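(* Let $N_1$ and $N_2$ be ideals of finite dimensional Lie algebras $L_1$ and $L_2$ respectively (over a field $F$), such that $(L_1*L_2,\,N_1*N_2)$ is a pair. Then: (i) $J_2(L_1*L_2,\,N_1*N_2)\simeq J_2(L_1,N_1)\oplus J_2(L_2,N_2)\oplus\left(\frac{N_1}{[N_1,L_1]}\otimes\frac{N_2}{[N_2,L_2]}\right)$; (ii) $(L_1*L_2)\,\square\,(N_1*N_2)\simeq (L_1\oplus L_2)\,\square\,(N_1\oplus N_2)$; (iii) $M(L_1*L_2,\,N_1*N_2)\simeq M(L_1,N_1)\oplus M(L_2,N_2)$, whenever $N_1$ admits a complement in $L_1$ such that $[N_1,L_1]=[L_1,L_1]$.
   Context: All Lie algebras are over a field $F$. A pair $(L,N)$ consists of a Lie algebra $L$ and an ideal $N$ of $L$. $L_1*L_2$ denotes the free product (coproduct) of Lie algebras, and $N_1*N_2$ is viewed in $L_1*L_2$ via the natural inclusions; $\oplus$ is the direct sum of Lie algebras. For a pair $(L,N)$, $L$ and $N$ act on each other by Lie multiplication: ${}^{l}n=[l,n]$, ${}^{n}l=[n,l]$ (and on themselves by ${}^ll'=[l,l']$, ${}^nn'=[n,n']$). The nonabelian tensor product $L\otimes N$ is the Lie algebra generated by symbols $l\otimes n$ ($l\in L$, $n\in N$) with defining relations, for all $c\in F$, $l,l'\in L$, $n,n'\in N$: $c(l\otimes n)=cl\otimes n=l\otimes cn$; $(l+l')\otimes n=l\otimes n+l'\otimes n$; $l\otimes(n+n')=l\otimes n+l\otimes n'$; ${}^ll'\otimes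 n=l\otimes{}^{l'}n-l'\otimes{}^ln$; $l\otimes{}^nn'={}^{n'}l\otimes n-{}^nl\otimes n'$; $[l\otimes n,l'\otimes n']=-\,{}^nl\otimes{}^{l'}n'$. The tensor product of the abelian Lie algebras $N_1/[N_1,L_1]$ and $N_2/[N_2,L_2]$ (with trivial mutual actions) is the usual abelian tensor product. The diagonal ideal is $L\,\square\,N=\langle n\otimes n\mid n\in L\cap N\rangle$, a central ideal of $L\otimes N$; the nonabelian exterior product is $L\wedge N=(L\otimes N)/(L\,\square\,N)$, with $l\wedge n$ the class of $l\otimes n$. $J_2(L,N)$ is the kernel of the epimorphism $\kappa_{L,N}:L\otimes N\to[L,N]$, $l\otimes n\mapsto[l,n]$. $M(L,N)$, the Schur multiplier of the pair $(L,N)$, is the abelian Lie algebra identified with the kernel of the epimorphism $\kappa'_{L,N}:L\wedge N\to[L,N]$, $l\wedge n\mapsto[l,n]$. *)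

theory Defs
  imports "Jordan_Normal_Form.Missing_VectorSpace" "HOL-Algebra.QuotRing"
begin

text \<open>
  A Lie algebra over \<open>F\<close> is carried by a record of type \<open>module\<close>. The multiplication of the
  underlying ring record is the Lie bracket, so that \<open>x \<otimes>\<^bsub>L\<^esub> y\<close> is \<open>[x, y]\<close>; the field
  \<open>one\<close> of the record plays no role. Subalgebras and ideals of \<open>L\<close> are sets, and
  \<open>L\<lparr>carrier := N\<rparr>\<close> is such a set regarded as a Lie algebra.
\<close>

locale lie_algebra = vectorspace F L for F and L (structure) +
  assumes bracket_closed: "\<lbrakk>x \<in> carrier L; y \<in> carrier L\<rbrakk> \<Longrightarrow> x \<otimes> y \<in> carrier L"
    and bracket_add_left: "\<lbrakk>x \<in> carrier L; y \<in> carrier L; z \<in> carrier L\<rbrakk>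
      \<Longrightarrow> (x \<oplus> y) \<otimes> z = (x \<otimes> z) \<oplus> (y \<otimes> z)"
    and bracket_add_right: "\<lbrakk>x \<in> carrier L; y \<in> carrier L; z \<in> carrier L\<rbrakk>
      \<Longrightarrow> x \<otimes> (y \<oplus> z) = (x \<otimes> y) \<oplus> (x \<otimes> z)"
    and bracket_smult_left: "\<lbrakk>c \<in> carrier F; x \<in> carrier L; y \<in> carrier L\<rbrakk>
      \<Longrightarrow> (c \<odot> x) \<otimes> y = c \<odot> (x \<otimes> y)"
    and bracket_smult_right: "\<lbrakk>c \<in> carrier F; x \<in> carrier L; y \<in> carrier L\<rbrakk>
      \<Longrightarrow> x \<otimes> (c \<odot> y) = c \<odot> (x \<otimes> y)"
    and bracket_self: "x \<in> carrier L \<Longrightarrow> x \<otimes> x = \<zero>"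
    and jacobi: "\<lbrakk>x \<in> carrier L; y \<in> carrier L; z \<in> carrier L\<rbrakk>
      \<Longrightarrow> (x \<otimes> (y \<otimes> z)) \<oplus> (y \<otimes> (z \<otimes> x)) \<oplus> (z \<otimes> (x \<otimes> y)) = \<zero>"

definition lie_subalgebra ::
  "('f, 'k) ring_scheme \<Rightarrow> 'a set \<Rightarrow> ('f, 'a, 'm) module_scheme \<Rightarrow> bool" where
  "lie_subalgebra F K L \<longleftrightarrow> subspace F K L \<and> (\<forall>x\<in>K. \<forall>y\<in>K. x \<otimes>\<^bsub>L\<^esub> y \<in> K)"

definition lie_ideal ::
  "('f, 'k) ring_scheme \<Rightarrow> 'a set \<Rightarrow> ('f, 'a, 'm) module_scheme \<Rightarrow> bool" where
  "lie_ideal F N L \<longleftrightarrow> subspace F N L \<and> (\<forall>x\<in>carrier L. \<forall>n\<in>N. x \<otimes>\<^bsub>L\<^esub> n \<in> N)"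

definition lie_pair ::
  "('f, 'k) ring_scheme \<Rightarrow> ('f, 'a, 'm) module_scheme \<Rightarrow> 'a set \<Rightarrow> bool" where
  "lie_pair F L N \<longleftrightarrow> lie_algebra F L \<and> lie_ideal F N L"

definition lie_ideal_generated ::
  "('f, 'k) ring_scheme \<Rightarrow> ('f, 'a, 'm) module_scheme \<Rightarrow> 'a set \<Rightarrow> 'a set" where
  "lie_ideal_generated F L S = \<Inter>{I. lie_ideal F I L \<and> S \<subseteq> I}"

definition lie_commutator ::
  "('f, 'k) ring_scheme \<Rightarrow> ('f, 'a, 'm) module_scheme \<Rightarrow> 'a set \<Rightarrow> 'a set \<Rightarrow> 'a set" where
  "lie_commutator F L A B = module.span F L {a \<otimes>\<^bsub>L\<^esub> b | a b. a \<in> A \<and> b \<in> B}"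

text \<open>
  As usual for Lie algebras, a complement of an ideal is a subalgebra, not just a subspace
  (a complementary subspace always exists).
\<close>

definition lie_complement ::
  "('f, 'k) ring_scheme \<Rightarrow> ('f, 'a, 'm) module_scheme \<Rightarrow> 'a set \<Rightarrow> 'a set \<Rightarrow> bool" where
  "lie_complement F L N K \<longleftrightarrow>
     lie_subalgebra F K L \<and> N \<inter> K = {\<zero>\<^bsub>L\<^esub>} \<and> N <+>\<^bsub>L\<^esub> K = carrier L"

definition lie_hom :: "('f, 'k) ring_scheme \<Rightarrow> ('f, 'a, 'm) module_scheme
    \<Rightarrow> ('f, 'b, 'n) module_scheme \<Rightarrow> ('a \<Rightarrow> 'b) set" where
  "lie_hom F A B = {h \<in> module_hom F A B.
     \<forall>x\<in>carrier A. \<forall>y\<in>carrier A. h (x \<otimes>\<^bsub>A\<^esub> y) = h x \<otimes>\<^bsub>B\<^esub> h y}"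

definition lie_isomorphic :: "('f, 'k) ring_scheme \<Rightarrow> ('f, 'a, 'm) module_scheme
    \<Rightarrow> ('f, 'b, 'n) module_scheme \<Rightarrow> bool" where
  "lie_isomorphic F A B \<longleftrightarrow> (\<exists>h\<in>lie_hom F A B. bij_betw h (carrier A) (carrier B))"

text \<open>The library's \<open>direct_sum\<close> has the zero multiplication; it is replaced by the bracket.\<close>

definition lie_direct_sum :: "('f, 'a, 'm) module_scheme \<Rightarrow> ('f, 'b, 'n) module_scheme
    \<Rightarrow> ('f, 'a \<times> 'b) module" where
  "lie_direct_sum A B =
     (direct_sum A B)\<lparr>mult := \<lambda>v w. (fst v \<otimes>\<^bsub>A\<^esub> fst w, snd v \<otimes>\<^bsub>B\<^esub> snd w)\<rparr>"

definition lie_quotient ::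
  "('f, 'a, 'm) module_scheme \<Rightarrow> 'a set \<Rightarrow> ('f, 'a set) module" where
  "lie_quotient L I =
     \<lparr>carrier = a_rcosets\<^bsub>L\<^esub> I, mult = rcoset_mult L I, one = undefined,
      zero = I, add = set_add L, smult = \<lambda>c A. \<Union>a\<in>A. I +>\<^bsub>L\<^esub> (c \<odot>\<^bsub>L\<^esub> a)\<rparr>"

definition lie_kernel :: "('f, 'a, 'm) module_scheme \<Rightarrow> ('f, 'b, 'n) module_scheme
    \<Rightarrow> ('a \<Rightarrow> 'b) \<Rightarrow> ('f, 'a, 'm) module_scheme" where
  "lie_kernel A B h = A\<lparr>carrier := {x \<in> carrier A. h x = \<zero>\<^bsub>B\<^esub>}\<rparr>"


subsection \<open>Lie algebras presented by generators and relations\<close>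

datatype ('f, 'x) lie_term =
    LGen 'x
  | LZero
  | LAdd "('f, 'x) lie_term" "('f, 'x) lie_term"
  | LSmult 'f "('f, 'x) lie_term"
  | LBracket "('f, 'x) lie_term" "('f, 'x) lie_term"

inductive_set lie_terms :: "('f, 'k) ring_scheme \<Rightarrow> 'x set \<Rightarrow> ('f, 'x) lie_term set"
  for F :: "('f, 'k) ring_scheme" and X :: "'x set" where
  gen: "x \<in> X \<Longrightarrow> LGen x \<in> lie_terms F X"
| zero: "LZero \<in> lie_terms F X"
| add: "\<lbrakk>s \<in> lie_terms F X; t \<in> lie_terms F X\<rbrakk> \<Longrightarrow> LAdd s t \<in> lie_terms F X"
| smult: "\<lbrakk>c \<in> carrier F; t \<in> lie_terms F X\<rbrakk> \<Longrightarrow> LSmult c t \<in> lie_terms F X"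
| bracket: "\<lbrakk>s \<in> lie_terms F X; t \<in> lie_terms F X\<rbrakk> \<Longrightarrow> LBracket s t \<in> lie_terms F X"

text \<open>
  The least congruence on \<open>lie_terms F X\<close> that contains the relations \<open>R\<close> and the Lie algebra
  axioms. Additive inverses are given by the scalar \<open>-1\<close>.
\<close>

inductive lie_pres_eq :: "('f, 'k) ring_scheme \<Rightarrow> 'x set
    \<Rightarrow> (('f, 'x) lie_term \<times> ('f, 'x) lie_term) set
    \<Rightarrow> ('f, 'x) lie_term \<Rightarrow> ('f, 'x) lie_term \<Rightarrow> bool"
  for F :: "('f, 'k) ring_scheme" and X :: "'x set"
    and R :: "(('f, 'x) lie_term \<times> ('f, 'x) lie_term) set" where
  rel: "\<lbrakk>(s, t) \<in> R; s \<in> lie_terms F X; t \<in> lie_terms F X\<rbrakk> \<Longrightarrow> lie_pres_eq F X R s t"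
| refl: "t \<in> lie_terms F X \<Longrightarrow> lie_pres_eq F X R t t"
| sym: "lie_pres_eq F X R s t \<Longrightarrow> lie_pres_eq F X R t s"
| trans: "\<lbrakk>lie_pres_eq F X R s t; lie_pres_eq F X R t u\<rbrakk> \<Longrightarrow> lie_pres_eq F X R s u"
| add_cong: "\<lbrakk>lie_pres_eq F X R s s'; lie_pres_eq F X R t t'\<rbrakk>
    \<Longrightarrow> lie_pres_eq F X R (LAdd s t) (LAdd s' t')"
| smult_cong: "\<lbrakk>c \<in> carrier F; lie_pres_eq F X R t t'\<rbrakk>
    \<Longrightarrow> lie_pres_eq F X R (LSmult c t) (LSmult c t')"
| bracket_cong: "\<lbrakk>lie_pres_eq F X R s s'; lie_pres_eq F X R t t'\<rbrakk>
    \<Longrightarrow> lie_pres_eq F X R (LBracket s t) (LBracket s' t')"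
| add_assoc: "\<lbrakk>s \<in> lie_terms F X; t \<in> lie_terms F X; u \<in> lie_terms F X\<rbrakk>
    \<Longrightarrow> lie_pres_eq F X R (LAdd (LAdd s t) u) (LAdd s (LAdd t u))"
| add_comm: "\<lbrakk>s \<in> lie_terms F X; t \<in> lie_terms F X\<rbrakk>
    \<Longrightarrow> lie_pres_eq F X R (LAdd s t) (LAdd t s)"
| add_zero: "t \<in> lie_terms F X \<Longrightarrow> lie_pres_eq F X R (LAdd LZero t) t"
| zero_smult: "t \<in> lie_terms F X \<Longrightarrow> lie_pres_eq F X R (LSmult \<zero>\<^bsub>F\<^esub> t) LZero"
| one_smult: "t \<in> lie_terms F X \<Longrightarrow> lie_pres_eq F X R (LSmult \<one>\<^bsub>F\<^esub> t) t"
| smult_smult: "\<lbrakk>c \<in> carrier F; d \<in> carrier F; t \<in> lie_terms F X\<rbrakk>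
    \<Longrightarrow> lie_pres_eq F X R (LSmult (c \<otimes>\<^bsub>F\<^esub> d) t) (LSmult c (LSmult d t))"
| smult_add_left: "\<lbrakk>c \<in> carrier F; d \<in> carrier F; t \<in> lie_terms F X\<rbrakk>
    \<Longrightarrow> lie_pres_eq F X R (LSmult (c \<oplus>\<^bsub>F\<^esub> d) t) (LAdd (LSmult c t) (LSmult d t))"
| smult_add_right: "\<lbrakk>c \<in> carrier F; s \<in> lie_terms F X; t \<in> lie_terms F X\<rbrakk>
    \<Longrightarrow> lie_pres_eq F X R (LSmult c (LAdd s t)) (LAdd (LSmult c s) (LSmult c t))"
| bracket_add_left: "\<lbrakk>s \<in> lie_terms F X; t \<in> lie_terms F X; u \<in> lie_terms F X\<rbrakk>
    \<Longrightarrow> lie_pres_eq F X R (LBracket (LAdd s t) u) (LAdd (LBracket s u) (LBracket t u))"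
| bracket_add_right: "\<lbrakk>s \<in> lie_terms F X; t \<in> lie_terms F X; u \<in> lie_terms F X\<rbrakk>
    \<Longrightarrow> lie_pres_eq F X R (LBracket s (LAdd t u)) (LAdd (LBracket s t) (LBracket s u))"
| bracket_smult_left: "\<lbrakk>c \<in> carrier F; s \<in> lie_terms F X; t \<in> lie_terms F X\<rbrakk>
    \<Longrightarrow> lie_pres_eq F X R (LBracket (LSmult c s) t) (LSmult c (LBracket s t))"
| bracket_smult_right: "\<lbrakk>c \<in> carrier F; s \<in> lie_terms F X; t \<in> lie_terms F X\<rbrakk>
    \<Longrightarrow> lie_pres_eq F X R (LBracket s (LSmult c t)) (LSmult c (LBracket s t))"
| bracket_self: "t \<in> lie_terms F X \<Longrightarrow> lie_pres_eq F X R (LBracket t t) LZero"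
| jacobi: "\<lbrakk>s \<in> lie_terms F X; t \<in> lie_terms F X; u \<in> lie_terms F X\<rbrakk>
    \<Longrightarrow> lie_pres_eq F X R
          (LAdd (LAdd (LBracket s (LBracket t u)) (LBracket t (LBracket u s)))
                (LBracket u (LBracket s t))) LZero"

definition lie_pres_class :: "('f, 'k) ring_scheme \<Rightarrow> 'x set
    \<Rightarrow> (('f, 'x) lie_term \<times> ('f, 'x) lie_term) set
    \<Rightarrow> ('f, 'x) lie_term \<Rightarrow> ('f, 'x) lie_term set" where
  "lie_pres_class F X R t = {u. lie_pres_eq F X R t u}"

definition lie_pres :: "('f, 'k) ring_scheme \<Rightarrow> 'x set
    \<Rightarrow> (('f, 'x) lie_term \<times> ('f, 'x) lie_term) set
    \<Rightarrow> ('f, ('f, 'x) lie_term set) module" where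
  "lie_pres F X R =
     \<lparr>carrier = lie_pres_class F X R ` lie_terms F X,
      mult = \<lambda>A B. \<Union>s\<in>A. \<Union>t\<in>B. lie_pres_class F X R (LBracket s t),
      one = undefined,
      zero = lie_pres_class F X R LZero,
      add = \<lambda>A B. \<Union>s\<in>A. \<Union>t\<in>B. lie_pres_class F X R (LAdd s t),
      smult = \<lambda>c A. \<Union>t\<in>A. lie_pres_class F X R (LSmult c t)\<rparr>"

primrec lie_eval ::
  "('f, 'a, 'm) module_scheme \<Rightarrow> ('x \<Rightarrow> 'a) \<Rightarrow> ('f, 'x) lie_term \<Rightarrow> 'a" where
  "lie_eval A f (LGen x) = f x"
| "lie_eval A f LZero = \<zero>\<^bsub>A\<^esub>"
| "lie_eval A f (LAdd s t) = lie_eval A f s \<oplus>\<^bsub>A\<^esub> lie_eval A f t"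
| "lie_eval A f (LSmult c t) = c \<odot>\<^bsub>A\<^esub> lie_eval A f t"
| "lie_eval A f (LBracket s t) = lie_eval A f s \<otimes>\<^bsub>A\<^esub> lie_eval A f t"

text \<open>
  The homomorphism from a presented Lie algebra to \<open>A\<close> that sends each generator \<open>x\<close> to \<open>f x\<close>;
  meaningful when \<open>f\<close> respects the defining relations.
\<close>

definition lie_pres_lift ::
  "('f, 'a, 'm) module_scheme \<Rightarrow> ('x \<Rightarrow> 'a) \<Rightarrow> ('f, 'x) lie_term set \<Rightarrow> 'a" where
  "lie_pres_lift A f C = the_elem (lie_eval A f ` C)"


subsection \<open>Free products\<close>

definition lie_alg_rels :: "('f, 'k) ring_scheme \<Rightarrow> ('f, 'a, 'm) module_scheme \<Rightarrow> ('a \<Rightarrow> 'x)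
    \<Rightarrow> (('f, 'x) lie_term \<times> ('f, 'x) lie_term) set" where
  "lie_alg_rels F L g =
     {(LGen (g (x \<oplus>\<^bsub>L\<^esub> y)), LAdd (LGen (g x)) (LGen (g y))) | x y.
        x \<in> carrier L \<and> y \<in> carrier L} \<union>
     {(LGen (g (c \<odot>\<^bsub>L\<^esub> x)), LSmult c (LGen (g x))) | c x.
        c \<in> carrier F \<and> x \<in> carrier L} \<union>
     {(LGen (g (x \<otimes>\<^bsub>L\<^esub> y)), LBracket (LGen (g x)) (LGen (g y))) | x y.
        x \<in> carrier L \<and> y \<in> carrier L}"

definition lie_free_product_rels :: "('f, 'k) ring_scheme \<Rightarrow> ('f, 'a, 'm) module_scheme
    \<Rightarrow> ('f, 'b, 'n) module_scheme
    \<Rightarrow> (('f, 'a + 'b) lie_term \<times> ('f, 'a + 'b) lie_term) set" where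
  "lie_free_product_rels F L1 L2 = lie_alg_rels F L1 Inl \<union> lie_alg_rels F L2 Inr"

definition lie_free_product :: "('f, 'k) ring_scheme \<Rightarrow> ('f, 'a, 'm) module_scheme
    \<Rightarrow> ('f, 'b, 'n) module_scheme \<Rightarrow> ('f, ('f, 'a + 'b) lie_term set) module" where
  "lie_free_product F L1 L2 =
     lie_pres F (carrier L1 <+> carrier L2) (lie_free_product_rels F L1 L2)"

text \<open>
  The natural map \<open>L1 \<union> L2 \<rightarrow> L1 * L2\<close>, given on \<open>L1\<close> by \<open>Inl\<close> and on \<open>L2\<close> by \<open>Inr\<close>.
\<close>

definition lie_free_product_incl :: "('f, 'k) ring_scheme \<Rightarrow> ('f, 'a, 'm) module_scheme
    \<Rightarrow> ('f, 'b, 'n) module_scheme \<Rightarrow> 'a + 'b \<Rightarrow> ('f, 'a + 'b) lie_term set" where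
  "lie_free_product_incl F L1 L2 z =
     lie_pres_class F (carrier L1 <+> carrier L2) (lie_free_product_rels F L1 L2) (LGen z)"

text \<open>
  \<open>N1 * N2\<close> viewed in \<open>L1 * L2\<close>: the image of the homomorphism \<open>N1 * N2 \<rightarrow> L1 * L2\<close> induced by
  the inclusions of \<open>N1\<close> in \<open>L1\<close> and of \<open>N2\<close> in \<open>L2\<close>.
\<close>

definition lie_free_product_sub :: "('f, 'k) ring_scheme \<Rightarrow> ('f, 'a, 'm) module_scheme
    \<Rightarrow> ('f, 'b, 'n) module_scheme \<Rightarrow> 'a set \<Rightarrow> 'b set
    \<Rightarrow> ('f, 'a + 'b) lie_term set set" where
  "lie_free_product_sub F L1 L2 N1 N2 =
     lie_pres_lift (lie_free_product F L1 L2) (lie_free_product_incl F L1 L2) `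
       carrier (lie_free_product F (L1\<lparr>carrier := N1\<rparr>) (L2\<lparr>carrier := N2\<rparr>))"


subsection \<open>Nonabelian tensor and exterior products\<close>

text \<open>
  The nonabelian tensor product of Lie algebras \<open>M\<close> and \<open>N\<close> acting on each other: \<open>a m n\<close> is the
  action of \<open>m\<close> on \<open>n\<close>, and \<open>b n m\<close> that of \<open>n\<close> on \<open>m\<close>. The generator \<open>(m, n)\<close> is the symbol
  \<open>m \<otimes> n\<close>.
\<close>

definition lie_tensor_rels :: "('f, 'k) ring_scheme \<Rightarrow> ('f, 'a, 'm) module_scheme
    \<Rightarrow> ('f, 'b, 'n) module_scheme \<Rightarrow> ('a \<Rightarrow> 'b \<Rightarrow> 'b) \<Rightarrow> ('b \<Rightarrow> 'a \<Rightarrow> 'a)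
    \<Rightarrow> (('f, 'a \<times> 'b) lie_term \<times> ('f, 'a \<times> 'b) lie_term) set" where
  "lie_tensor_rels F M N a b =
     (let neg = LSmult (\<ominus>\<^bsub>F\<^esub> \<one>\<^bsub>F\<^esub>) in
     {(LSmult c (LGen (m, n)), LGen (c \<odot>\<^bsub>M\<^esub> m, n)) | c m n.
        c \<in> carrier F \<and> m \<in> carrier M \<and> n \<in> carrier N} \<union>
     {(LSmult c (LGen (m, n)), LGen (m, c \<odot>\<^bsub>N\<^esub> n)) | c m n.
        c \<in> carrier F \<and> m \<in> carrier M \<and> n \<in> carrier N} \<union>
     {(LGen (m \<oplus>\<^bsub>M\<^esub> m', n), LAdd (LGen (m, n)) (LGen (m', n))) | m m' n.
        m \<in> carrier M \<and> m' \<in> carrier M \<and> n \<in> carrier N} \<union>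
     {(LGen (m, n \<oplus>\<^bsub>N\<^esub> n'), LAdd (LGen (m, n)) (LGen (m, n'))) | m n n'.
        m \<in> carrier M \<and> n \<in> carrier N \<and> n' \<in> carrier N} \<union>
     {(LGen (m \<otimes>\<^bsub>M\<^esub> m', n), LAdd (LGen (m, a m' n)) (neg (LGen (m', a m n)))) | m m' n.
        m \<in> carrier M \<and> m' \<in> carrier M \<and> n \<in> carrier N} \<union>
     {(LGen (m, n \<otimes>\<^bsub>N\<^esub> n'), LAdd (LGen (b n' m, n)) (neg (LGen (b n m, n')))) | m n n'.
        m \<in> carrier M \<and> n \<in> carrier N \<and> n' \<in> carrier N} \<union>
     {(LBracket (LGen (m, n)) (LGen (m', n')), neg (LGen (b n m, a m' n'))) | m n m' n'.
        m \<in> carrier M \<and> n \<in> carrier N \<and> m' \<in> carrier M \<and> n' \<in> carrier N})"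

definition lie_tensor :: "('f, 'k) ring_scheme \<Rightarrow> ('f, 'a, 'm) module_scheme
    \<Rightarrow> ('f, 'b, 'n) module_scheme \<Rightarrow> ('a \<Rightarrow> 'b \<Rightarrow> 'b) \<Rightarrow> ('b \<Rightarrow> 'a \<Rightarrow> 'a)
    \<Rightarrow> ('f, ('f, 'a \<times> 'b) lie_term set) module" where
  "lie_tensor F M N a b = lie_pres F (carrier M \<times> carrier N) (lie_tensor_rels F M N a b)"

definition lie_tensor_trivial :: "('f, 'k) ring_scheme \<Rightarrow> ('f, 'a, 'm) module_scheme
    \<Rightarrow> ('f, 'b, 'n) module_scheme \<Rightarrow> ('f, ('f, 'a \<times> 'b) lie_term set) module" where
  "lie_tensor_trivial F M N = lie_tensor F M N (\<lambda>_ _. \<zero>\<^bsub>N\<^esub>) (\<lambda>_ _. \<zero>\<^bsub>M\<^esub>)"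

definition pair_tensor :: "('f, 'k) ring_scheme \<Rightarrow> ('f, 'a, 'm) module_scheme \<Rightarrow> 'a set
    \<Rightarrow> ('f, ('f, 'a \<times> 'a) lie_term set) module" where
  "pair_tensor F L N = lie_tensor F L (L\<lparr>carrier := N\<rparr>) (mult L) (mult L)"

definition pair_tensor_elem :: "('f, 'k) ring_scheme \<Rightarrow> ('f, 'a, 'm) module_scheme \<Rightarrow> 'a set
    \<Rightarrow> 'a \<Rightarrow> 'a \<Rightarrow> ('f, 'a \<times> 'a) lie_term set" where
  "pair_tensor_elem F L N l n =
     lie_pres_class F (carrier L \<times> N)
       (lie_tensor_rels F L (L\<lparr>carrier := N\<rparr>) (mult L) (mult L)) (LGen (l, n))"

definition diagonal_ideal :: "('f, 'k) ring_scheme \<Rightarrow> ('f, 'a, 'm) module_scheme \<Rightarrow> 'a set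
    \<Rightarrow> ('f, 'a \<times> 'a) lie_term set set" where
  "diagonal_ideal F L N =
     lie_ideal_generated F (pair_tensor F L N)
       {pair_tensor_elem F L N n n | n. n \<in> carrier L \<inter> N}"

definition pair_square :: "('f, 'k) ring_scheme \<Rightarrow> ('f, 'a, 'm) module_scheme \<Rightarrow> 'a set
    \<Rightarrow> ('f, ('f, 'a \<times> 'a) lie_term set) module" where
  "pair_square F L N = (pair_tensor F L N)\<lparr>carrier := diagonal_ideal F L N\<rparr>"

definition pair_exterior :: "('f, 'k) ring_scheme \<Rightarrow> ('f, 'a, 'm) module_scheme \<Rightarrow> 'a set
    \<Rightarrow> ('f, ('f, 'a \<times> 'a) lie_term set set) module" where
  "pair_exterior F L N = lie_quotient (pair_tensor F L N) (diagonal_ideal F L N)"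

text \<open>
  The commutator maps are given the codomain \<open>L\<close> instead of \<open>[L, N]\<close>, which does not affect
  their kernels.
\<close>

definition pair_kappa ::
  "('f, 'a, 'm) module_scheme \<Rightarrow> ('f, 'a \<times> 'a) lie_term set \<Rightarrow> 'a" where
  "pair_kappa L = lie_pres_lift L (\<lambda>(l, n). l \<otimes>\<^bsub>L\<^esub> n)"

definition pair_kappa_ext ::
  "('f, 'a, 'm) module_scheme \<Rightarrow> ('f, 'a \<times> 'a) lie_term set set \<Rightarrow> 'a" where
  "pair_kappa_ext L W = the_elem (pair_kappa L ` W)"

definition J2 :: "('f, 'k) ring_scheme \<Rightarrow> ('f, 'a, 'm) module_scheme \<Rightarrow> 'a set
    \<Rightarrow> ('f, ('f, 'a \<times> 'a) lie_term set) module" where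
  "J2 F L N = lie_kernel (pair_tensor F L N) L (pair_kappa L)"

definition schur_multiplier :: "('f, 'k) ring_scheme \<Rightarrow> ('f, 'a, 'm) module_scheme \<Rightarrow> 'a set
    \<Rightarrow> ('f, ('f, 'a \<times> 'a) lie_term set set) module" where
  "schur_multiplier F L N = lie_kernel (pair_exterior F L N) L (pair_kappa_ext L)"

text \<open>The abelian Lie algebra \<open>N/[N, L]\<close>.\<close>

definition pair_abelianization :: "('f, 'k) ring_scheme \<Rightarrow> ('f, 'a, 'm) module_scheme
    \<Rightarrow> 'a set \<Rightarrow> ('f, 'a set) module" where
  "pair_abelianization F L N =
     lie_quotient (L\<lparr>carrier := N\<rparr>) (lie_commutator F L N (carrier L))"

end

theory Submission imports Defs begin

text \<open>
  Write \<open>L = L1 * L2\<close>, let \<open>N\<close> be the subalgebra of \<open>L\<close> generated by \<open>N1\<close> and \<open>N2\<close>, and let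
  \<open>T = L \<otimes> N\<close>.

  That \<open>N\<close> is an ideal of \<open>L\<close> is a strong hypothesis. If \<open>l \<in> L1\<close> is not in \<open>N1\<close> and
  \<open>0 \<noteq> n \<in> N2\<close>, then \<open>[l, n]\<close> is not in \<open>N\<close>, and symmetrically (\<open>bracket_not_in_sub\<close>). Hence either
  \<open>N1 = L1\<close> and \<open>N2 = L2\<close>, or one of the two algebras is zero, or \<open>N1 = N2 = 0\<close>
  (\<open>sub_ideal_cases\<close>). The proof needs enough of the Poincare-Birkhoff-Witt theorem to tell
  elements of a free product apart: words in the letters of two bases, adapted to \<open>N1\<close> and \<open>N2\<close>, are
  straightened separately inside each factor, by the diamond argument, and \<open>L\<close> acts on the functions
  of words that are compatible with straightening.

  For the isomorphisms, the inclusions of \<open>L1\<close> and \<open>L2\<close> induce maps \<open>i1\<close> and \<open>i2\<close> into \<open>T\<close>, and the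
  symmetrized tensors \<open>x \<otimes> y + y \<otimes> x\<close> with \<open>x \<in> N1\<close>, \<open>y \<in> N2\<close> vanish as soon as \<open>x\<close> or \<open>y\<close> is a
  commutator (\<open>symmetrized_bracket\<close>), so that they induce a map \<open>sym_map\<close> from
  \<open>W = N1/[N1, L1] \<otimes> N2/[N2, L2]\<close> to \<open>T\<close>. These three maps have left inverses that annihilate the
  images of the other two and that factor through the tensor product of the pair
  \<open>(L1 \<oplus> L2, N1 \<oplus> N2)\<close>. So everything follows once each element of \<open>J2(L, N)\<close> is a sum of elements
  in the three images. (i) is then immediate. For (ii), the diagonal ideal of \<open>T\<close> lies in
  \<open>J2(L, N)\<close>, where the map to the tensor product of \<open>(L1 \<oplus> L2, N1 \<oplus> N2)\<close> has become injective. For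
  (iii), the image of \<open>W\<close> lies in the diagonal ideal by polarization, so that it disappears from the
  exterior product.

  The decomposition is the point at which the freeness of \<open>L\<close> enters (\<open>kappa_kernel_decomposes\<close>).
  Assume \<open>N1 = L1\<close> and \<open>N2 = L2\<close>, let \<open>I\<close> (\<open>split_kernel\<close>) be the set of all sums in question, with the first two
  summands coming from \<open>J2(L1, L1)\<close> and \<open>J2(L2, L2)\<close>, and let \<open>q\<close> be the projection of \<open>T\<close> to \<open>T/I\<close>.
  The map \<open>q(x \<otimes> y)\<close> is an alternating 2-cocycle on \<open>L\<close> and so defines a central extension of \<open>L\<close> by
  \<open>T/I\<close>. Its restriction to \<open>L1\<close> splits: since \<open>J2(L1, L1)\<close> is killed, \<open>q(x \<otimes> y)\<close> depends linearly on
  \<open>[x, y]\<close>, and this linear map on \<open>[L1, L1]\<close> extends to \<open>L1\<close>. The same holds for \<open>L2\<close>. By the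
  universal property of the free product the whole extension splits, which means that
  \<open>q(x \<otimes> y) = \<sigma>[x, y]\<close> for a linear map \<open>\<sigma>\<close> on \<open>L\<close>. Thus \<open>q = \<sigma> \<kappa>\<close>, and the kernel of \<open>\<kappa>\<close> lies in
  \<open>I\<close>. In the degenerate cases \<open>T\<close> is zero or the image of \<open>i1\<close> or \<open>i2\<close>.
\<close>


section \<open>Lie algebras and their homomorphisms\<close>

context lie_algebra
begin

lemma bracket_zero_left [simp]: "x \<in> carrier L \<Longrightarrow> \<zero> \<otimes> x = \<zero>"
  using bracket_smult_left[of "\<zero>\<^bsub>F\<^esub>" x x] bracket_self[of x] bracket_closed[of "\<zero>" x]
    bracket_smult_left[of "\<zero>\<^bsub>F\<^esub>" "\<zero>" x] by (simp add: bracket_closed)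

lemma bracket_zero_right [simp]: "x \<in> carrier L \<Longrightarrow> x \<otimes> \<zero> = \<zero>"
  using bracket_smult_right[of "\<zero>\<^bsub>F\<^esub>" x "\<zero>"] bracket_closed[of x "\<zero>"] by simp

lemma neg_eq_smult: "x \<in> carrier L \<Longrightarrow> \<ominus> x = (\<ominus>\<^bsub>F\<^esub> \<one>\<^bsub>F\<^esub>) \<odot> x"
  by (simp add: smult_minus_1)

lemma bracket_neg_left: "\<lbrakk>x \<in> carrier L; y \<in> carrier L\<rbrakk> \<Longrightarrow> (\<ominus> x) \<otimes> y = \<ominus> (x \<otimes> y)"
  by (simp add: neg_eq_smult bracket_smult_left bracket_closed)

lemma bracket_neg_right: "\<lbrakk>x \<in> carrier L; y \<in> carrier L\<rbrakk> \<Longrightarrow> x \<otimes> (\<ominus> y) = \<ominus> (x \<otimes> y)"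
  by (simp add: neg_eq_smult bracket_smult_right bracket_closed)

lemma bracket_swap:
  assumes "x \<in> carrier L" "y \<in> carrier L"
  shows "y \<otimes> x = \<ominus> (x \<otimes> y)"
proof -
  have "\<zero> = (x \<oplus> y) \<otimes> (x \<oplus> y)"
    using assms by (simp add: bracket_self)
  also have "\<dots> = (x \<otimes> x \<oplus> y \<otimes> x) \<oplus> (x \<otimes> y \<oplus> y \<otimes> y)"
    using assms by (simp add: bracket_add_left bracket_add_right bracket_closed del: bracket_self)
  also have "\<dots> = y \<otimes> x \<oplus> x \<otimes> y"
    using assms by (simp add: bracket_self bracket_closed)
  finally have "y \<otimes> x \<oplus> x \<otimes> y = \<zero>" by simp
  then show ?thesis
    using assms by (simp add: bracket_closed M.minus_equality)
qed

end

lemma lie_homI: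
  assumes "\<And>x. x \<in> carrier A \<Longrightarrow> h x \<in> carrier B"
    and "\<And>x y. \<lbrakk>x \<in> carrier A; y \<in> carrier A\<rbrakk> \<Longrightarrow> h (x \<oplus>\<^bsub>A\<^esub> y) = h x \<oplus>\<^bsub>B\<^esub> h y"
    and "\<And>c x. \<lbrakk>c \<in> carrier F; x \<in> carrier A\<rbrakk> \<Longrightarrow> h (c \<odot>\<^bsub>A\<^esub> x) = c \<odot>\<^bsub>B\<^esub> h x"
    and "\<And>x y. \<lbrakk>x \<in> carrier A; y \<in> carrier A\<rbrakk> \<Longrightarrow> h (x \<otimes>\<^bsub>A\<^esub> y) = h x \<otimes>\<^bsub>B\<^esub> h y"
  shows "h \<in> lie_hom F A B"
  using assms by (auto simp: lie_hom_def module_hom_def)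

lemma lie_homD:
  assumes "h \<in> lie_hom F A B"
  shows "x \<in> carrier A \<Longrightarrow> h x \<in> carrier B"
    and "\<lbrakk>x \<in> carrier A; y \<in> carrier A\<rbrakk> \<Longrightarrow> h (x \<oplus>\<^bsub>A\<^esub> y) = h x \<oplus>\<^bsub>B\<^esub> h y"
    and "\<lbrakk>c \<in> carrier F; x \<in> carrier A\<rbrakk> \<Longrightarrow> h (c \<odot>\<^bsub>A\<^esub> x) = c \<odot>\<^bsub>B\<^esub> h x"
    and "\<lbrakk>x \<in> carrier A; y \<in> carrier A\<rbrakk> \<Longrightarrow> h (x \<otimes>\<^bsub>A\<^esub> y) = h x \<otimes>\<^bsub>B\<^esub> h y"
  using assms by (auto simp: lie_hom_def module_hom_def)

lemma lie_hom_zero: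
  assumes "h \<in> lie_hom F A B" "lie_algebra F A" "lie_algebra F B"
  shows "h \<zero>\<^bsub>A\<^esub> = \<zero>\<^bsub>B\<^esub>"
proof -
  interpret A: lie_algebra F A by fact
  interpret B: lie_algebra F B by fact
  have "h (\<zero>\<^bsub>F\<^esub> \<odot>\<^bsub>A\<^esub> \<zero>\<^bsub>A\<^esub>) = \<zero>\<^bsub>F\<^esub> \<odot>\<^bsub>B\<^esub> h \<zero>\<^bsub>A\<^esub>"
    by (rule lie_homD[OF assms(1)]) auto
  then show ?thesis
    using lie_homD(1)[OF assms(1), of "\<zero>\<^bsub>A\<^esub>"] by simp
qed

lemma lie_hom_neg:
  assumes "h \<in> lie_hom F A B" "lie_algebra F A" "lie_algebra F B" "x \<in> carrier A"
  shows "h (\<ominus>\<^bsub>A\<^esub> x) = \<ominus>\<^bsub>B\<^esub> h x"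
proof -
  interpret A: lie_algebra F A by fact
  interpret B: lie_algebra F B by fact
  show ?thesis
    using assms(4) lie_homD(1)[OF assms(1,4)]
    by (simp add: A.neg_eq_smult B.neg_eq_smult lie_homD(3)[OF assms(1)])
qed

lemma lie_hom_comp:
  "\<lbrakk>h \<in> lie_hom F A B; g \<in> lie_hom F B C\<rbrakk> \<Longrightarrow> (\<lambda>x. g (h x)) \<in> lie_hom F A C"
  by (auto simp: lie_hom_def module_hom_def Pi_iff)

lemma lie_hom_zero_map: "\<lbrakk>lie_algebra F A; lie_algebra F B\<rbrakk> \<Longrightarrow> (\<lambda>_. \<zero>\<^bsub>B\<^esub>) \<in> lie_hom F A B"
proof -
  assume "lie_algebra F A" "lie_algebra F B"
  then interpret B: lie_algebra F B by simp
  show ?thesis by (rule lie_homI) (auto)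
qed

lemma lie_idealD:
  assumes "lie_ideal F N L"
  shows "N \<subseteq> carrier L" and "\<zero>\<^bsub>L\<^esub> \<in> N"
    and "\<lbrakk>x \<in> N; y \<in> N\<rbrakk> \<Longrightarrow> x \<oplus>\<^bsub>L\<^esub> y \<in> N"
    and "\<lbrakk>c \<in> carrier F; x \<in> N\<rbrakk> \<Longrightarrow> c \<odot>\<^bsub>L\<^esub> x \<in> N"
    and "\<lbrakk>x \<in> carrier L; y \<in> N\<rbrakk> \<Longrightarrow> x \<otimes>\<^bsub>L\<^esub> y \<in> N"
proof -
  interpret submodule F N L using assms by (simp add: lie_ideal_def subspace_def)
  show "N \<subseteq> carrier L" "\<zero>\<^bsub>L\<^esub> \<in> N"
    "\<lbrakk>x \<in> N; y \<in> N\<rbrakk> \<Longrightarrow> x \<oplus>\<^bsub>L\<^esub> y \<in> N"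
    "\<lbrakk>c \<in> carrier F; x \<in> N\<rbrakk> \<Longrightarrow> c \<odot>\<^bsub>L\<^esub> x \<in> N"
    using subset by auto
  show "\<lbrakk>x \<in> carrier L; y \<in> N\<rbrakk> \<Longrightarrow> x \<otimes>\<^bsub>L\<^esub> y \<in> N"
    using assms by (simp add: lie_ideal_def)
qed

lemma lie_idealI:
  assumes "lie_algebra F L" "N \<subseteq> carrier L" "\<zero>\<^bsub>L\<^esub> \<in> N"
    and "\<And>x y. \<lbrakk>x \<in> N; y \<in> N\<rbrakk> \<Longrightarrow> x \<oplus>\<^bsub>L\<^esub> y \<in> N"
    and "\<And>c x. \<lbrakk>c \<in> carrier F; x \<in> N\<rbrakk> \<Longrightarrow> c \<odot>\<^bsub>L\<^esub> x \<in> N"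
    and "\<And>x y. \<lbrakk>x \<in> carrier L; y \<in> N\<rbrakk> \<Longrightarrow> x \<otimes>\<^bsub>L\<^esub> y \<in> N"
  shows "lie_ideal F N L"
proof -
  interpret lie_algebra F L by fact
  have "vectorspace F L" by unfold_locales
  moreover have "submodule F N L"
    using assms by (intro submodule.intro is_module) (auto intro: module_axioms)
  ultimately show ?thesis
    using assms by (auto simp: lie_ideal_def subspace_def)
qed

lemma lie_ideal_minus:
  assumes "lie_ideal F N L" "lie_algebra F L" "x \<in> N"
  shows "\<ominus>\<^bsub>L\<^esub> x \<in> N"
proof -
  interpret lie_algebra F L by fact
  show ?thesis
    using lie_idealD(4)[OF assms(1), of "\<ominus>\<^bsub>F\<^esub> \<one>\<^bsub>F\<^esub>" x] lie_idealD(1)[OF assms(1)] assms(3)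
    by (auto simp: neg_eq_smult)
qed

lemma lie_ideal_bracket_left:
  assumes "lie_ideal F N L" "lie_algebra F L" "x \<in> N" "y \<in> carrier L"
  shows "x \<otimes>\<^bsub>L\<^esub> y \<in> N"
proof -
  interpret lie_algebra F L by fact
  have "x \<in> carrier L" using assms lie_idealD(1) by blast
  then show ?thesis
    using bracket_swap[of y x] lie_ideal_minus[OF assms(1,2)] lie_idealD(5)[OF assms(1,4,3)] assms
    by auto
qed

lemma lie_algebraI:
  assumes "field F"
    and "\<zero>\<^bsub>L\<^esub> \<in> carrier L"
    and "\<And>x y. \<lbrakk>x \<in> carrier L; y \<in> carrier L\<rbrakk> \<Longrightarrow> x \<oplus>\<^bsub>L\<^esub> y \<in> carrier L"
    and "\<And>x. x \<in> carrier L \<Longrightarrow> \<exists>y\<in>carrier L. x \<oplus>\<^bsub>L\<^esub> y = \<zero>\<^bsub>L\<^esub>"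
    and "\<And>c x. \<lbrakk>c \<in> carrier F; x \<in> carrier L\<rbrakk> \<Longrightarrow> c \<odot>\<^bsub>L\<^esub> x \<in> carrier L"
    and "\<And>x y. \<lbrakk>x \<in> carrier L; y \<in> carrier L\<rbrakk> \<Longrightarrow> x \<oplus>\<^bsub>L\<^esub> y = y \<oplus>\<^bsub>L\<^esub> x"
    and "\<And>x y z. \<lbrakk>x \<in> carrier L; y \<in> carrier L; z \<in> carrier L\<rbrakk>
      \<Longrightarrow> (x \<oplus>\<^bsub>L\<^esub> y) \<oplus>\<^bsub>L\<^esub> z = x \<oplus>\<^bsub>L\<^esub> (y \<oplus>\<^bsub>L\<^esub> z)"
    and "\<And>x. x \<in> carrier L \<Longrightarrow> x \<oplus>\<^bsub>L\<^esub> \<zero>\<^bsub>L\<^esub> = x"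
    and "\<And>c d x. \<lbrakk>c \<in> carrier F; d \<in> carrier F; x \<in> carrier L\<rbrakk>
      \<Longrightarrow> (c \<otimes>\<^bsub>F\<^esub> d) \<odot>\<^bsub>L\<^esub> x = c \<odot>\<^bsub>L\<^esub> (d \<odot>\<^bsub>L\<^esub> x)"
    and "\<And>x. x \<in> carrier L \<Longrightarrow> \<one>\<^bsub>F\<^esub> \<odot>\<^bsub>L\<^esub> x = x"
    and "\<And>c d x. \<lbrakk>c \<in> carrier F; d \<in> carrier F; x \<in> carrier L\<rbrakk>
      \<Longrightarrow> (c \<oplus>\<^bsub>F\<^esub> d) \<odot>\<^bsub>L\<^esub> x = (c \<odot>\<^bsub>L\<^esub> x) \<oplus>\<^bsub>L\<^esub> (d \<odot>\<^bsub>L\<^esub> x)"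
    and "\<And>c x y. \<lbrakk>c \<in> carrier F; x \<in> carrier L; y \<in> carrier L\<rbrakk>
      \<Longrightarrow> c \<odot>\<^bsub>L\<^esub> (x \<oplus>\<^bsub>L\<^esub> y) = (c \<odot>\<^bsub>L\<^esub> x) \<oplus>\<^bsub>L\<^esub> (c \<odot>\<^bsub>L\<^esub> y)"
    and "\<And>x y. \<lbrakk>x \<in> carrier L; y \<in> carrier L\<rbrakk> \<Longrightarrow> x \<otimes>\<^bsub>L\<^esub> y \<in> carrier L"
    and "\<And>x y z. \<lbrakk>x \<in> carrier L; y \<in> carrier L; z \<in> carrier L\<rbrakk>
      \<Longrightarrow> (x \<oplus>\<^bsub>L\<^esub> y) \<otimes>\<^bsub>L\<^esub> z = (x \<otimes>\<^bsub>L\<^esub> z) \<oplus>\<^bsub>L\<^esub> (y \<otimes>\<^bsub>L\<^esub> z)"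
    and "\<And>x y z. \<lbrakk>x \<in> carrier L; y \<in> carrier L; z \<in> carrier L\<rbrakk>
      \<Longrightarrow> x \<otimes>\<^bsub>L\<^esub> (y \<oplus>\<^bsub>L\<^esub> z) = (x \<otimes>\<^bsub>L\<^esub> y) \<oplus>\<^bsub>L\<^esub> (x \<otimes>\<^bsub>L\<^esub> z)"
    and "\<And>c x y. \<lbrakk>c \<in> carrier F; x \<in> carrier L; y \<in> carrier L\<rbrakk>
      \<Longrightarrow> (c \<odot>\<^bsub>L\<^esub> x) \<otimes>\<^bsub>L\<^esub> y = c \<odot>\<^bsub>L\<^esub> (x \<otimes>\<^bsub>L\<^esub> y)"
    and "\<And>c x y. \<lbrakk>c \<in> carrier F; x \<in> carrier L; y \<in> carrier L\<rbrakk>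
      \<Longrightarrow> x \<otimes>\<^bsub>L\<^esub> (c \<odot>\<^bsub>L\<^esub> y) = c \<odot>\<^bsub>L\<^esub> (x \<otimes>\<^bsub>L\<^esub> y)"
    and "\<And>x. x \<in> carrier L \<Longrightarrow> x \<otimes>\<^bsub>L\<^esub> x = \<zero>\<^bsub>L\<^esub>"
    and "\<And>x y z. \<lbrakk>x \<in> carrier L; y \<in> carrier L; z \<in> carrier L\<rbrakk>
      \<Longrightarrow> (x \<otimes>\<^bsub>L\<^esub> (y \<otimes>\<^bsub>L\<^esub> z)) \<oplus>\<^bsub>L\<^esub> (y \<otimes>\<^bsub>L\<^esub> (z \<otimes>\<^bsub>L\<^esub> x)) \<oplus>\<^bsub>L\<^esub> (z \<otimes>\<^bsub>L\<^esub> (x \<otimes>\<^bsub>L\<^esub> y)) = \<zero>\<^bsub>L\<^esub>"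
  shows "lie_algebra F L"
proof -
  interpret field F by fact
  have "module F L"
    using assms by (intro module_criteria is_cring) simp_all
  then have "vectorspace F L"
    by (simp add: vectorspace_def field_axioms)
  then show ?thesis
    using assms by (simp add: lie_algebra_def lie_algebra_axioms_def)
qed

lemma lie_ideal_is_lie_algebra:
  assumes "lie_ideal F N L" "lie_algebra F L"
  shows "lie_algebra F (L\<lparr>carrier := N\<rparr>)"
proof -
  interpret lie_algebra F L by fact
  note N = lie_idealD[OF assms(1)]
  have sub: "x \<in> N \<Longrightarrow> x \<in> carrier L" for x using N(1) by blast
  have "vectorspace F (L\<lparr>carrier := N\<rparr>)"
    using subspace_is_vs assms(1) by (simp add: lie_ideal_def)
  then show ?thesis
    using N sub by (simp add: lie_algebra_def lie_algebra_axioms_def bracket_add_left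
      bracket_add_right bracket_smult_left bracket_smult_right bracket_self jacobi)
qed

section \<open>Presentations\<close>

locale lie_presentation = field F for F :: "('f, 'k) ring_scheme" (structure) +
  fixes X :: "'x set" and R :: "(('f, 'x) lie_term \<times> ('f, 'x) lie_term) set"
begin

abbreviation "terms \<equiv> lie_terms F X"
abbreviation "eqv \<equiv> lie_pres_eq F X R"
abbreviation "cls \<equiv> lie_pres_class F X R"
abbreviation "P \<equiv> lie_pres F X R"

lemma eqv_terms: "eqv s t \<Longrightarrow> s \<in> terms \<and> t \<in> terms"
  by (induction rule: lie_pres_eq.induct) (auto intro!: lie_terms.intros)

lemma cls_eq_iff: "\<lbrakk>s \<in> terms; t \<in> terms\<rbrakk> \<Longrightarrow> cls s = cls t \<longleftrightarrow> eqv s t"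
  unfolding lie_pres_class_def
  by (auto intro: lie_pres_eq.intros)

lemma cls_eqI: "eqv s t \<Longrightarrow> cls s = cls t"
  using cls_eq_iff eqv_terms by blast

lemma carrier_P: "carrier P = cls ` terms"
  by (simp add: lie_pres_def)

lemma cls_closed: "t \<in> terms \<Longrightarrow> cls t \<in> carrier P"
  by (simp add: carrier_P)

lemma zero_P: "\<zero>\<^bsub>P\<^esub> = cls LZero"
  by (simp add: lie_pres_def)

lemma cls_UN:
  assumes "t \<in> terms" "\<And>u. eqv t u \<Longrightarrow> G u = G t"
  shows "(\<Union>u\<in>cls t. G u) = G t"
  using assms lie_pres_eq.refl[OF assms(1)] unfolding lie_pres_class_def by blast

lemma add_cls:
  assumes "s \<in> terms" "t \<in> terms"
  shows "cls s \<oplus>\<^bsub>P\<^esub> cls t = cls (LAdd s t)"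
proof -
  have "(\<Union>v\<in>cls t. cls (LAdd u v)) = cls (LAdd u t)" if "eqv s u" for u
    using that assms eqv_terms
    by (intro cls_UN cls_eqI) (auto intro: lie_pres_eq.intros)
  then have "(\<Union>u\<in>cls s. \<Union>v\<in>cls t. cls (LAdd u v)) = (\<Union>u\<in>cls s. cls (LAdd u t))"
    by (auto simp: lie_pres_class_def)
  also have "\<dots> = cls (LAdd s t)"
    using assms eqv_terms by (intro cls_UN cls_eqI) (auto intro: lie_pres_eq.intros)
  finally show ?thesis by (simp add: lie_pres_def)
qed

lemma bracket_cls:
  assumes "s \<in> terms" "t \<in> terms"
  shows "cls s \<otimes>\<^bsub>P\<^esub> cls t = cls (LBracket s t)"
proof -
  have "(\<Union>v\<in>cls t. cls (LBracket u v)) = cls (LBracket u t)" if "eqv s u" for u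
    using that assms eqv_terms
    by (intro cls_UN cls_eqI) (auto intro: lie_pres_eq.intros)
  then have "(\<Union>u\<in>cls s. \<Union>v\<in>cls t. cls (LBracket u v)) = (\<Union>u\<in>cls s. cls (LBracket u t))"
    by (auto simp: lie_pres_class_def)
  also have "\<dots> = cls (LBracket s t)"
    using assms eqv_terms by (intro cls_UN cls_eqI) (auto intro: lie_pres_eq.intros)
  finally show ?thesis by (simp add: lie_pres_def)
qed

lemma smult_cls:
  assumes "c \<in> carrier F" "t \<in> terms"
  shows "c \<odot>\<^bsub>P\<^esub> cls t = cls (LSmult c t)"
proof -
  have "(\<Union>v\<in>cls t. cls (LSmult c v)) = cls (LSmult c t)"
    using assms eqv_terms by (intro cls_UN cls_eqI) (auto intro: lie_pres_eq.intros)
  then show ?thesis by (simp add: lie_pres_def)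
qed

lemmas op_cls = add_cls bracket_cls smult_cls zero_P

lemma carrier_P_cases:
  assumes "x \<in> carrier P"
  obtains t where "t \<in> terms" "x = cls t"
  using assms by (auto simp: carrier_P)

lemma lie_algebra_P: "lie_algebra F P"
proof (rule lie_algebraI)
  show "field F" by (rule field_axioms)
  show "\<exists>y\<in>carrier P. x \<oplus>\<^bsub>P\<^esub> y = \<zero>\<^bsub>P\<^esub>" if "x \<in> carrier P" for x
  proof -
    from that obtain t where t: "t \<in> terms" "x = cls t" by (rule carrier_P_cases)
    have "eqv (LSmult (\<one> \<oplus> \<ominus> \<one>) t) (LAdd (LSmult \<one> t) (LSmult (\<ominus> \<one>) t))"
      using t by (intro lie_pres_eq.smult_add_left) auto
    moreover have "eqv (LAdd (LSmult \<one> t) (LSmult (\<ominus> \<one>) t)) (LAdd t (LSmult (\<ominus> \<one>) t))"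
      using t by (intro lie_pres_eq.add_cong lie_pres_eq.one_smult lie_pres_eq.refl
          lie_terms.intros) auto
    moreover have "eqv (LSmult \<zero> t) LZero"
      using t by (intro lie_pres_eq.zero_smult)
    ultimately have "eqv (LAdd t (LSmult (\<ominus> \<one>) t)) LZero"
      by (metis lie_pres_eq.sym lie_pres_eq.trans one_closed r_neg)
    then show ?thesis
      using t by (intro bexI[of _ "cls (LSmult (\<ominus> \<one>) t)"] cls_closed)
        (auto simp: op_cls lie_terms.intros intro!: cls_eqI)
  qed
  show "x \<oplus>\<^bsub>P\<^esub> \<zero>\<^bsub>P\<^esub> = x" if "x \<in> carrier P" for x
  proof -
    from that obtain t where t: "t \<in> terms" "x = cls t" by (rule carrier_P_cases)
    have "eqv (LAdd t LZero) (LAdd LZero t)" "eqv (LAdd LZero t) t"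
      using t by (auto intro: lie_pres_eq.intros lie_terms.intros)
    then have "cls (LAdd t LZero) = cls t"
      by (rule cls_eqI[OF lie_pres_eq.trans])
    then show ?thesis
      using t by (simp add: op_cls lie_terms.intros)
  qed
qed ((elim carrier_P_cases)?; simp add: op_cls cls_closed cls_eq_iff lie_terms.intros
      lie_pres_eq.intros(8-))+

lemma P_induct [consumes 1, case_names gen zero add smult bracket]:
  assumes "x \<in> carrier P"
    and gen: "\<And>g. g \<in> X \<Longrightarrow> Q (cls (LGen g))"
    and zero: "Q \<zero>\<^bsub>P\<^esub>"
    and add: "\<And>x y. \<lbrakk>x \<in> carrier P; y \<in> carrier P; Q x; Q y\<rbrakk> \<Longrightarrow> Q (x \<oplus>\<^bsub>P\<^esub> y)"
    and smult: "\<And>c x. \<lbrakk>c \<in> carrier F; x \<in> carrier P; Q x\<rbrakk> \<Longrightarrow> Q (c \<odot>\<^bsub>P\<^esub> x)"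
    and bracket: "\<And>x y. \<lbrakk>x \<in> carrier P; y \<in> carrier P; Q x; Q y\<rbrakk> \<Longrightarrow> Q (x \<otimes>\<^bsub>P\<^esub> y)"
  shows "Q x"
proof -
  obtain t where t: "t \<in> terms" "x = cls t" using assms(1) by (rule carrier_P_cases)
  from t(1) have "Q (cls t)"
  proof induction
    case (gen g) then show ?case by (rule assms)
  next
    case zero show ?case using assms(3) by (simp add: zero_P)
  next
    case (add s t)
    then show ?case using assms(4)[of "cls s" "cls t"] by (simp add: op_cls cls_closed)
  next
    case (smult c t)
    then show ?case using assms(5)[of c "cls t"] by (simp add: op_cls cls_closed)
  next
    case (bracket s t)
    then show ?case using assms(6)[of "cls s" "cls t"] by (simp add: op_cls cls_closed)
  qed
  with t show ?thesis by simp
qed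

lemma hom_ext:
  assumes "h \<in> lie_hom F P A" "k \<in> lie_hom F P A" "lie_algebra F A"
    and "\<And>g. g \<in> X \<Longrightarrow> h (cls (LGen g)) = k (cls (LGen g))"
    and "x \<in> carrier P"
  shows "h x = k x"
  using assms(5)
  by (induction rule: P_induct)
    (auto simp: assms(4) lie_homD[OF assms(1)] lie_homD[OF assms(2)]
      lie_hom_zero[OF assms(1) lie_algebra_P assms(3)] lie_hom_zero[OF assms(2) lie_algebra_P assms(3)])

lemma rel_cls: "\<lbrakk>(s, t) \<in> R; s \<in> terms; t \<in> terms\<rbrakk> \<Longrightarrow> cls s = cls t"
  by (intro cls_eqI lie_pres_eq.rel)

text \<open>
  The universal property in the direction needed for free products: generators that satisfy the
  relations of the multiplication table of \<open>L\<close> form a homomorphic image of \<open>L\<close>.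
\<close>

lemma alg_rels_hom:
  assumes L: "lie_algebra F L" and g: "\<And>x. x \<in> carrier L \<Longrightarrow> g x \<in> X"
    and R: "lie_alg_rels F L g \<subseteq> R"
  shows "(\<lambda>x. cls (LGen (g x))) \<in> lie_hom F L P"
proof -
  interpret L: lie_algebra F L by fact
  have rel: "cls s = cls t" if "(s, t) \<in> lie_alg_rels F L g" "s \<in> terms" "t \<in> terms" for s t
    using that R by (intro rel_cls) auto
  show ?thesis
  proof (rule lie_homI)
    show "cls (LGen (g x)) \<in> carrier P" if "x \<in> carrier L" for x
      using that g by (intro cls_closed lie_terms.intros)
    show "cls (LGen (g (x \<oplus>\<^bsub>L\<^esub> y))) = cls (LGen (g x)) \<oplus>\<^bsub>P\<^esub> cls (LGen (g y))"
      if "x \<in> carrier L" "y \<in> carrier L" for x y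
      using rel[of "LGen (g (x \<oplus>\<^bsub>L\<^esub> y))" "LAdd (LGen (g x)) (LGen (g y))"] that g
      by (auto simp: op_cls lie_alg_rels_def lie_terms.intros)
    show "cls (LGen (g (c \<odot>\<^bsub>L\<^esub> x))) = c \<odot>\<^bsub>P\<^esub> cls (LGen (g x))"
      if "c \<in> carrier F" "x \<in> carrier L" for c x
      using rel[of "LGen (g (c \<odot>\<^bsub>L\<^esub> x))" "LSmult c (LGen (g x))"] that g
      by (auto simp: op_cls lie_alg_rels_def lie_terms.intros)
    show "cls (LGen (g (x \<otimes>\<^bsub>L\<^esub> y))) = cls (LGen (g x)) \<otimes>\<^bsub>P\<^esub> cls (LGen (g y))"
      if "x \<in> carrier L" "y \<in> carrier L" for x y
      using rel[of "LGen (g (x \<otimes>\<^bsub>L\<^esub> y))" "LBracket (LGen (g x)) (LGen (g y))"] that g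
      by (auto simp: op_cls lie_alg_rels_def lie_terms.intros L.bracket_closed)
  qed
qed

lemma eval_self: "t \<in> terms \<Longrightarrow> lie_eval P (\<lambda>g. cls (LGen g)) t = cls t"
  by (induction rule: lie_terms.induct) (auto simp: op_cls)

end

lemma lie_eval_closed:
  assumes "lie_algebra F A" "\<And>g. g \<in> X \<Longrightarrow> f g \<in> carrier A" "t \<in> lie_terms F X"
  shows "lie_eval A f t \<in> carrier A"
proof -
  interpret A: lie_algebra F A by fact
  show ?thesis
    using assms(3) by induction (auto simp: assms(2) A.bracket_closed)
qed

locale lie_pres_hom = lie_presentation F X R + A: lie_algebra F A
  for F :: "('f, 'k) ring_scheme" (structure) and X :: "'x set" and R
    and A :: "('f, 'c, 'm) module_scheme" +
  fixes f :: "'x \<Rightarrow> 'c"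
  assumes f_closed: "g \<in> X \<Longrightarrow> f g \<in> carrier A"
    and f_rel: "\<lbrakk>(s, t) \<in> R; s \<in> terms; t \<in> terms\<rbrakk> \<Longrightarrow> lie_eval A f s = lie_eval A f t"
begin

lemma eval_closed: "t \<in> terms \<Longrightarrow> lie_eval A f t \<in> carrier A"
  using lie_eval_closed[of F A X f t] f_closed A.lie_algebra_axioms by blast

lemma eval_eqv: "eqv s t \<Longrightarrow> lie_eval A f s = lie_eval A f t"
proof (induction rule: lie_pres_eq.induct)
  case (rel s t) then show ?case by (rule f_rel)
next
  case (add_comm s t) then show ?case by (simp add: eval_closed A.M.a_comm)
next
  case (add_assoc s t u) then show ?case by (simp add: eval_closed A.M.a_assoc)
qed (auto simp: eval_closed A.bracket_closed A.bracket_self A.bracket_add_left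
      A.bracket_add_right A.bracket_smult_left A.bracket_smult_right A.jacobi
      A.smult_assoc1 A.smult_l_distr A.smult_r_distr)

lemma lift_cls: "t \<in> terms \<Longrightarrow> lie_pres_lift A f (cls t) = lie_eval A f t"
proof -
  assume t: "t \<in> terms"
  have "lie_eval A f ` cls t = {lie_eval A f t}"
    using eval_eqv lie_pres_eq.refl[OF t] unfolding lie_pres_class_def
    by (auto simp: image_iff)
  then show ?thesis by (simp add: lie_pres_lift_def)
qed

lemma lift_gen: "g \<in> X \<Longrightarrow> lie_pres_lift A f (cls (LGen g)) = f g"
  by (simp add: lift_cls lie_terms.intros)

lemma lift_hom: "lie_pres_lift A f \<in> lie_hom F P A"
  by (rule lie_homI)
    (auto elim!: carrier_P_cases simp: lift_cls op_cls lie_terms.intros eval_closed)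

end


section \<open>Nonabelian tensor products\<close>

lemma (in lie_algebra) bracket_bracket_left:
  assumes "x \<in> carrier L" "y \<in> carrier L" "z \<in> carrier L"
  shows "(x \<otimes> y) \<otimes> z = x \<otimes> (y \<otimes> z) \<oplus> \<ominus> (y \<otimes> (x \<otimes> z))"
proof -
  note cl = bracket_closed
  have "x \<otimes> (y \<otimes> z) \<oplus> y \<otimes> (z \<otimes> x) = (x \<otimes> y) \<otimes> z"
    using jacobi[OF assms] bracket_swap[of "x \<otimes> y" z] assms cl
    by (simp add: M.minus_equality M.add.inv_solve_right')
  moreover have "y \<otimes> (z \<otimes> x) = \<ominus> (y \<otimes> (x \<otimes> z))"
    using assms cl by (simp add: bracket_swap[of x z] bracket_neg_right)
  ultimately show ?thesis by simp
qed

lemma (in lie_algebra) bracket_bracket_right: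
  assumes "x \<in> carrier L" "y \<in> carrier L" "z \<in> carrier L"
  shows "x \<otimes> (y \<otimes> z) = (z \<otimes> x) \<otimes> y \<oplus> \<ominus> ((y \<otimes> x) \<otimes> z)"
proof -
  note cl = bracket_closed
  have 1: "x \<otimes> (y \<otimes> z) = \<ominus> ((y \<otimes> z) \<otimes> x)"
    using assms cl by (intro bracket_swap)
  have 2: "(z \<otimes> x) \<otimes> y = \<ominus> (y \<otimes> (z \<otimes> x))" "(y \<otimes> x) \<otimes> z = \<ominus> (z \<otimes> (y \<otimes> x))"
    using assms cl by (intro bracket_swap; simp)+
  show ?thesis
    using assms cl by (simp add: 1 2 bracket_bracket_left[of y z x] M.minus_add)
qed

locale lie_actions = M: lie_algebra F M + N: lie_algebra F N
  for F :: "('f, 'k) ring_scheme" and M :: "('f, 'a, 'm) module_scheme"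
    and N :: "('f, 'b, 'n) module_scheme" +
  fixes a :: "'a \<Rightarrow> 'b \<Rightarrow> 'b" and b :: "'b \<Rightarrow> 'a \<Rightarrow> 'a"
  assumes a_closed: "\<lbrakk>m \<in> carrier M; n \<in> carrier N\<rbrakk> \<Longrightarrow> a m n \<in> carrier N"
    and b_closed: "\<lbrakk>m \<in> carrier M; n \<in> carrier N\<rbrakk> \<Longrightarrow> b n m \<in> carrier M"
begin

abbreviation "T \<equiv> lie_tensor F M N a b"
abbreviation "gen m n \<equiv>
  lie_pres_class F (carrier M \<times> carrier N) (lie_tensor_rels F M N a b) (LGen (m, n))"

sublocale pres: lie_presentation F "carrier M \<times> carrier N" "lie_tensor_rels F M N a b"
  by unfold_locales

lemma T_def: "T = pres.P"
  by (simp add: lie_tensor_def)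

sublocale T: lie_algebra F T
  unfolding T_def by (rule pres.lie_algebra_P)

lemma gen_closed [simp]: "\<lbrakk>m \<in> carrier M; n \<in> carrier N\<rbrakk> \<Longrightarrow> gen m n \<in> carrier T"
  unfolding T_def by (intro pres.cls_closed lie_terms.intros) auto

lemma gen_smult_left:
  assumes "c \<in> carrier F" "m \<in> carrier M" "n \<in> carrier N"
  shows "gen (c \<odot>\<^bsub>M\<^esub> m) n = c \<odot>\<^bsub>T\<^esub> gen m n"
proof -
  have "(LSmult c (LGen (m, n)), LGen (c \<odot>\<^bsub>M\<^esub> m, n)) \<in> lie_tensor_rels F M N a b"
    unfolding lie_tensor_rels_def Let_def
    by (rule UnI1, rule UnI1, rule UnI1, rule UnI1, rule UnI1, rule UnI1, rule CollectI, rule exI[of _ c], rule exI[of _ m], rule exI[of _ n], simp add: assms)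
  from pres.rel_cls[OF this] show ?thesis
    using assms by (simp add: T_def pres.op_cls lie_terms.intros)
qed

lemma gen_smult_right:
  assumes "c \<in> carrier F" "m \<in> carrier M" "n \<in> carrier N"
  shows "gen m (c \<odot>\<^bsub>N\<^esub> n) = c \<odot>\<^bsub>T\<^esub> gen m n"
proof -
  have "(LSmult c (LGen (m, n)), LGen (m, c \<odot>\<^bsub>N\<^esub> n)) \<in> lie_tensor_rels F M N a b"
    unfolding lie_tensor_rels_def Let_def
    by (rule UnI1, rule UnI1, rule UnI1, rule UnI1, rule UnI1, rule UnI2, rule CollectI, rule exI[of _ c], rule exI[of _ m], rule exI[of _ n], simp add: assms)
  from pres.rel_cls[OF this] show ?thesis
    using assms by (simp add: T_def pres.op_cls lie_terms.intros)
qed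

lemma gen_add_left:
  assumes "m \<in> carrier M" "m' \<in> carrier M" "n \<in> carrier N"
  shows "gen (m \<oplus>\<^bsub>M\<^esub> m') n = gen m n \<oplus>\<^bsub>T\<^esub> gen m' n"
proof -
  have "(LGen (m \<oplus>\<^bsub>M\<^esub> m', n), LAdd (LGen (m, n)) (LGen (m', n))) \<in> lie_tensor_rels F M N a b"
    unfolding lie_tensor_rels_def Let_def
    by (rule UnI1, rule UnI1, rule UnI1, rule UnI1, rule UnI2, rule CollectI, rule exI[of _ m], rule exI[of _ m'], rule exI[of _ n], simp add: assms)
  from pres.rel_cls[OF this] show ?thesis
    using assms by (simp add: T_def pres.op_cls lie_terms.intros)
qed

lemma gen_add_right:
  assumes "m \<in> carrier M" "n \<in> carrier N" "n' \<in> carrier N"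
  shows "gen m (n \<oplus>\<^bsub>N\<^esub> n') = gen m n \<oplus>\<^bsub>T\<^esub> gen m n'"
proof -
  have "(LGen (m, n \<oplus>\<^bsub>N\<^esub> n'), LAdd (LGen (m, n)) (LGen (m, n'))) \<in> lie_tensor_rels F M N a b"
    unfolding lie_tensor_rels_def Let_def
    by (rule UnI1, rule UnI1, rule UnI1, rule UnI2, rule CollectI, rule exI[of _ m], rule exI[of _ n], rule exI[of _ n'], simp add: assms)
  from pres.rel_cls[OF this] show ?thesis
    using assms by (simp add: T_def pres.op_cls lie_terms.intros)
qed

lemma gen_bracket_left:
  assumes "m \<in> carrier M" "m' \<in> carrier M" "n \<in> carrier N"
  shows "gen (m \<otimes>\<^bsub>M\<^esub> m') n = gen m (a m' n) \<oplus>\<^bsub>T\<^esub> \<ominus>\<^bsub>T\<^esub> gen m' (a m n)"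
proof -
  have "(LGen (m \<otimes>\<^bsub>M\<^esub> m', n), LAdd (LGen (m, a m' n))
      (LSmult (\<ominus>\<^bsub>F\<^esub> \<one>\<^bsub>F\<^esub>) (LGen (m', a m n)))) \<in> lie_tensor_rels F M N a b"
    unfolding lie_tensor_rels_def Let_def
    by (rule UnI1, rule UnI1, rule UnI2, rule CollectI, rule exI[of _ m], rule exI[of _ m'], rule exI[of _ n], simp add: assms)
  from pres.rel_cls[OF this] show ?thesis
    using assms a_closed b_closed
    by (simp add: T.neg_eq_smult)
      (simp add: T_def pres.op_cls lie_terms.intros M.bracket_closed)
qed

lemma gen_bracket_right:
  assumes "m \<in> carrier M" "n \<in> carrier N" "n' \<in> carrier N"
  shows "gen m (n \<otimes>\<^bsub>N\<^esub> n') = gen (b n' m) n \<oplus>\<^bsub>T\<^esub> \<ominus>\<^bsub>T\<^esub> gen (b n m) n'"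
proof -
  have "(LGen (m, n \<otimes>\<^bsub>N\<^esub> n'), LAdd (LGen (b n' m, n))
      (LSmult (\<ominus>\<^bsub>F\<^esub> \<one>\<^bsub>F\<^esub>) (LGen (b n m, n')))) \<in> lie_tensor_rels F M N a b"
    unfolding lie_tensor_rels_def Let_def
    by (rule UnI1, rule UnI2, rule CollectI, rule exI[of _ m], rule exI[of _ n], rule exI[of _ n'], simp add: assms)
  from pres.rel_cls[OF this] show ?thesis
    using assms a_closed b_closed
    by (simp add: T.neg_eq_smult)
      (simp add: T_def pres.op_cls lie_terms.intros N.bracket_closed)
qed

lemma bracket_gen:
  assumes "m \<in> carrier M" "n \<in> carrier N" "m' \<in> carrier M" "n' \<in> carrier N"
  shows "gen m n \<otimes>\<^bsub>T\<^esub> gen m' n' = \<ominus>\<^bsub>T\<^esub> gen (b n m) (a m' n')"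
proof -
  have "(LBracket (LGen (m, n)) (LGen (m', n')),
      LSmult (\<ominus>\<^bsub>F\<^esub> \<one>\<^bsub>F\<^esub>) (LGen (b n m, a m' n'))) \<in> lie_tensor_rels F M N a b"
    unfolding lie_tensor_rels_def Let_def
    by (rule UnI2, rule CollectI, rule exI[of _ m], rule exI[of _ n], rule exI[of _ m'], rule exI[of _ n'], simp add: assms)
  from pres.rel_cls[OF this] show ?thesis
    using assms a_closed b_closed
    by (simp add: T.neg_eq_smult) (simp add: T_def pres.op_cls lie_terms.intros)
qed

text \<open>
  The bracket of two generators is again minus a generator, so the generators span the tensor
  product linearly.
\<close>

inductive_set tensor_span :: "('f, 'a \<times> 'b) lie_term set set" where
  gen: "\<lbrakk>m \<in> carrier M; n \<in> carrier N\<rbrakk> \<Longrightarrow> gen m n \<in> tensor_span"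
| zero: "\<zero>\<^bsub>T\<^esub> \<in> tensor_span"
| add: "\<lbrakk>x \<in> tensor_span; y \<in> tensor_span\<rbrakk> \<Longrightarrow> x \<oplus>\<^bsub>T\<^esub> y \<in> tensor_span"
| smult: "\<lbrakk>c \<in> carrier F; x \<in> tensor_span\<rbrakk> \<Longrightarrow> c \<odot>\<^bsub>T\<^esub> x \<in> tensor_span"

lemma tensor_span_closed: "x \<in> tensor_span \<Longrightarrow> x \<in> carrier T"
  by (induction rule: tensor_span.induct) auto

lemma tensor_span_bracket:
  assumes "x \<in> tensor_span" "y \<in> tensor_span"
  shows "x \<otimes>\<^bsub>T\<^esub> y \<in> tensor_span"
  using assms(1)
proof induction
  case (gen m n)
  from assms(2) show ?case
  proof induction
    case (gen m' n')
    have "(\<ominus>\<^bsub>F\<^esub> \<one>\<^bsub>F\<^esub>) \<odot>\<^bsub>T\<^esub> pres.cls (LGen (b n m, a m' n')) \<in> tensor_span"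
      using gen \<open>m \<in> carrier M\<close> \<open>n \<in> carrier N\<close>
      by (intro tensor_span.intros a_closed b_closed) auto
    then show ?case
      using gen \<open>m \<in> carrier M\<close> \<open>n \<in> carrier N\<close> a_closed b_closed
      by (simp add: bracket_gen T.neg_eq_smult)
  qed (use gen in \<open>auto simp: T.bracket_add_right T.bracket_smult_right tensor_span_closed
        intro: tensor_span.intros\<close>)
qed (use assms(2) in \<open>auto simp: T.bracket_add_left T.bracket_smult_left tensor_span_closed
      intro: tensor_span.intros\<close>)

lemma carrier_T: "carrier T = tensor_span"
proof
  show "tensor_span \<subseteq> carrier T" using tensor_span_closed by blast
  show "carrier T \<subseteq> tensor_span"
  proof
    fix x assume "x \<in> carrier T"
    then have "x \<in> carrier pres.P" by (simp add: T_def)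
    then show "x \<in> tensor_span"
      by (induction rule: pres.P_induct)
        (auto simp: T_def[symmetric] intro: tensor_span.intros tensor_span_bracket)
  qed
qed

lemma T_induct [consumes 1, case_names gen zero add smult]:
  assumes "x \<in> carrier T"
    and "\<And>m n. \<lbrakk>m \<in> carrier M; n \<in> carrier N\<rbrakk> \<Longrightarrow> Q (gen m n)"
    and "Q \<zero>\<^bsub>T\<^esub>"
    and "\<And>x y. \<lbrakk>x \<in> carrier T; y \<in> carrier T; Q x; Q y\<rbrakk> \<Longrightarrow> Q (x \<oplus>\<^bsub>T\<^esub> y)"
    and "\<And>c x. \<lbrakk>c \<in> carrier F; x \<in> carrier T; Q x\<rbrakk> \<Longrightarrow> Q (c \<odot>\<^bsub>T\<^esub> x)"
  shows "Q x"
  using assms(1) unfolding carrier_T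
  by induction (auto simp: assms carrier_T[symmetric])

lemma T_lift:
  assumes A: "lie_algebra F A"
    and cl: "\<And>m n. \<lbrakk>m \<in> carrier M; n \<in> carrier N\<rbrakk> \<Longrightarrow> g m n \<in> carrier A"
    and "\<And>c m n. \<lbrakk>c \<in> carrier F; m \<in> carrier M; n \<in> carrier N\<rbrakk>
      \<Longrightarrow> g (c \<odot>\<^bsub>M\<^esub> m) n = c \<odot>\<^bsub>A\<^esub> g m n"
    and "\<And>c m n. \<lbrakk>c \<in> carrier F; m \<in> carrier M; n \<in> carrier N\<rbrakk>
      \<Longrightarrow> g m (c \<odot>\<^bsub>N\<^esub> n) = c \<odot>\<^bsub>A\<^esub> g m n"
    and "\<And>m m' n. \<lbrakk>m \<in> carrier M; m' \<in> carrier M; n \<in> carrier N\<rbrakk>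
      \<Longrightarrow> g (m \<oplus>\<^bsub>M\<^esub> m') n = g m n \<oplus>\<^bsub>A\<^esub> g m' n"
    and "\<And>m n n'. \<lbrakk>m \<in> carrier M; n \<in> carrier N; n' \<in> carrier N\<rbrakk>
      \<Longrightarrow> g m (n \<oplus>\<^bsub>N\<^esub> n') = g m n \<oplus>\<^bsub>A\<^esub> g m n'"
    and "\<And>m m' n. \<lbrakk>m \<in> carrier M; m' \<in> carrier M; n \<in> carrier N\<rbrakk>
      \<Longrightarrow> g (m \<otimes>\<^bsub>M\<^esub> m') n = g m (a m' n) \<oplus>\<^bsub>A\<^esub> \<ominus>\<^bsub>A\<^esub> g m' (a m n)"
    and "\<And>m n n'. \<lbrakk>m \<in> carrier M; n \<in> carrier N; n' \<in> carrier N\<rbrakk>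
      \<Longrightarrow> g m (n \<otimes>\<^bsub>N\<^esub> n') = g (b n' m) n \<oplus>\<^bsub>A\<^esub> \<ominus>\<^bsub>A\<^esub> g (b n m) n'"
    and "\<And>m n m' n'. \<lbrakk>m \<in> carrier M; n \<in> carrier N; m' \<in> carrier M; n' \<in> carrier N\<rbrakk>
      \<Longrightarrow> g m n \<otimes>\<^bsub>A\<^esub> g m' n' = \<ominus>\<^bsub>A\<^esub> g (b n m) (a m' n')"
  shows "lie_pres_lift A (\<lambda>(m, n). g m n) \<in> lie_hom F T A"
    and "\<lbrakk>m \<in> carrier M; n \<in> carrier N\<rbrakk> \<Longrightarrow> lie_pres_lift A (\<lambda>(m, n). g m n) (gen m n) = g m n"
proof -
  interpret A: lie_algebra F A by fact
  interpret lie_pres_hom F "carrier M \<times> carrier N" "lie_tensor_rels F M N a b" A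
    "\<lambda>(m, n). g m n"
  proof
    fix s t assume "(s, t) \<in> lie_tensor_rels F M N a b"
    then show "lie_eval A (\<lambda>(m, n). g m n) s = lie_eval A (\<lambda>(m, n). g m n) t"
      unfolding lie_tensor_rels_def Let_def
      by (auto simp: assms(3-) cl a_closed b_closed A.neg_eq_smult[symmetric])
  qed (auto simp: cl)
  show "lie_pres_lift A (\<lambda>(m, n). g m n) \<in> lie_hom F T A"
    using lift_hom by (simp add: T_def)
  show "\<lbrakk>m \<in> carrier M; n \<in> carrier N\<rbrakk> \<Longrightarrow> lie_pres_lift A (\<lambda>(m, n). g m n) (gen m n) = g m n"
    by (subst lift_gen) auto
qed

lemma T_hom_ext:
  assumes "h \<in> lie_hom F T A" "k \<in> lie_hom F T A" "lie_algebra F A"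
    and "\<And>m n. \<lbrakk>m \<in> carrier M; n \<in> carrier N\<rbrakk> \<Longrightarrow> h (gen m n) = k (gen m n)"
    and "x \<in> carrier T"
  shows "h x = k x"
  using pres.hom_ext[of h A k x] assms by (auto simp: T_def)

end

section \<open>The tensor product of a pair\<close>

locale lie_pair_tensor =
  fixes F :: "('f, 'k) ring_scheme" and L :: "('f, 'a, 'm) module_scheme" and N :: "'a set"
  assumes pair: "lie_pair F L N"
begin

sublocale lie_algebra F L
  using pair by (simp add: lie_pair_def)

lemma ideal_N: "lie_ideal F N L"
  using pair by (simp add: lie_pair_def)

lemmas N_closed = lie_idealD[OF ideal_N]
  and N_bracket_left = lie_ideal_bracket_left[OF ideal_N lie_algebra_axioms]

lemma N_sub: "n \<in> N \<Longrightarrow> n \<in> carrier L"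
  using N_closed(1) by blast

lemma N_lie_algebra: "lie_algebra F (L\<lparr>carrier := N\<rparr>)"
  by (rule lie_ideal_is_lie_algebra[OF ideal_N lie_algebra_axioms])

sublocale act: lie_actions F L "L\<lparr>carrier := N\<rparr>" "mult L" "mult L"
proof -
  interpret N: lie_algebra F "L\<lparr>carrier := N\<rparr>" by (rule N_lie_algebra)
  show "lie_actions F L (L\<lparr>carrier := N\<rparr>) (mult L) (mult L)"
    by unfold_locales (auto simp: N_closed N_sub bracket_closed)
qed

abbreviation "TT \<equiv> pair_tensor F L N"
abbreviation "tens \<equiv> pair_tensor_elem F L N"

lemma TT_def: "TT = act.T"
  by (simp add: pair_tensor_def)

lemma tens_def: "tens l n = act.gen l n"
  by (simp add: pair_tensor_elem_def)

sublocale TT: lie_algebra F TT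
  unfolding TT_def by (rule act.T.lie_algebra_axioms)

lemma tens_closed [simp]: "\<lbrakk>l \<in> carrier L; n \<in> N\<rbrakk> \<Longrightarrow> tens l n \<in> carrier TT"
  unfolding TT_def tens_def by (rule act.gen_closed) auto

lemma tens_smult_left: "\<lbrakk>c \<in> carrier F; l \<in> carrier L; n \<in> N\<rbrakk>
    \<Longrightarrow> tens (c \<odot>\<^bsub>L\<^esub> l) n = c \<odot>\<^bsub>TT\<^esub> tens l n"
  unfolding TT_def tens_def by (rule act.gen_smult_left) auto

lemma tens_smult_right: "\<lbrakk>c \<in> carrier F; l \<in> carrier L; n \<in> N\<rbrakk>
    \<Longrightarrow> tens l (c \<odot>\<^bsub>L\<^esub> n) = c \<odot>\<^bsub>TT\<^esub> tens l n"
  unfolding TT_def tens_def using act.gen_smult_right[of c l n] by simp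

lemma tens_add_left: "\<lbrakk>l \<in> carrier L; l' \<in> carrier L; n \<in> N\<rbrakk>
    \<Longrightarrow> tens (l \<oplus>\<^bsub>L\<^esub> l') n = tens l n \<oplus>\<^bsub>TT\<^esub> tens l' n"
  unfolding TT_def tens_def by (rule act.gen_add_left) auto

lemma tens_add_right: "\<lbrakk>l \<in> carrier L; n \<in> N; n' \<in> N\<rbrakk>
    \<Longrightarrow> tens l (n \<oplus>\<^bsub>L\<^esub> n') = tens l n \<oplus>\<^bsub>TT\<^esub> tens l n'"
  unfolding TT_def tens_def using act.gen_add_right[of l n n'] by simp

lemma tens_bracket_left: "\<lbrakk>l \<in> carrier L; l' \<in> carrier L; n \<in> N\<rbrakk>
    \<Longrightarrow> tens (l \<otimes>\<^bsub>L\<^esub> l') n = tens l (l' \<otimes>\<^bsub>L\<^esub> n) \<oplus>\<^bsub>TT\<^esub> \<ominus>\<^bsub>TT\<^esub> tens l' (l \<otimes>\<^bsub>L\<^esub> n)"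
  unfolding TT_def tens_def by (rule act.gen_bracket_left) auto

lemma tens_bracket_right: "\<lbrakk>l \<in> carrier L; n \<in> N; n' \<in> N\<rbrakk>
    \<Longrightarrow> tens l (n \<otimes>\<^bsub>L\<^esub> n') = tens (n' \<otimes>\<^bsub>L\<^esub> l) n \<oplus>\<^bsub>TT\<^esub> \<ominus>\<^bsub>TT\<^esub> tens (n \<otimes>\<^bsub>L\<^esub> l) n'"
  unfolding TT_def tens_def using act.gen_bracket_right[of l n n'] by simp

lemma tens_zero_left [simp]: "n \<in> N \<Longrightarrow> tens \<zero>\<^bsub>L\<^esub> n = \<zero>\<^bsub>TT\<^esub>"
  using tens_smult_left[of "\<zero>\<^bsub>F\<^esub>" "\<zero>\<^bsub>L\<^esub>" n] by simp

lemma tens_zero_right [simp]: "l \<in> carrier L \<Longrightarrow> tens l \<zero>\<^bsub>L\<^esub> = \<zero>\<^bsub>TT\<^esub>"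
  using tens_smult_right[of "\<zero>\<^bsub>F\<^esub>" l "\<zero>\<^bsub>L\<^esub>"] N_closed(2) by simp

lemma tens_neg_left: "\<lbrakk>l \<in> carrier L; n \<in> N\<rbrakk> \<Longrightarrow> tens (\<ominus>\<^bsub>L\<^esub> l) n = \<ominus>\<^bsub>TT\<^esub> tens l n"
  by (simp add: neg_eq_smult TT.neg_eq_smult tens_smult_left)

lemma tens_neg_right: "\<lbrakk>l \<in> carrier L; n \<in> N\<rbrakk> \<Longrightarrow> tens l (\<ominus>\<^bsub>L\<^esub> n) = \<ominus>\<^bsub>TT\<^esub> tens l n"
  by (simp add: neg_eq_smult TT.neg_eq_smult tens_smult_right N_sub)

lemma bracket_tens:
  assumes "l \<in> carrier L" "n \<in> N" "l' \<in> carrier L" "n' \<in> N"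
  shows "tens l n \<otimes>\<^bsub>TT\<^esub> tens l' n' = tens (l \<otimes>\<^bsub>L\<^esub> n) (l' \<otimes>\<^bsub>L\<^esub> n')"
proof -
  have "tens l n \<otimes>\<^bsub>TT\<^esub> tens l' n' = \<ominus>\<^bsub>TT\<^esub> tens (n \<otimes>\<^bsub>L\<^esub> l) (l' \<otimes>\<^bsub>L\<^esub> n')"
    unfolding TT_def tens_def using assms by (intro act.bracket_gen) auto
  then show ?thesis
    using assms bracket_swap[of l n]
    by (simp add: tens_neg_left N_sub bracket_closed N_closed)
qed

lemma TT_induct [consumes 1, case_names tens zero add smult]:
  assumes "x \<in> carrier TT"
    and "\<And>l n. \<lbrakk>l \<in> carrier L; n \<in> N\<rbrakk> \<Longrightarrow> Q (tens l n)"
    and "Q \<zero>\<^bsub>TT\<^esub>"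
    and "\<And>x y. \<lbrakk>x \<in> carrier TT; y \<in> carrier TT; Q x; Q y\<rbrakk> \<Longrightarrow> Q (x \<oplus>\<^bsub>TT\<^esub> y)"
    and "\<And>c x. \<lbrakk>c \<in> carrier F; x \<in> carrier TT; Q x\<rbrakk> \<Longrightarrow> Q (c \<odot>\<^bsub>TT\<^esub> x)"
  shows "Q x"
  using act.T_induct[of x Q] assms by (auto simp: TT_def tens_def)

lemma TT_lift:
  assumes A: "lie_algebra F A"
    and cl: "\<And>m n. \<lbrakk>m \<in> carrier L; n \<in> N\<rbrakk> \<Longrightarrow> g m n \<in> carrier A"
    and "\<And>c m n. \<lbrakk>c \<in> carrier F; m \<in> carrier L; n \<in> N\<rbrakk>
      \<Longrightarrow> g (c \<odot>\<^bsub>L\<^esub> m) n = c \<odot>\<^bsub>A\<^esub> g m n"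
    and "\<And>c m n. \<lbrakk>c \<in> carrier F; m \<in> carrier L; n \<in> N\<rbrakk>
      \<Longrightarrow> g m (c \<odot>\<^bsub>L\<^esub> n) = c \<odot>\<^bsub>A\<^esub> g m n"
    and "\<And>m m' n. \<lbrakk>m \<in> carrier L; m' \<in> carrier L; n \<in> N\<rbrakk>
      \<Longrightarrow> g (m \<oplus>\<^bsub>L\<^esub> m') n = g m n \<oplus>\<^bsub>A\<^esub> g m' n"
    and "\<And>m n n'. \<lbrakk>m \<in> carrier L; n \<in> N; n' \<in> N\<rbrakk>
      \<Longrightarrow> g m (n \<oplus>\<^bsub>L\<^esub> n') = g m n \<oplus>\<^bsub>A\<^esub> g m n'"
    and "\<And>m m' n. \<lbrakk>m \<in> carrier L; m' \<in> carrier L; n \<in> N\<rbrakk>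
      \<Longrightarrow> g (m \<otimes>\<^bsub>L\<^esub> m') n = g m (m' \<otimes>\<^bsub>L\<^esub> n) \<oplus>\<^bsub>A\<^esub> \<ominus>\<^bsub>A\<^esub> g m' (m \<otimes>\<^bsub>L\<^esub> n)"
    and "\<And>m n n'. \<lbrakk>m \<in> carrier L; n \<in> N; n' \<in> N\<rbrakk>
      \<Longrightarrow> g m (n \<otimes>\<^bsub>L\<^esub> n') = g (n' \<otimes>\<^bsub>L\<^esub> m) n \<oplus>\<^bsub>A\<^esub> \<ominus>\<^bsub>A\<^esub> g (n \<otimes>\<^bsub>L\<^esub> m) n'"
    and "\<And>m n m' n'. \<lbrakk>m \<in> carrier L; n \<in> N; m' \<in> carrier L; n' \<in> N\<rbrakk>
      \<Longrightarrow> g m n \<otimes>\<^bsub>A\<^esub> g m' n' = \<ominus>\<^bsub>A\<^esub> g (n \<otimes>\<^bsub>L\<^esub> m) (m' \<otimes>\<^bsub>L\<^esub> n')"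
  shows "lie_pres_lift A (\<lambda>(m, n). g m n) \<in> lie_hom F TT A"
    and "\<lbrakk>m \<in> carrier L; n \<in> N\<rbrakk> \<Longrightarrow> lie_pres_lift A (\<lambda>(m, n). g m n) (tens m n) = g m n"
  using act.T_lift[OF A, of g] assms(2-) by (simp_all add: TT_def tens_def)

lemma TT_hom_ext:
  assumes "h \<in> lie_hom F TT A" "k \<in> lie_hom F TT A" "lie_algebra F A"
    and "\<And>m n. \<lbrakk>m \<in> carrier L; n \<in> N\<rbrakk> \<Longrightarrow> h (tens m n) = k (tens m n)"
    and "x \<in> carrier TT"
  shows "h x = k x"
  using act.T_hom_ext[of h A k x] assms by (auto simp: TT_def tens_def)

lemma kappa_hom: "pair_kappa L \<in> lie_hom F TT L"
  and kappa_tens: "\<lbrakk>l \<in> carrier L; n \<in> N\<rbrakk> \<Longrightarrow> pair_kappa L (tens l n) = l \<otimes>\<^bsub>L\<^esub> n"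
proof -
  have 3: "(m \<otimes>\<^bsub>L\<^esub> n) \<otimes>\<^bsub>L\<^esub> (m' \<otimes>\<^bsub>L\<^esub> n') =
      \<ominus>\<^bsub>L\<^esub> ((n \<otimes>\<^bsub>L\<^esub> m) \<otimes>\<^bsub>L\<^esub> (m' \<otimes>\<^bsub>L\<^esub> n'))"
    if "m \<in> carrier L" "n \<in> N" "m' \<in> carrier L" "n' \<in> N" for m n m' n'
    using that bracket_swap[of n m] by (simp add: N_sub bracket_closed bracket_neg_left)
  note lift = TT_lift[of L "mult L", OF lie_algebra_axioms _ _ _ _ _ bracket_bracket_left
      bracket_bracket_right 3]
  show "pair_kappa L \<in> lie_hom F TT L"
    unfolding pair_kappa_def
    by (rule lift(1)) (auto simp: bracket_closed N_sub bracket_smult_left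
      bracket_smult_right bracket_add_left bracket_add_right)
  show "\<lbrakk>l \<in> carrier L; n \<in> N\<rbrakk> \<Longrightarrow> pair_kappa L (tens l n) = l \<otimes>\<^bsub>L\<^esub> n"
    unfolding pair_kappa_def
    by (rule lift(2)) (auto simp: bracket_closed N_sub bracket_smult_left
      bracket_smult_right bracket_add_left bracket_add_right)
qed

lemmas kappa = lie_homD[OF kappa_hom] lie_hom_zero[OF kappa_hom TT.lie_algebra_axioms lie_algebra_axioms]

lemma kappa_in_N: "t \<in> carrier TT \<Longrightarrow> pair_kappa L t \<in> N"
  by (induction rule: TT_induct) (auto simp: kappa kappa_tens N_closed)

text \<open>
  On generators this is the last defining relation. It makes the kernel of \<open>\<kappa>\<close> central, so that on
  this kernel only the linear structure has to be watched.
\<close>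

lemma bracket_TT:
  assumes "s \<in> carrier TT" "t \<in> carrier TT"
  shows "s \<otimes>\<^bsub>TT\<^esub> t = tens (pair_kappa L s) (pair_kappa L t)"
  using assms(1)
proof (induction rule: TT_induct)
  case (tens l n)
  from assms(2) show ?case
    by (induction rule: TT_induct)
      (auto simp: tens kappa kappa_tens bracket_tens TT.bracket_add_right TT.bracket_smult_right
        tens_add_right tens_smult_right kappa_in_N bracket_closed N_sub)
qed (auto simp: assms(2) kappa TT.bracket_add_left TT.bracket_smult_left
      tens_add_left tens_smult_left kappa_in_N)

lemma bracket_TT_zero:
  assumes "s \<in> carrier TT" "t \<in> carrier TT" "pair_kappa L s = \<zero>\<^bsub>L\<^esub> \<or> pair_kappa L t = \<zero>\<^bsub>L\<^esub>"
  shows "s \<otimes>\<^bsub>TT\<^esub> t = \<zero>\<^bsub>TT\<^esub>"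
  using assms by (auto simp: bracket_TT kappa_in_N kappa)

lemma kappa_kernel_ideal: "lie_ideal F {t \<in> carrier TT. pair_kappa L t = \<zero>\<^bsub>L\<^esub>} TT"
  by (rule lie_idealI) (auto simp: TT.lie_algebra_axioms TT.bracket_closed kappa)

lemma diagonal_ideal_kappa: "t \<in> diagonal_ideal F L N \<Longrightarrow> t \<in> carrier TT \<and> pair_kappa L t = \<zero>\<^bsub>L\<^esub>"
  unfolding diagonal_ideal_def lie_ideal_generated_def
  using kappa_kernel_ideal by (auto simp: kappa_tens bracket_self)

lemma diagonal_ideal_lie_ideal: "lie_ideal F (diagonal_ideal F L N) TT"
proof -
  have "lie_ideal F (carrier TT) TT"
    by (rule lie_idealI) (auto simp: TT.lie_algebra_axioms TT.bracket_closed)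
  then show ?thesis
    unfolding diagonal_ideal_def lie_ideal_generated_def
    using diagonal_ideal_kappa
    by (intro lie_idealI TT.lie_algebra_axioms) (auto simp: lie_idealD)
qed

lemma tens_diagonal: "n \<in> N \<Longrightarrow> tens n n \<in> diagonal_ideal F L N"
  unfolding diagonal_ideal_def lie_ideal_generated_def using N_sub by blast

lemma diagonal_ideal_least:
  assumes "lie_ideal F I TT" "\<And>n. n \<in> N \<Longrightarrow> tens n n \<in> I"
  shows "diagonal_ideal F L N \<subseteq> I"
  unfolding diagonal_ideal_def lie_ideal_generated_def using assms by blast

end

lemma lie_ideal_preimage:
  assumes "h \<in> lie_hom F A B" "lie_algebra F A" "lie_algebra F B" "lie_ideal F I B"
  shows "lie_ideal F {x \<in> carrier A. h x \<in> I} A"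
proof -
  interpret A: lie_algebra F A by fact
  show ?thesis
    by (rule lie_idealI) (auto simp: assms A.bracket_closed lie_homD[OF assms(1)]
      lie_hom_zero[OF assms(1-3)] lie_idealD[OF assms(4)])
qed

definition tensor_map :: "('f, 'k) ring_scheme \<Rightarrow> ('f, 'b, 'n) module_scheme \<Rightarrow> 'b set
    \<Rightarrow> ('a \<Rightarrow> 'b) \<Rightarrow> ('f, 'a \<times> 'a) lie_term set \<Rightarrow> ('f, 'b \<times> 'b) lie_term set" where
  "tensor_map F L N h =
     lie_pres_lift (pair_tensor F L N) (\<lambda>(l, n). pair_tensor_elem F L N (h l) (h n))"

lemma tensor_map:
  assumes "lie_pair F L N" "lie_pair F L' N'"
    and h: "h \<in> lie_hom F L L'" and hN: "\<And>n. n \<in> N \<Longrightarrow> h n \<in> N'"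
  shows "tensor_map F L' N' h \<in> lie_hom F (pair_tensor F L N) (pair_tensor F L' N')"
    and "\<And>l n. \<lbrakk>l \<in> carrier L; n \<in> N\<rbrakk> \<Longrightarrow> tensor_map F L' N' h (pair_tensor_elem F L N l n) =
      pair_tensor_elem F L' N' (h l) (h n)"
    and "\<And>t. t \<in> carrier (pair_tensor F L N) \<Longrightarrow>
      pair_kappa L' (tensor_map F L' N' h t) = h (pair_kappa L t)"
    and "\<And>t. t \<in> diagonal_ideal F L N \<Longrightarrow> tensor_map F L' N' h t \<in> diagonal_ideal F L' N'"
proof -
  interpret A: lie_pair_tensor F L N by (simp add: assms lie_pair_tensor_def)
  interpret B: lie_pair_tensor F L' N' by (simp add: assms lie_pair_tensor_def)
  note h' = lie_homD[OF h]
  let ?k = "tensor_map F L' N' h"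
  have br: "B.tens (h m) (h n) \<otimes>\<^bsub>B.TT\<^esub> B.tens (h m') (h n') =
      \<ominus>\<^bsub>B.TT\<^esub> B.tens (h (n \<otimes>\<^bsub>L\<^esub> m)) (h (m' \<otimes>\<^bsub>L\<^esub> n'))"
    if "m \<in> carrier L" "n \<in> N" "m' \<in> carrier L" "n' \<in> N" for m n m' n'
    using that B.bracket_swap[of "h n" "h m"]
    by (simp add: B.bracket_tens h' hN A.N_sub B.N_sub B.bracket_closed B.tens_neg_left
        B.N_closed)
  have bl: "B.tens (h (m \<otimes>\<^bsub>L\<^esub> m')) (h n) = B.tens (h m) (h (m' \<otimes>\<^bsub>L\<^esub> n))
      \<oplus>\<^bsub>B.TT\<^esub> \<ominus>\<^bsub>B.TT\<^esub> B.tens (h m') (h (m \<otimes>\<^bsub>L\<^esub> n))"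
    if "m \<in> carrier L" "m' \<in> carrier L" "n \<in> N" for m m' n
    using that B.tens_bracket_left[of "h m" "h m'" "h n"] by (simp add: h' hN A.N_sub)
  have br': "B.tens (h m) (h (n \<otimes>\<^bsub>L\<^esub> n')) = B.tens (h (n' \<otimes>\<^bsub>L\<^esub> m)) (h n)
      \<oplus>\<^bsub>B.TT\<^esub> \<ominus>\<^bsub>B.TT\<^esub> B.tens (h (n \<otimes>\<^bsub>L\<^esub> m)) (h n')"
    if "m \<in> carrier L" "n \<in> N" "n' \<in> N" for m n n'
    using that B.tens_bracket_right[of "h m" "h n" "h n'"] by (simp add: h' hN A.N_sub)
  note lift = A.TT_lift[of B.TT "\<lambda>l n. B.tens (h l) (h n)", OF B.TT.lie_algebra_axioms
      _ _ _ _ _ bl br' br, folded tensor_map_def]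
  have 1: "?k \<in> lie_hom F A.TT B.TT"
    by (rule lift(1)) (simp_all add: h' hN A.N_sub B.tens_smult_left B.tens_smult_right
      B.tens_add_left B.tens_add_right)
  have 2: "?k (A.tens l n) = B.tens (h l) (h n)" if "l \<in> carrier L" "n \<in> N" for l n
    by (rule lift(2)) (simp_all add: that h' hN A.N_sub B.tens_smult_left B.tens_smult_right
      B.tens_add_left B.tens_add_right)
  have 3: "pair_kappa L' (?k t) = h (pair_kappa L t)" if "t \<in> carrier A.TT" for t
    using lie_hom_comp[OF 1 B.kappa_hom] lie_hom_comp[OF A.kappa_hom h] B.lie_algebra_axioms _ that
    by (rule A.TT_hom_ext) (simp add: 2 B.kappa_tens A.kappa_tens h' hN A.N_sub)
  have "diagonal_ideal F L N \<subseteq> {t \<in> carrier A.TT. ?k t \<in> diagonal_ideal F L' N'}"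
    by (rule A.diagonal_ideal_least[OF lie_ideal_preimage[OF 1 A.TT.lie_algebra_axioms
      B.TT.lie_algebra_axioms B.diagonal_ideal_lie_ideal]])
      (auto simp: 2 A.N_sub B.tens_diagonal hN)
  then show "\<And>t. t \<in> diagonal_ideal F L N \<Longrightarrow> ?k t \<in> diagonal_ideal F L' N'"
    by blast
  show "?k \<in> lie_hom F A.TT B.TT" by (rule 1)
  show "\<And>l n. \<lbrakk>l \<in> carrier L; n \<in> N\<rbrakk> \<Longrightarrow> ?k (A.tens l n) = B.tens (h l) (h n)" by (rule 2)
  show "\<And>t. t \<in> carrier A.TT \<Longrightarrow> pair_kappa L' (?k t) = h (pair_kappa L t)" by (rule 3)
qed


section \<open>Quotients and direct sums\<close>

locale lie_quotient_algebra = lie_algebra F L for F :: "('f, 'k) ring_scheme"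
    and L :: "('f, 'a, 'm) module_scheme" (structure) +
  fixes I :: "'a set"
  assumes ideal: "lie_ideal F I L"
begin

abbreviation "Q \<equiv> lie_quotient L I"
abbreviation "q x \<equiv> I +>\<^bsub>L\<^esub> x"

lemmas I_closed = lie_idealD[OF ideal]

lemma I_minus: "x \<in> I \<Longrightarrow> \<ominus> x \<in> I"
  by (rule lie_ideal_minus[OF ideal lie_algebra_axioms])

sublocale sub: abelian_subgroup I L
proof -
  have "additive_subgroup I L"
    unfolding additive_subgroup_def
    by (rule M.add.subgroupI) (use I_closed I_minus in \<open>auto simp: a_inv_def[symmetric]\<close>)
  then show "abelian_subgroup I L"
    by (rule abelian_subgroupI3) (rule M.abelian_group_axioms)
qed

lemma q_eq_iff: "\<lbrakk>x \<in> carrier L; y \<in> carrier L\<rbrakk> \<Longrightarrow> q x = q y \<longleftrightarrow> x \<oplus> \<ominus> y \<in> I"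
  using sub.a_rcos_module[of y x] sub.a_rcos_self[of x] sub.a_repr_independence'[of x y]
  by (auto simp: a_minus_def)

lemma q_zero_iff: "x \<in> carrier L \<Longrightarrow> q x = I \<longleftrightarrow> x \<in> I"
  using sub.a_rcos_self[of x] sub.a_rcos_const[of x] by auto

lemma carrier_Q: "carrier Q = q ` carrier L"
  by (auto simp: lie_quotient_def A_RCOSETS_def' )

lemma Q_cases:
  assumes "W \<in> carrier Q"
  obtains x where "x \<in> carrier L" "W = q x"
  using assms by (auto simp: carrier_Q)

lemma q_closed: "x \<in> carrier L \<Longrightarrow> q x \<in> carrier Q"
  by (simp add: carrier_Q)

lemma mem_q: "x \<in> carrier L \<Longrightarrow> y \<in> q x \<Longrightarrow> y \<in> carrier L \<and> y \<oplus> \<ominus> x \<in> I"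
  by (metis a_minus_def sub.a_rcos_module sub.a_elemrcos_carrier)

lemma zero_Q: "\<zero>\<^bsub>Q\<^esub> = I"
  by (simp add: lie_quotient_def)

lemma q_UN:
  assumes "x \<in> carrier L" "\<And>y. \<lbrakk>y \<in> carrier L; y \<oplus> \<ominus> x \<in> I\<rbrakk> \<Longrightarrow> G y = G x"
  shows "(\<Union>y\<in>q x. G y) = G x"
  using assms mem_q[OF assms(1)] sub.a_rcos_self[OF assms(1)] by blast

lemma q_add: "\<lbrakk>x \<in> carrier L; y \<in> carrier L\<rbrakk> \<Longrightarrow> q x \<oplus>\<^bsub>Q\<^esub> q y = q (x \<oplus> y)"
  by (simp add: lie_quotient_def sub.a_rcos_sum)

lemma q_smult:
  assumes "c \<in> carrier F" "x \<in> carrier L"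
  shows "c \<odot>\<^bsub>Q\<^esub> q x = q (c \<odot> x)"
proof -
  have "q (c \<odot> y) = q (c \<odot> x)" if "y \<in> carrier L" "y \<oplus> \<ominus> x \<in> I" for y
    using I_closed(4)[OF assms(1) that(2)] that assms
    by (subst q_eq_iff) (auto simp: smult_r_distr smult_r_minus)
  then show ?thesis
    using q_UN[OF assms(2), of "\<lambda>y. q (c \<odot> y)"] by (simp add: lie_quotient_def)
qed

lemma q_bracket:
  assumes "x \<in> carrier L" "y \<in> carrier L"
  shows "q x \<otimes>\<^bsub>Q\<^esub> q y = q (x \<otimes> y)"
proof -
  have "q (u \<otimes> v) = q (u \<otimes> y)" if "u \<in> carrier L" "v \<in> carrier L" "v \<oplus> \<ominus> y \<in> I" for u v
    using I_closed(5)[OF that(1,3)] that assms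
    by (subst q_eq_iff) (auto simp: bracket_closed bracket_add_right bracket_neg_right)
  then have 1: "(\<Union>v\<in>q y. q (u \<otimes> v)) = q (u \<otimes> y)" if "u \<in> carrier L" for u
    using q_UN[OF assms(2), of "\<lambda>v. q (u \<otimes> v)"] that by blast
  have "q (u \<otimes> y) = q (x \<otimes> y)" if "u \<in> carrier L" "u \<oplus> \<ominus> x \<in> I" for u
    using lie_ideal_bracket_left[OF ideal lie_algebra_axioms that(2) assms(2)] that assms
    by (subst q_eq_iff) (auto simp: bracket_closed bracket_add_left bracket_neg_left)
  then have 2: "(\<Union>u\<in>q x. q (u \<otimes> y)) = q (x \<otimes> y)"
    using q_UN[OF assms(1), of "\<lambda>u. q (u \<otimes> y)"] by blast
  have "q x \<otimes>\<^bsub>Q\<^esub> q y = (\<Union>u\<in>q x. \<Union>v\<in>q y. q (u \<otimes> v))"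
    by (simp add: lie_quotient_def rcoset_mult_def)
  also have "\<dots> = (\<Union>u\<in>q x. q (u \<otimes> y))"
    by (intro SUP_cong HOL.refl 1) (use mem_q[OF assms(1)] in blast)
  finally show ?thesis using 2 by simp
qed

lemma q_zero: "q \<zero> = \<zero>\<^bsub>Q\<^esub>"
  using q_zero_iff[of "\<zero>"] I_closed(2) by (simp add: zero_Q)

lemma lie_algebra_Q: "lie_algebra F Q"
proof (rule lie_algebraI)
  show "field F" by unfold_locales
  show "\<exists>y\<in>carrier Q. x \<oplus>\<^bsub>Q\<^esub> y = \<zero>\<^bsub>Q\<^esub>" if "x \<in> carrier Q" for x
  proof -
    from that obtain u where u: "u \<in> carrier L" "x = q u" by (rule Q_cases)
    then show ?thesis
      by (intro bexI[of _ "q (\<ominus> u)"]) (simp_all add: q_add q_closed M.r_neg q_zero)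
  qed
  show "x \<oplus>\<^bsub>Q\<^esub> y = y \<oplus>\<^bsub>Q\<^esub> x" if "x \<in> carrier Q" "y \<in> carrier Q" for x y
    using that by (elim Q_cases) (simp add: q_add M.a_comm)
  show "(x \<oplus>\<^bsub>Q\<^esub> y) \<oplus>\<^bsub>Q\<^esub> z = x \<oplus>\<^bsub>Q\<^esub> (y \<oplus>\<^bsub>Q\<^esub> z)"
    if "x \<in> carrier Q" "y \<in> carrier Q" "z \<in> carrier Q" for x y z
    using that by (elim Q_cases) (simp add: q_add M.a_assoc)
qed ((elim Q_cases)?; simp add: q_add q_smult q_bracket q_zero[symmetric] q_closed bracket_closed
      smult_assoc1 smult_l_distr smult_r_distr bracket_add_left bracket_add_right
      bracket_smult_left bracket_smult_right bracket_self jacobi)+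

lemma q_hom: "q \<in> lie_hom F L Q"
  by (rule lie_homI) (auto simp: q_closed q_add q_smult q_bracket)

text \<open>
  The choice-free description of the map induced on the quotient by a map that vanishes on the
  ideal; \<^const>\<open>pair_kappa_ext\<close> has this form.
\<close>

lemma the_elem_q:
  assumes "h \<in> lie_hom F L A" "lie_algebra F A" "\<And>y. y \<in> I \<Longrightarrow> h y = \<zero>\<^bsub>A\<^esub>" "x \<in> carrier L"
  shows "the_elem (h ` q x) = h x"
proof -
  interpret A: lie_algebra F A by fact
  have "h y = h x" if "y \<in> q x" for y
  proof -
    have y: "y \<in> carrier L" "y \<oplus> \<ominus> x \<in> I" using mem_q[OF assms(4) that] by auto
    then have "h y \<oplus>\<^bsub>A\<^esub> \<ominus>\<^bsub>A\<^esub> h x = \<zero>\<^bsub>A\<^esub>"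
      using assms(3)[OF y(2)] assms(4)
      by (simp add: lie_homD(2)[OF assms(1)] lie_hom_neg[OF assms(1) lie_algebra_axioms assms(2)])
    then show ?thesis
      using lie_homD(1)[OF assms(1)] y assms(4) by (metis A.M.minus_equality A.M.minus_minus A.M.a_inv_closed)
  qed
  then have "h ` q x = {h x}" using sub.a_rcos_self[OF assms(4)] by blast
  then show ?thesis by simp
qed

end

lemma carrier_direct_sum [simp]: "carrier (lie_direct_sum A B) = carrier A \<times> carrier B"
  and zero_direct_sum [simp]: "\<zero>\<^bsub>lie_direct_sum A B\<^esub> = (\<zero>\<^bsub>A\<^esub>, \<zero>\<^bsub>B\<^esub>)"
  and add_direct_sum [simp]: "x \<oplus>\<^bsub>lie_direct_sum A B\<^esub> y = (fst x \<oplus>\<^bsub>A\<^esub> fst y, snd x \<oplus>\<^bsub>B\<^esub> snd y)"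
  and smult_direct_sum [simp]: "c \<odot>\<^bsub>lie_direct_sum A B\<^esub> x = (c \<odot>\<^bsub>A\<^esub> fst x, c \<odot>\<^bsub>B\<^esub> snd x)"
  and bracket_direct_sum [simp]: "x \<otimes>\<^bsub>lie_direct_sum A B\<^esub> y = (fst x \<otimes>\<^bsub>A\<^esub> fst y, snd x \<otimes>\<^bsub>B\<^esub> snd y)"
  by (simp_all add: lie_direct_sum_def direct_sum_def case_prod_beta)

lemma lie_algebra_direct_sum:
  assumes "lie_algebra F A" "lie_algebra F B"
  shows "lie_algebra F (lie_direct_sum A B)"
proof -
  interpret A: lie_algebra F A by fact
  interpret B: lie_algebra F B by fact
  let ?D = "lie_direct_sum A B"
  show ?thesis
  proof (rule lie_algebraI)
    show "field F" by unfold_locales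
    show "\<exists>y\<in>carrier (lie_direct_sum A B). x \<oplus>\<^bsub>lie_direct_sum A B\<^esub> y = \<zero>\<^bsub>lie_direct_sum A B\<^esub>"
      if "x \<in> carrier (lie_direct_sum A B)" for x
      using that by (intro bexI[of _ "(\<ominus>\<^bsub>A\<^esub> fst x, \<ominus>\<^bsub>B\<^esub> snd x)"]) (auto simp: A.M.r_neg B.M.r_neg)
    show "x \<oplus>\<^bsub>?D\<^esub> y = y \<oplus>\<^bsub>?D\<^esub> x" if "x \<in> carrier ?D" "y \<in> carrier ?D" for x y
      using that by (auto simp: A.M.a_comm B.M.a_comm)
    show "(x \<oplus>\<^bsub>?D\<^esub> y) \<oplus>\<^bsub>?D\<^esub> z = x \<oplus>\<^bsub>?D\<^esub> (y \<oplus>\<^bsub>?D\<^esub> z)"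
      if "x \<in> carrier ?D" "y \<in> carrier ?D" "z \<in> carrier ?D" for x y z
      using that by (auto simp: A.M.a_assoc B.M.a_assoc)
  qed (auto simp: A.bracket_closed B.bracket_closed
      A.smult_assoc1 A.smult_l_distr A.smult_r_distr B.smult_assoc1 B.smult_l_distr B.smult_r_distr
      A.bracket_add_left A.bracket_add_right A.bracket_smult_left A.bracket_smult_right
      A.bracket_self A.jacobi B.bracket_add_left B.bracket_add_right B.bracket_smult_left
      B.bracket_smult_right B.bracket_self B.jacobi)
qed

lemma lie_pair_direct_sum:
  assumes "lie_pair F A I" "lie_pair F B J"
  shows "lie_pair F (lie_direct_sum A B) (I \<times> J)"
proof -
  have 1: "lie_algebra F A" "lie_ideal F I A" "lie_algebra F B" "lie_ideal F J B"
    using assms by (auto simp: lie_pair_def)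
  note I = lie_idealD[OF 1(2)] and J = lie_idealD[OF 1(4)]
  have "lie_ideal F (I \<times> J) (lie_direct_sum A B)"
    by (rule lie_idealI[OF lie_algebra_direct_sum[OF 1(1,3)]]) (use I J in auto)
  then show ?thesis using lie_algebra_direct_sum[OF 1(1,3)] by (simp add: lie_pair_def)
qed

lemma lie_hom_pair:
  assumes "h \<in> lie_hom F C A" "k \<in> lie_hom F C B"
  shows "(\<lambda>x. (h x, k x)) \<in> lie_hom F C (lie_direct_sum A B)"
  by (rule lie_homI) (auto simp: lie_homD[OF assms(1)] lie_homD[OF assms(2)])

lemma lie_hom_fst: "fst \<in> lie_hom F (lie_direct_sum A B) A"
  and lie_hom_snd: "snd \<in> lie_hom F (lie_direct_sum A B) B"
  by (auto intro!: lie_homI)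

section \<open>Free products\<close>

lemma lie_terms_mono: "t \<in> lie_terms F X \<Longrightarrow> X \<subseteq> Y \<Longrightarrow> t \<in> lie_terms F Y"
  by (induction rule: lie_terms.induct) (auto intro: lie_terms.intros)

locale lie_free_prod = A: lie_algebra F L1 + B: lie_algebra F L2
  for F :: "('f, 'k) ring_scheme" and L1 :: "('f, 'a, 'm) module_scheme"
    and L2 :: "('f, 'b, 'n) module_scheme"
begin

abbreviation "FP \<equiv> lie_free_product F L1 L2"
abbreviation "inl x \<equiv> lie_free_product_incl F L1 L2 (Inl x)"
abbreviation "inr y \<equiv> lie_free_product_incl F L1 L2 (Inr y)"

sublocale pres: lie_presentation F "carrier L1 <+> carrier L2" "lie_free_product_rels F L1 L2"
  by unfold_locales

lemma FP_def: "FP = pres.P"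
  by (simp add: lie_free_product_def)

sublocale FP: lie_algebra F FP
  unfolding FP_def by (rule pres.lie_algebra_P)

lemma incl_def: "lie_free_product_incl F L1 L2 z = pres.cls (LGen z)"
  by (simp add: lie_free_product_incl_def)

lemma inl_hom: "(\<lambda>x. inl x) \<in> lie_hom F L1 FP"
  unfolding FP_def incl_def
  by (rule pres.alg_rels_hom[OF A.lie_algebra_axioms]) (auto simp: lie_free_product_rels_def)

lemma inr_hom: "(\<lambda>y. inr y) \<in> lie_hom F L2 FP"
  unfolding FP_def incl_def
  by (rule pres.alg_rels_hom[OF B.lie_algebra_axioms]) (auto simp: lie_free_product_rels_def)

lemmas inl = lie_homD[OF inl_hom] lie_hom_zero[OF inl_hom A.lie_algebra_axioms FP.lie_algebra_axioms]
lemmas inr = lie_homD[OF inr_hom] lie_hom_zero[OF inr_hom B.lie_algebra_axioms FP.lie_algebra_axioms]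

lemma FP_induct [consumes 1, case_names inl inr zero add smult bracket]:
  assumes "x \<in> carrier FP"
    and "\<And>x. x \<in> carrier L1 \<Longrightarrow> P (inl x)" "\<And>y. y \<in> carrier L2 \<Longrightarrow> P (inr y)"
    and "P \<zero>\<^bsub>FP\<^esub>"
    and "\<And>x y. \<lbrakk>x \<in> carrier FP; y \<in> carrier FP; P x; P y\<rbrakk> \<Longrightarrow> P (x \<oplus>\<^bsub>FP\<^esub> y)"
    and "\<And>c x. \<lbrakk>c \<in> carrier F; x \<in> carrier FP; P x\<rbrakk> \<Longrightarrow> P (c \<odot>\<^bsub>FP\<^esub> x)"
    and "\<And>x y. \<lbrakk>x \<in> carrier FP; y \<in> carrier FP; P x; P y\<rbrakk> \<Longrightarrow> P (x \<otimes>\<^bsub>FP\<^esub> y)"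
  shows "P x"
  using pres.P_induct[of x P] assms unfolding FP_def incl_def by auto

lemma FP_hom_ext:
  assumes "h \<in> lie_hom F FP C" "k \<in> lie_hom F FP C" "lie_algebra F C"
    and "\<And>x. x \<in> carrier L1 \<Longrightarrow> h (inl x) = k (inl x)"
    and "\<And>y. y \<in> carrier L2 \<Longrightarrow> h (inr y) = k (inr y)"
    and "x \<in> carrier FP"
  shows "h x = k x"
  using pres.hom_ext[of h C k x] assms unfolding FP_def incl_def by auto

lemma FP_lift:
  assumes C: "lie_algebra F C" and h: "h1 \<in> lie_hom F L1 C" "h2 \<in> lie_hom F L2 C"
  defines "h \<equiv> lie_pres_lift C (case_sum h1 h2)"
  shows "h \<in> lie_hom F FP C" "\<And>x. x \<in> carrier L1 \<Longrightarrow> h (inl x) = h1 x"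
    "\<And>y. y \<in> carrier L2 \<Longrightarrow> h (inr y) = h2 y"
proof -
  interpret C: lie_algebra F C by fact
  interpret lie_pres_hom F "carrier L1 <+> carrier L2" "lie_free_product_rels F L1 L2" C
    "case_sum h1 h2"
  proof
    fix s t assume "(s, t) \<in> lie_free_product_rels F L1 L2"
    then show "lie_eval C (case_sum h1 h2) s = lie_eval C (case_sum h1 h2) t"
      unfolding lie_free_product_rels_def lie_alg_rels_def
      by (auto simp: lie_homD[OF h(1)] lie_homD[OF h(2)])
  qed (use lie_homD[OF h(1)] lie_homD[OF h(2)] in auto)
  show "h \<in> lie_hom F FP C" using lift_hom by (simp add: FP_def h_def)
  show "h (inl x) = h1 x" if "x \<in> carrier L1" for x
    using that lift_gen[of "Inl x"] by (simp add: incl_def h_def InlI)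
  show "h (inr y) = h2 y" if "y \<in> carrier L2" for y
    using that lift_gen[of "Inr y"] by (simp add: incl_def h_def InrI)
qed

definition prl :: "('f, 'a + 'b) lie_term set \<Rightarrow> 'a" where
  "prl = lie_pres_lift L1 (case_sum (\<lambda>x. x) (\<lambda>_. \<zero>\<^bsub>L1\<^esub>))"

definition prr :: "('f, 'a + 'b) lie_term set \<Rightarrow> 'b" where
  "prr = lie_pres_lift L2 (case_sum (\<lambda>_. \<zero>\<^bsub>L2\<^esub>) (\<lambda>x. x))"

lemma lie_hom_ident: "(\<lambda>x. x) \<in> lie_hom F M M"
  by (rule lie_homI) simp_all

lemma prl_hom: "prl \<in> lie_hom F FP L1"
  and prl_inl [simp]: "x \<in> carrier L1 \<Longrightarrow> prl (inl x) = x"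
  and prl_inr [simp]: "y \<in> carrier L2 \<Longrightarrow> prl (inr y) = \<zero>\<^bsub>L1\<^esub>"
  using FP_lift[OF A.lie_algebra_axioms lie_hom_ident
    lie_hom_zero_map[OF B.lie_algebra_axioms A.lie_algebra_axioms]]
  by (auto simp: prl_def)

lemma prr_hom: "prr \<in> lie_hom F FP L2"
  and prr_inl [simp]: "x \<in> carrier L1 \<Longrightarrow> prr (inl x) = \<zero>\<^bsub>L2\<^esub>"
  and prr_inr [simp]: "y \<in> carrier L2 \<Longrightarrow> prr (inr y) = y"
  using FP_lift[OF B.lie_algebra_axioms lie_hom_zero_map[OF A.lie_algebra_axioms
    B.lie_algebra_axioms] lie_hom_ident]
  by (auto simp: prr_def)

lemmas prl = lie_homD[OF prl_hom] lie_hom_zero[OF prl_hom FP.lie_algebra_axioms A.lie_algebra_axioms]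
lemmas prr = lie_homD[OF prr_hom] lie_hom_zero[OF prr_hom FP.lie_algebra_axioms B.lie_algebra_axioms]

text \<open>
  Elements of \<open>N1 * N2\<close> inside \<open>L1 * L2\<close> are the values of Lie terms in generators from \<open>N1\<close> and
  \<open>N2\<close>; this is how membership in \<open>N1 * N2\<close> is exploited and refuted below.
\<close>

lemma sub_eq_terms:
  assumes "lie_ideal F N1 L1" "lie_ideal F N2 L2"
  shows "lie_free_product_sub F L1 L2 N1 N2 = pres.cls ` lie_terms F (N1 <+> N2)"
proof -
  let ?K1 = "L1\<lparr>carrier := N1\<rparr>" and ?K2 = "L2\<lparr>carrier := N2\<rparr>"
  interpret N1: lie_algebra F ?K1 using assms(1) A.lie_algebra_axioms by (rule lie_ideal_is_lie_algebra)
  interpret N2: lie_algebra F ?K2 using assms(2) B.lie_algebra_axioms by (rule lie_ideal_is_lie_algebra)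
  have s1: "x \<in> N1 \<Longrightarrow> x \<in> carrier L1" for x using lie_idealD(1)[OF assms(1)] by blast
  have s2: "x \<in> N2 \<Longrightarrow> x \<in> carrier L2" for x using lie_idealD(1)[OF assms(2)] by blast
  let ?f = "lie_free_product_incl F L1 L2"
  interpret lie_pres_hom F "N1 <+> N2" "lie_free_product_rels F ?K1 ?K2" FP ?f
  proof
    fix s t assume "(s, t) \<in> lie_free_product_rels F ?K1 ?K2"
    then show "lie_eval FP ?f s = lie_eval FP ?f t"
      unfolding lie_free_product_rels_def lie_alg_rels_def
      by (auto simp: inl inr s1 s2)
  qed (auto simp: inl inr s1 s2)
  have sub: "t \<in> lie_terms F (N1 <+> N2) \<Longrightarrow> t \<in> pres.terms" for t
    by (erule lie_terms_mono) (auto simp: s1 s2)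
  have "lie_eval FP ?f t = pres.cls t" if "t \<in> lie_terms F (N1 <+> N2)" for t
    using pres.eval_self[OF sub[OF that]] incl_def[abs_def] by (simp add: FP_def)
  then have "lie_pres_lift FP ?f ` carrier P = pres.cls ` lie_terms F (N1 <+> N2)"
    by (auto simp: carrier_P lift_cls image_image)
  then show ?thesis
    by (simp add: lie_free_product_sub_def lie_free_product_def)
qed

lemma inl_in_sub: "\<lbrakk>lie_ideal F N1 L1; lie_ideal F N2 L2; n \<in> N1\<rbrakk>
    \<Longrightarrow> inl n \<in> lie_free_product_sub F L1 L2 N1 N2"
  unfolding sub_eq_terms incl_def by (auto intro: lie_terms.intros)

lemma inr_in_sub: "\<lbrakk>lie_ideal F N1 L1; lie_ideal F N2 L2; n \<in> N2\<rbrakk>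
    \<Longrightarrow> inr n \<in> lie_free_product_sub F L1 L2 N1 N2"
  unfolding sub_eq_terms incl_def by (auto intro: lie_terms.intros)

lemma sub_image:
  assumes N: "lie_ideal F N1 L1" "lie_ideal F N2 L2"
    and h: "h \<in> lie_hom F FP C" and C: "lie_algebra F C" and I: "lie_ideal F I C"
    and gens: "\<And>n. n \<in> N1 \<Longrightarrow> h (inl n) \<in> I" "\<And>n. n \<in> N2 \<Longrightarrow> h (inr n) \<in> I"
    and x: "x \<in> lie_free_product_sub F L1 L2 N1 N2"
  shows "h x \<in> I"
proof -
  obtain t where t: "t \<in> lie_terms F (N1 <+> N2)" "x = pres.cls t"
    using x by (auto simp: sub_eq_terms[OF N])
  have sub: "t \<in> lie_terms F (N1 <+> N2) \<Longrightarrow> t \<in> pres.terms" for t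
    by (erule lie_terms_mono) (use lie_idealD(1)[OF N(1)] lie_idealD(1)[OF N(2)] in auto)
  note h' = lie_homD[OF h] and I' = lie_idealD[OF I]
  from t(1) have "h (pres.cls t) \<in> I \<and> pres.cls t \<in> carrier FP"
  proof induction
    case (gen g)
    then show ?case
      using gens sub[OF lie_terms.gen[OF gen]] unfolding FP_def incl_def
      by (auto intro: pres.cls_closed)
  next
    case zero
    then show ?case
      using lie_hom_zero[OF h FP.lie_algebra_axioms C] I'(2)
      by (simp add: FP_def pres.zero_P[symmetric] pres.lie_algebra_P lie_algebra.axioms)
        (metis FP.M.zero_closed FP_def pres.zero_P)
  next
    case (add s t)
    then have "pres.cls (LAdd s t) = pres.cls s \<oplus>\<^bsub>FP\<^esub> pres.cls t"
      using sub by (simp add: FP_def pres.op_cls)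
    then show ?case using add I' h' by simp
  next
    case (smult c t)
    then have "pres.cls (LSmult c t) = c \<odot>\<^bsub>FP\<^esub> pres.cls t"
      using sub by (simp add: FP_def pres.op_cls)
    then show ?case using smult I' h' by simp
  next
    case (bracket s t)
    then have "pres.cls (LBracket s t) = pres.cls s \<otimes>\<^bsub>FP\<^esub> pres.cls t"
      using sub by (simp add: FP_def pres.op_cls)
    then show ?case using bracket I' h' by (auto simp: FP.bracket_closed)
  qed
  then show ?thesis using t(2) by simp
qed

lemma prl_sub:
  assumes "lie_ideal F N1 L1" "lie_ideal F N2 L2" "x \<in> lie_free_product_sub F L1 L2 N1 N2"
  shows "prl x \<in> N1"
  using lie_idealD(1)[OF assms(1)] lie_idealD(1)[OF assms(2)] lie_idealD(2)[OF assms(1)]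
  by (intro sub_image[OF assms(1,2) prl_hom A.lie_algebra_axioms assms(1) _ _ assms(3)])
    (auto simp: subset_iff)

lemma prr_sub:
  assumes "lie_ideal F N1 L1" "lie_ideal F N2 L2" "x \<in> lie_free_product_sub F L1 L2 N1 N2"
  shows "prr x \<in> N2"
  using lie_idealD(1)[OF assms(1)] lie_idealD(1)[OF assms(2)] lie_idealD(2)[OF assms(2)]
  by (intro sub_image[OF assms(1,2) prr_hom B.lie_algebra_axioms assms(2) _ _ assms(3)])
    (auto simp: subset_iff)

lemma sub_full: "lie_free_product_sub F L1 L2 (carrier L1) (carrier L2) = carrier FP"
proof -
  have "lie_ideal F (carrier L1) L1" "lie_ideal F (carrier L2) L2"
    by (auto intro!: lie_idealI A.lie_algebra_axioms B.lie_algebra_axioms A.bracket_closed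
      B.bracket_closed)
  then show ?thesis by (simp add: sub_eq_terms FP_def pres.carrier_P)
qed

end


section \<open>Straightening words\<close>

text \<open>
  The alphabet consists of basis vectors. Two letters are related by \<open>E\<close> if they belong to the same
  Lie algebra, whose structure constants are \<open>c\<close>; only such letters may be interchanged, so that
  words represent elements of the enveloping algebra of a free product. The function \<open>v\<close> prescribes
  values on the words in normal form.
\<close>

locale straightening = cring F for F :: "('f, 'k) ring_scheme" (structure) +
  fixes K :: "'l set" and E gt :: "'l \<Rightarrow> 'l \<Rightarrow> bool" and c :: "'l \<Rightarrow> 'l \<Rightarrow> 'l \<Rightarrow> 'f"
    and v :: "'l list \<Rightarrow> 'f"
  assumes finite_K: "finite K"
    and v_closed [simp]: "v w \<in> carrier F"
    and c_closed [simp]: "c x y k \<in> carrier F"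
    and c_supp: "\<lbrakk>k \<in> K; E x y; c x y k \<noteq> \<zero>\<rbrakk> \<Longrightarrow> E x k"
    and c_swap: "E x y \<Longrightarrow> c y x k = \<ominus> c x y k"
    and c_self: "E x x \<Longrightarrow> c x x k = \<zero>"
    and c_jacobi: "\<lbrakk>E x y; E y z\<rbrakk> \<Longrightarrow>
      (\<Oplus>k\<in>K. c y z k \<otimes> c k x m) \<oplus> (\<Oplus>k\<in>K. c x y k \<otimes> c k z m) = (\<Oplus>k\<in>K. c x z k \<otimes> c k y m)"
    and E_sym: "E x y \<Longrightarrow> E y x"
    and E_trans: "\<lbrakk>E x y; E y z\<rbrakk> \<Longrightarrow> E x z"
    and gt_E: "gt x y \<Longrightarrow> E x y"
    and gt_trans: "\<lbrakk>gt x y; gt y z\<rbrakk> \<Longrightarrow> gt x z"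
    and gt_irrefl: "\<not> gt x x"
    and gt_total: "\<lbrakk>E x y; x \<noteq> y\<rbrakk> \<Longrightarrow> gt x y \<or> gt y x"
begin

fun inversions :: "'l list \<Rightarrow> nat" where
  "inversions [] = 0"
| "inversions (x # xs) = length (filter (gt x) xs) + inversions xs"

lemma inversions_swap: "gt x y \<Longrightarrow> inversions (a @ [y, x] @ b) < inversions (a @ [x, y] @ b)"
proof (induction a)
  case Nil
  then have "\<not> gt y x" using gt_trans gt_irrefl by blast
  then show ?case using Nil by simp
qed simp

definition descent :: "'l list \<Rightarrow> nat \<Rightarrow> bool" where
  "descent w p \<longleftrightarrow> Suc p < length w \<and> gt (w ! p) (w ! Suc p)"

lemma descent_split:
  "descent w p \<Longrightarrow> w = take p w @ [w ! p, w ! Suc p] @ drop (p + 2) w"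
  by (simp add: descent_def Cons_nth_drop_Suc)

abbreviation "word_order \<equiv> measures [length, inversions]"

text \<open>
  The linear functional that rewrites the first descent \<open>xy\<close> of a word into \<open>yx + [x, y]\<close> until no
  descent is left. The first term has fewer inversions, the others are shorter.
\<close>

function straighten :: "'l list \<Rightarrow> 'f" where
  "straighten w = (if \<exists>p. descent w p then
     (let p = (LEAST p. descent w p); a = take p w; x = w ! p; y = w ! Suc p; b = drop (p + 2) w
      in straighten (a @ [y, x] @ b) \<oplus> (\<Oplus>k\<in>K. c x y k \<otimes> straighten (a @ [k] @ b)))
     else v w)"
  by pat_completeness auto
termination
proof (relation word_order)
  show "wf word_order" by (rule wf_measures)
  fix w p a x y b
  assume *: "\<exists>p. descent w p" "p = (LEAST p. descent w p)" "a = take p w" "x = w ! p"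
    "y = w ! Suc p" "b = drop (p + 2) w"
  then have d: "descent w p" by (metis LeastI_ex)
  then have w: "w = a @ [x, y] @ b" using descent_split * by simp
  have "gt x y" using d * by (simp add: descent_def)
  then show "(a @ [y, x] @ b, w) \<in> word_order"
    unfolding w using inversions_swap[of x y a b] by simp
  show "(a @ [k] @ b, w) \<in> word_order" for k
    unfolding w by simp
qed

declare straighten.simps [simp del]

abbreviation "br x y g \<equiv> (\<Oplus>k\<in>K. c x y k \<otimes> g k)"

lemma straighten_irreducible: "(\<And>p. \<not> descent w p) \<Longrightarrow> straighten w = v w"
proof -
  assume "\<And>p. \<not> descent w p"
  then have no: "\<not> (\<exists>p. descent w p)" by blast
  show ?thesis using straighten.simps[of w] unfolding if_not_P[OF no] .
qed

lemma straighten_step: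
  assumes "descent w p" "\<And>q. q < p \<Longrightarrow> \<not> descent w q"
  shows "straighten w = straighten (take p w @ [w ! Suc p, w ! p] @ drop (p + 2) w) \<oplus>
    br (w ! p) (w ! Suc p) (\<lambda>k. straighten (take p w @ [k] @ drop (p + 2) w))"
proof -
  have l: "(LEAST p. descent w p) = p"
    using assms by (intro Least_equality) (auto simp: not_less[symmetric])
  have ex: "\<exists>p. descent w p" using assms(1) by blast
  show ?thesis
    using straighten.simps[of w] unfolding l Let_def if_P[OF ex] .
qed

lemma straighten_first:
  assumes "gt x y" "\<And>p. p < length a \<Longrightarrow> \<not> descent (a @ [x, y] @ b) p"
  shows "straighten (a @ [x, y] @ b) =
    straighten (a @ [y, x] @ b) \<oplus> br x y (\<lambda>k. straighten (a @ [k] @ b))"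
  using straighten_step[of "a @ [x, y] @ b" "length a"] assms
  by (simp add: descent_def nth_append)

lemma br_closed [simp]: "(\<And>k. g k \<in> carrier F) \<Longrightarrow> br x y g \<in> carrier F"
  by (intro finsum_closed) auto

lemma straighten_cases [consumes 0, case_names irreducible descent]:
  assumes "(\<And>p. \<not> descent w p) \<Longrightarrow> Q"
    and "\<And>a x y b. \<lbrakk>w = a @ [x, y] @ b; gt x y;
      \<And>p. p < length a \<Longrightarrow> \<not> descent (a @ [x, y] @ b) p\<rbrakk> \<Longrightarrow> Q"
  shows Q
proof (cases "\<exists>p. descent w p")
  case True
  define p where "p = (LEAST p. descent w p)"
  have p: "descent w p" "\<And>q. q < p \<Longrightarrow> \<not> descent w q"
    unfolding p_def using True by (auto intro: LeastI_ex dest: not_less_Least)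
  have w: "take p w @ [w ! p, w ! Suc p] @ drop (p + 2) w = w"
    using descent_split[OF p(1)] by simp
  show ?thesis
    by (rule assms(2)[OF w[symmetric]]) (use p in \<open>auto simp: w[simplified] descent_def\<close>)
qed (use assms(1) in blast)

lemma straighten_closed [simp]: "straighten w \<in> carrier F"
proof (induction w rule: wf_induct_rule[OF wf_measures[of "[length, inversions]"]])
  case (1 w)
  show ?case
  proof (cases w rule: straighten_cases)
    case irreducible
    then show ?thesis by (simp add: straighten_irreducible)
  next
    case (descent a x y b)
    have "straighten (a @ [y, x] @ b) \<in> carrier F" "straighten (a @ [k] @ b) \<in> carrier F" for k
      using inversions_swap[OF descent(2), of a b] by (auto intro!: 1 simp: descent(1))
    then show ?thesis using straighten_first[OF descent(2,3)] by (simp add: descent(1))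
  qed
qed

lemma br_add:
  assumes "\<And>k. g k \<in> carrier F" "\<And>k. h k \<in> carrier F"
  shows "br x y (\<lambda>k. g k \<oplus> h k) = br x y g \<oplus> br x y h"
  using assms by (simp add: r_distr finsum_addf)

lemma br_cong:
  assumes "\<And>k. k \<in> K \<Longrightarrow> c x y k \<noteq> \<zero> \<Longrightarrow> g k = h k" "\<And>k. g k \<in> carrier F" "\<And>k. h k \<in> carrier F"
  shows "br x y g = br x y h"
proof (rule finsum_cong')
  fix k assume "k \<in> K"
  then show "c x y k \<otimes> g k = c x y k \<otimes> h k"
    by (cases "c x y k = \<zero>") (simp_all add: assms)
qed (use assms in auto)

lemma br_br:
  assumes "\<And>k l. g k l \<in> carrier F"
  shows "br x y (\<lambda>k. br u w (\<lambda>l. g k l)) = br u w (\<lambda>l. br x y (\<lambda>k. g k l))"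
proof -
  have "br x y (\<lambda>k. br u w (\<lambda>l. g k l)) = (\<Oplus>k\<in>K. \<Oplus>l\<in>K. c x y k \<otimes> (c u w l \<otimes> g k l))"
    using assms finite_K by (intro finsum_cong') (auto intro: finsum_rdistr)
  also have "\<dots> = (\<Oplus>l\<in>K. \<Oplus>k\<in>K. c x y k \<otimes> (c u w l \<otimes> g k l))"
    using assms finite_K by (intro finsum_finsum_swap) auto
  also have "\<dots> = (\<Oplus>l\<in>K. c u w l \<otimes> br x y (\<lambda>k. g k l))"
  proof (rule finsum_cong')
    fix l
    have "(\<Oplus>k\<in>K. c x y k \<otimes> (c u w l \<otimes> g k l)) = (\<Oplus>k\<in>K. c u w l \<otimes> (c x y k \<otimes> g k l))"
      using assms by (intro finsum_cong') (auto simp: m_lcomm)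
    then show "(\<Oplus>k\<in>K. c x y k \<otimes> (c u w l \<otimes> g k l)) = c u w l \<otimes> br x y (\<lambda>k. g k l)"
      using assms finite_K by (simp add: finsum_rdistr)
  qed (use assms in auto)
  finally show ?thesis .
qed

lemma br_structure:
  assumes "\<And>m. g m \<in> carrier F"
  shows "br x y (\<lambda>k. br k z g) = (\<Oplus>m\<in>K. (\<Oplus>k\<in>K. c x y k \<otimes> c k z m) \<otimes> g m)"
proof -
  have "br x y (\<lambda>k. br k z g) = (\<Oplus>k\<in>K. \<Oplus>m\<in>K. c x y k \<otimes> c k z m \<otimes> g m)"
    using assms finite_K by (intro finsum_cong') (auto simp: finsum_rdistr m_assoc)
  also have "\<dots> = (\<Oplus>m\<in>K. \<Oplus>k\<in>K. c x y k \<otimes> c k z m \<otimes> g m)"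
    using assms finite_K by (intro finsum_finsum_swap) auto
  also have "\<dots> = (\<Oplus>m\<in>K. (\<Oplus>k\<in>K. c x y k \<otimes> c k z m) \<otimes> g m)"
    using assms finite_K by (intro finsum_cong') (auto simp: finsum_ldistr)
  finally show ?thesis .
qed

text \<open>
  Iterated brackets inside a functional are governed by products of structure constants, so that the
  Jacobi identity for the constants becomes this identity of functionals.
\<close>

lemma br_jacobi:
  assumes "E x y" "E y z" "\<And>m. g m \<in> carrier F"
  shows "br y z (\<lambda>k. br k x g) \<oplus> br x y (\<lambda>k. br k z g) = br x z (\<lambda>k. br k y g)"
proof -
  have "br y z (\<lambda>k. br k x g) \<oplus> br x y (\<lambda>k. br k z g) =
     (\<Oplus>m\<in>K. (\<Oplus>k\<in>K. c y z k \<otimes> c k x m) \<otimes> g m \<oplus> (\<Oplus>k\<in>K. c x y k \<otimes> c k z m) \<otimes> g m)"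
    using assms(3) by (simp add: br_structure finsum_addf)
  also have "\<dots> = (\<Oplus>m\<in>K. (\<Oplus>k\<in>K. c x z k \<otimes> c k y m) \<otimes> g m)"
    using assms(3) c_jacobi[OF assms(1,2)]
    by (intro finsum_cong') (auto simp: l_distr[symmetric])
  finally show ?thesis using assms(3) by (simp add: br_structure)
qed

lemma br_swap:
  assumes "E x y" "\<And>k. g k \<in> carrier F"
  shows "br y x g = \<ominus> br x y g"
proof -
  have "br y x g \<oplus> br x y g = (\<Oplus>k\<in>K. \<zero>)"
    using assms by (subst finsum_addf[symmetric])
      (auto simp: c_swap[OF assms(1)] l_minus l_neg intro!: finsum_cong')
  then show ?thesis using assms(2) by (simp add: minus_equality)
qed

definition straightens :: "'l list \<Rightarrow> 'l \<Rightarrow> 'l \<Rightarrow> 'l list \<Rightarrow> bool" where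
  "straightens a x y b \<longleftrightarrow> straighten (a @ [x, y] @ b) =
     straighten (a @ [y, x] @ b) \<oplus> br x y (\<lambda>k. straighten (a @ [k] @ b))"

lemma straightens_all:
  assumes "E x y" "gt x y \<Longrightarrow> straightens a x y b" "gt y x \<Longrightarrow> straightens a y x b"
  shows "straightens a x y b"
proof -
  consider "x = y" | "gt x y" | "gt y x" using gt_total[OF assms(1)] by blast
  then show ?thesis
  proof cases
    case 1
    have "br x x (\<lambda>k. straighten (a @ [k] @ b)) = (\<Oplus>k\<in>K. \<zero>)"
      using assms(1) 1 by (intro finsum_cong') (auto simp: c_self)
    then show ?thesis using 1 by (simp add: straightens_def)
  next
    case 2 then show ?thesis by (rule assms(2))
  next
    case 3
    show ?thesis
      using assms(3)[OF 3] br_swap[OF assms(1), of "\<lambda>k. straighten (a @ [k] @ b)"]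
      by (simp add: straightens_def a_assoc l_neg)
  qed
qed

text \<open>
  Bergman's diamond argument, by induction on the length and the number of inversions: the result does
  not depend on the descent that is rewritten first. If the first descent overlaps the given one, the
  two rewritings differ by the Jacobi identity; if it is disjoint from it, they commute.
\<close>

lemma straightens_gt: "gt x y \<Longrightarrow> straightens a x y b"
proof (induction "a @ [x, y] @ b" arbitrary: a x y b
    rule: wf_induct_rule[OF wf_measures[of "[length, inversions]"]])
  case (1 a x y b)
  let ?w = "a @ [x, y] @ b"
  have IH: "straightens a' x' y' b'"
    if "gt x' y'" "(a' @ [x', y'] @ b', ?w) \<in> word_order" for a' x' y' b'
    using 1(1)[OF that(2,1)] .
  have IHe: "straighten (a' @ [x', y'] @ b') =
     straighten (a' @ [y', x'] @ b') \<oplus> br x' y' (\<lambda>k. straighten (a' @ [k] @ b'))"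
    if "gt x' y'" "(a' @ [x', y'] @ b', ?w) \<in> word_order" for a' x' y' b'
    using IH[OF that] by (simp only: straightens_def)
  have short: "straighten (a' @ [x', y'] @ b') =
     straighten (a' @ [y', x'] @ b') \<oplus> br x' y' (\<lambda>k. straighten (a' @ [k] @ b'))"
    if "E x' y'" "length a' + length b' < length a + length b" for a' x' y' b'
    using straightens_all[OF that(1), of a' b'] IH that(2) by (simp add: straightens_def)
  have "descent ?w (length a)" using 1 by (simp add: descent_def nth_append)
  define p where "p = (LEAST p. descent ?w p)"
  have p: "descent ?w p" "p \<le> length a" "\<And>q. q < p \<Longrightarrow> \<not> descent ?w q"
    unfolding p_def using \<open>descent ?w (length a)\<close>
    by (auto intro: LeastI Least_le dest: not_less_Least)
  consider "p = length a" | "Suc p = length a" | "Suc (Suc p) \<le> length a" using p(2) by linarith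
  then show ?case
  proof cases
    case 1
    then show ?thesis
      unfolding straightens_def using p(3) \<open>gt x y\<close> by (intro straighten_first) auto
  next
    case 2
    \<comment> \<open>The first descent overlaps the given one: the word contains a decreasing triple.\<close>
    then obtain d u where a: "a = d @ [u]" "length d = p"
      by (cases a rule: rev_cases) auto
    have ux: "gt u x" using p(1) a by (simp add: descent_def nth_append)
    have uy: "gt u y" using gt_trans ux \<open>gt x y\<close> .
    have Eux: "E u x" and Exy: "E x y" and Euy: "E u y" using gt_E ux uy \<open>gt x y\<close> by auto
    let ?S = "\<lambda>w. straighten (d @ w @ b)"
    have inv: "inversions (d @ [x, u, y] @ b) < inversions ?w"
        "inversions (d @ [x, y, u] @ b) < inversions (d @ [x, u, y] @ b)"
        "inversions (d @ [u, y, x] @ b) < inversions ?w"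
        "inversions (d @ [y, u, x] @ b) < inversions (d @ [u, y, x] @ b)"
      using inversions_swap[OF ux, of d "y # b"] inversions_swap[OF uy, of "d @ [x]" b]
        inversions_swap[OF \<open>gt x y\<close>, of "d @ [u]" b] inversions_swap[OF uy, of d "x # b"]
      by (simp_all add: a)
    have first: "?S [u, x, y] = ?S [x, u, y] \<oplus> br u x (\<lambda>k. ?S [k, y])"
      using straighten_first[OF ux, of d "y # b"] p(3) a by simp
    have e1: "?S [x, u, y] = ?S [x, y, u] \<oplus> br u y (\<lambda>k. ?S [x, k])"
      using IHe[OF uy, of "d @ [x]" b] inv by (simp add: a)
    have e2: "?S [x, y, u] = ?S [y, x, u] \<oplus> br x y (\<lambda>k. ?S [k, u])"
      using IHe[OF \<open>gt x y\<close>, of d "u # b"] inv by (simp add: a)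
    have e3: "?S [u, y, x] = ?S [y, u, x] \<oplus> br u y (\<lambda>k. ?S [k, x])"
      using IHe[OF uy, of d "x # b"] inv by (simp add: a)
    have e4: "?S [y, u, x] = ?S [y, x, u] \<oplus> br u x (\<lambda>k. ?S [y, k])"
      using IHe[OF ux, of "d @ [y]" b] inv by (simp add: a)
    \<comment> \<open>On shorter words the commutation of a bracket past the third letter is available.\<close>
    have comm: "br r s (\<lambda>k. ?S [k, t]) =
        br r s (\<lambda>k. ?S [t, k]) \<oplus> br r s (\<lambda>k. br k t (\<lambda>m. ?S [m]))"
      if "E r s" "E r t" for r s t
    proof -
      have "br r s (\<lambda>k. ?S [k, t]) = br r s (\<lambda>k. ?S [t, k] \<oplus> br k t (\<lambda>m. ?S [m]))"
      proof (rule br_cong)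
        fix k assume "k \<in> K" "c r s k \<noteq> \<zero>"
        then have "E k t" using c_supp[OF _ that(1)] that(2) E_sym E_trans by blast
        then show "?S [k, t] = ?S [t, k] \<oplus> br k t (\<lambda>m. ?S [m])"
          using short[of k t d b] a by simp
      qed auto
      then show ?thesis by (simp add: br_add)
    qed
    let ?J = "\<lambda>r s t. br r s (\<lambda>k. br k t (\<lambda>m. ?S [m]))"
    have J: "?J x y u \<oplus> ?J u x y = ?J u y x"
      using br_jacobi[OF Eux Exy, of "\<lambda>m. ?S [m]"] by simp
    have "?S [u, x, y] = ((?S [y, x, u] \<oplus> (br x y (\<lambda>k. ?S [u, k]) \<oplus> ?J x y u))
        \<oplus> br u y (\<lambda>k. ?S [x, k])) \<oplus> (br u x (\<lambda>k. ?S [y, k]) \<oplus> ?J u x y)"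
      by (simp only: first e1 e2 comm[OF Exy E_sym[OF Eux]] comm[OF Eux Euy])
    also have "\<dots> = ((?S [y, x, u] \<oplus> br u x (\<lambda>k. ?S [y, k]))
        \<oplus> (br u y (\<lambda>k. ?S [x, k]) \<oplus> (?J x y u \<oplus> ?J u x y))) \<oplus> br x y (\<lambda>k. ?S [u, k])"
      by (simp add: a_ac)
    also have "\<dots> = ?S [u, y, x] \<oplus> br x y (\<lambda>k. ?S [u, k])"
      using comm[OF Euy Eux] by (simp only: J e3 e4)
    finally show ?thesis by (simp add: straightens_def a)
  next
    case 3
    \<comment> \<open>The two descents are disjoint, and the two straightening steps commute.\<close>
    define a' u z d where "a' = take p a" and "u = a ! p" and "z = a ! Suc p" and "d = drop (p + 2) a"
    have a: "a = a' @ [u, z] @ d"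
      using 3 by (simp add: a'_def u_def z_def d_def Cons_nth_drop_Suc)
    have la: "length a' = p" using 3 by (simp add: a'_def)
    have uz: "gt u z" using p(1) 3 by (simp add: descent_def nth_append u_def z_def)
    have xy: "gt x y" by fact
    let ?S = "\<lambda>r s. straighten (a' @ r @ d @ s @ b)"
    have inv: "inversions (a' @ [z, u] @ d @ [x, y] @ b) < inversions ?w"
      "inversions (a' @ [u, z] @ d @ [y, x] @ b) < inversions ?w"
      using inversions_swap[OF uz, of a' "d @ [x, y] @ b"] inversions_swap[OF xy, of a b]
      by (simp_all add: a)
    have first: "?S [u, z] [x, y] = ?S [z, u] [x, y] \<oplus> br u z (\<lambda>k. ?S [k] [x, y])"
      using straighten_first[OF uz, of a' "d @ [x, y] @ b"] p(3) a la by simp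
    have e1: "?S [z, u] [x, y] = ?S [z, u] [y, x] \<oplus> br x y (\<lambda>l. ?S [z, u] [l])"
      using IHe[OF xy, of "a' @ [z, u] @ d" b] inv by (simp add: a)
    have e2: "?S [k] [x, y] = ?S [k] [y, x] \<oplus> br x y (\<lambda>l. ?S [k] [l])" for k
      using short[OF gt_E[OF xy], of "a' @ [k] @ d" b] by (simp add: a)
    have e3: "?S [u, z] [y, x] = ?S [z, u] [y, x] \<oplus> br u z (\<lambda>k. ?S [k] [y, x])"
      using IHe[OF uz, of a' "d @ [y, x] @ b"] inv by (simp add: a)
    have e4: "?S [u, z] [l] = ?S [z, u] [l] \<oplus> br u z (\<lambda>k. ?S [k] [l])" for l
      using short[OF gt_E[OF uz], of a' "d @ [l] @ b"] by (simp add: a)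
    have "?S [u, z] [x, y] = (?S [z, u] [y, x] \<oplus> br x y (\<lambda>l. ?S [z, u] [l]))
        \<oplus> (br u z (\<lambda>k. ?S [k] [y, x]) \<oplus> br u z (\<lambda>k. br x y (\<lambda>l. ?S [k] [l])))"
      by (simp only: first e1 e2) (simp add: br_add)
    also have "\<dots> = (?S [z, u] [y, x] \<oplus> br u z (\<lambda>k. ?S [k] [y, x]))
        \<oplus> (br x y (\<lambda>l. ?S [z, u] [l]) \<oplus> br x y (\<lambda>l. br u z (\<lambda>k. ?S [k] [l])))"
      by (subst br_br[of "\<lambda>k l. ?S [k] [l]"]) (simp_all add: a_ac)
    also have "\<dots> = ?S [u, z] [y, x] \<oplus> br x y (\<lambda>l. ?S [u, z] [l])"
      by (simp only: e3 e4) (simp add: br_add)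
    finally show ?thesis by (simp add: straightens_def a)
  qed
qed

theorem straighten_relation:
  "E x y \<Longrightarrow> straighten (a @ [x, y] @ b) =
     straighten (a @ [y, x] @ b) \<oplus> (\<Oplus>k\<in>K. c x y k \<otimes> straighten (a @ [k] @ b))"
  using straightens_all[of x y a b] straightens_gt unfolding straightens_def by blast

text \<open>
  This separates a subalgebra from the rest: if \<open>S\<close> is a basis of a subalgebra, then all words that
  occur in the straightening of a word in \<open>S\<close> are words in \<open>S\<close>.
\<close>

lemma straighten_zero:
  assumes closed: "\<And>x y k. \<lbrakk>x \<in> S; y \<in> S; E x y; k \<in> K; c x y k \<noteq> \<zero>\<rbrakk> \<Longrightarrow> k \<in> S"
    and v: "\<And>w. set w \<subseteq> S \<Longrightarrow> v w = \<zero>"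
  shows "set w \<subseteq> S \<Longrightarrow> straighten w = \<zero>"
proof (induction w rule: wf_induct_rule[OF wf_measures[of "[length, inversions]"]])
  case (1 w)
  show ?case
  proof (cases w rule: straighten_cases)
    case irreducible
    then show ?thesis using straighten_irreducible v 1(2) by simp
  next
    case (descent a x y b)
    note w = descent(1) and xy = descent(2)
    have s: "set a \<subseteq> S" "x \<in> S" "y \<in> S" "set b \<subseteq> S" using 1(2) w by auto
    have "straighten (a @ [y, x] @ b) = \<zero>"
      using inversions_swap[OF xy, of a b] s by (intro 1(1)) (auto simp: w)
    moreover have "br x y (\<lambda>k. straighten (a @ [k] @ b)) = br x y (\<lambda>k. \<zero>)"
    proof (rule br_cong)
      fix k assume "k \<in> K" "c x y k \<noteq> \<zero>"
      then have "k \<in> S" using closed s gt_E[OF xy] by blast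
      then show "straighten (a @ [k] @ b) = \<zero>"
        using s by (intro 1(1)) (auto simp: w)
    qed auto
    ultimately show ?thesis
      using straighten_first[OF descent(2,3)] w by simp
  qed
qed

end


section \<open>Coordinates\<close>

definition lin_functional :: "('f, 'k) ring_scheme \<Rightarrow> ('f, 'a, 'm) module_scheme \<Rightarrow> ('a \<Rightarrow> 'f) \<Rightarrow> bool"
  where "lin_functional F V g \<longleftrightarrow> (\<forall>x\<in>carrier V. g x \<in> carrier F) \<and>
    (\<forall>x\<in>carrier V. \<forall>y\<in>carrier V. g (x \<oplus>\<^bsub>V\<^esub> y) = g x \<oplus>\<^bsub>F\<^esub> g y) \<and>
    (\<forall>c\<in>carrier F. \<forall>x\<in>carrier V. g (c \<odot>\<^bsub>V\<^esub> x) = c \<otimes>\<^bsub>F\<^esub> g x)"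

lemma (in vectorspace) lin_functional_lincomb:
  assumes g: "lin_functional K V g" and B: "finite B" "B \<subseteq> carrier V" and a: "a \<in> B \<rightarrow> carrier K"
  shows "g (lincomb a B) = (\<Oplus>\<^bsub>K\<^esub>b\<in>B. a b \<otimes>\<^bsub>K\<^esub> g b)"
  using B a
proof (induction B rule: finite_induct)
  case empty
  have "g (\<zero>\<^bsub>K\<^esub> \<odot>\<^bsub>V\<^esub> \<zero>\<^bsub>V\<^esub>) = \<zero>\<^bsub>K\<^esub> \<otimes>\<^bsub>K\<^esub> g \<zero>\<^bsub>V\<^esub>" and "g \<zero>\<^bsub>V\<^esub> \<in> carrier K"
    using g M.zero_closed R.zero_closed unfolding lin_functional_def by blast+
  then show ?case by (simp add: lincomb_def)
next
  case (insert b B)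
  then have "g (lincomb a (insert b B)) = g (a b \<odot>\<^bsub>V\<^esub> b \<oplus>\<^bsub>V\<^esub> lincomb a B)"
    by (subst lincomb_insert2) auto
  also have "\<dots> = a b \<otimes>\<^bsub>K\<^esub> g b \<oplus>\<^bsub>K\<^esub> g (lincomb a B)"
    using g insert by (simp add: lin_functional_def Pi_iff lincomb_closed)
  finally show ?case
    using insert g by (subst R.finsum_insert) (auto simp: lin_functional_def)
qed

text \<open>
  A basis \<open>B\<close> whose part \<open>C\<close> is a basis of \<open>W\<close>, together with its dual basis \<open>coord\<close>. Membership in \<open>W\<close>
  is read off from the coordinates outside \<open>C\<close>.
\<close>

lemma (in vectorspace) adapted_coordinates:
  assumes fd: "fin_dim" and W: "subspace K W V"
  obtains B C coord where "finite B" "C \<subseteq> B" "B \<subseteq> carrier V" "C \<subseteq> W"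
    and "\<And>b x. coord b x \<in> carrier K"
    and "\<And>b. lin_functional K V (coord b)"
    and "\<And>g x. \<lbrakk>lin_functional K V g; x \<in> carrier V\<rbrakk>
      \<Longrightarrow> g x = (\<Oplus>\<^bsub>K\<^esub>b\<in>B. coord b x \<otimes>\<^bsub>K\<^esub> g b)"
    and "\<And>x. x \<in> carrier V \<Longrightarrow> x \<in> W \<longleftrightarrow> (\<forall>b\<in>B - C. coord b x = \<zero>\<^bsub>K\<^esub>)"
    and "\<And>x. x \<in> carrier V \<Longrightarrow> x \<noteq> \<zero>\<^bsub>V\<^esub> \<Longrightarrow> \<exists>b\<in>B. coord b x \<noteq> \<zero>\<^bsub>K\<^esub>"
    and "\<And>x. x \<in> carrier V \<Longrightarrow> x = lincomb (\<lambda>b. coord b x) B"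
proof -
  have sm: "submodule K W V" using W by simp
  have WV: "W \<subseteq> carrier V" using sm by (rule submodule.subset)
  let ?P = "\<lambda>S. S \<subseteq> W \<and> lin_indpt S"
  have "lin_indpt {}" by (auto simp: lin_dep_def)
  then have P0: "?P {}" by simp
  have "finite S \<and> card S \<le> dim" if "?P S" for S
    using li_le_dim[OF fd, of S] that WV by auto
  from maximal_exists[of ?P dim "{}", OF this P0] obtain C where
    C: "finite C" "maximal C ?P" by blast
  have CW: "C \<subseteq> W" and Cli: "lin_indpt C" using C(2) by (auto simp: maximal_def)
  let ?Q = "\<lambda>S. C \<subseteq> S \<and> S \<subseteq> carrier V \<and> lin_indpt S"
  have Q0: "?Q C" using CW Cli WV by auto
  have "finite S \<and> card S \<le> dim" if "?Q S" for S
    using li_le_dim[OF fd, of S] that by auto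
  from maximal_exists[of ?Q dim C, OF this Q0] obtain B where
    B: "finite B" "maximal B ?Q" by blast
  have CB: "C \<subseteq> B" and BV: "B \<subseteq> carrier V" using B(2) by (auto simp: maximal_def)
  have "maximal B (\<lambda>S. S \<subseteq> carrier V \<and> lin_indpt S)"
    using B(2) CB unfolding maximal_def by (metis subset_trans)
  then have basisB: "basis B" by (rule max_li_is_basis)
  have spanC: "W \<subseteq> span C"
  proof
    fix x assume x: "x \<in> W"
    show "x \<in> span C"
    proof (cases "x \<in> C")
      case True then show ?thesis using CW WV by (intro span_mem) auto
    next
      case False
      then have "lin_dep (C \<union> {x})" using C(2) CW x unfolding maximal_def by blast
      then show ?thesis using lin_dep_iff_in_span[of C x] False x CW WV Cli by blast
    qed
  qed
  have ex1: "\<exists>!a. a \<in> B \<rightarrow>\<^sub>E carrier K \<and> lincomb a B = x" if "x \<in> carrier V" for x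
    using basis_criterion[OF B(1) BV] basisB that by blast
  define coef where "coef x = (THE a. a \<in> B \<rightarrow>\<^sub>E carrier K \<and> lincomb a B = x)" for x
  define coord where "coord b x = (if b \<in> B \<and> x \<in> carrier V then coef x b else \<zero>\<^bsub>K\<^esub>)" for b x
  have coef: "coef x \<in> B \<rightarrow>\<^sub>E carrier K \<and> lincomb (coef x) B = x" if "x \<in> carrier V" for x
    unfolding coef_def using theI'[OF ex1[OF that]] .
  have coordK: "coord b x \<in> carrier K" for b x
    using coef[of x] by (auto simp: coord_def)
  have coord: "lincomb (\<lambda>b. coord b x) B = x" if "x \<in> carrier V" for x
  proof -
    have "lincomb (\<lambda>b. coord b x) B = lincomb (coef x) B"
      using coef[OF that] that BV by (intro lincomb_cong) (auto simp: coord_def)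
    then show ?thesis using coef[OF that] by simp
  qed
  have uniq: "a b = coord b x"
    if a: "a \<in> B \<rightarrow> carrier K" "lincomb a B = x" and b: "b \<in> B" for a b x
  proof -
    have x: "x \<in> carrier V" using a BV by (auto intro: lincomb_closed)
    have "lincomb (restrict a B) B = x"
      using a BV by (subst lincomb_cong[of B B "restrict a B" a]) auto
    moreover have "restrict a B \<in> B \<rightarrow>\<^sub>E carrier K" using a by auto
    ultimately have "restrict a B = coef x" using ex1[OF x] coef[OF x] by blast
    then show ?thesis using b x by (metis coord_def restrict_apply')
  qed
  have lin: "lin_functional K V (coord b)" for b
  proof (cases "b \<in> B")
    case False
    then show ?thesis by (simp add: lin_functional_def coord_def)
  next
    case True
    have "coord b (x \<oplus>\<^bsub>V\<^esub> y) = coord b x \<oplus>\<^bsub>K\<^esub> coord b y"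
      if "x \<in> carrier V" "y \<in> carrier V" for x y
      using lincomb_sum[OF B(1) BV, of "\<lambda>b. coord b x" "\<lambda>b. coord b y"] coord that coordK True
      by (intro uniq[of "\<lambda>b. coord b x \<oplus>\<^bsub>K\<^esub> coord b y", symmetric]) auto
    moreover have "coord b (c \<odot>\<^bsub>V\<^esub> x) = c \<otimes>\<^bsub>K\<^esub> coord b x"
      if "x \<in> carrier V" "c \<in> carrier K" for c x
      using lincomb_smult[OF BV, of "\<lambda>b. coord b x" c] coord that coordK True
      by (intro uniq[of "\<lambda>b. c \<otimes>\<^bsub>K\<^esub> coord b x", symmetric]) auto
    ultimately show ?thesis using coordK by (simp add: lin_functional_def)
  qed
  show ?thesis
  proof (rule that[OF B(1) CB BV CW coordK lin])
    show "g x = (\<Oplus>\<^bsub>K\<^esub>b\<in>B. coord b x \<otimes>\<^bsub>K\<^esub> g b)"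
      if "lin_functional K V g" "x \<in> carrier V" for g x
      using lin_functional_lincomb[OF that(1) B(1) BV, of "\<lambda>b. coord b x"] coordK coord[OF that(2)]
      by auto
    show "x \<in> W \<longleftrightarrow> (\<forall>b\<in>B - C. coord b x = \<zero>\<^bsub>K\<^esub>)" if x: "x \<in> carrier V" for x
    proof
      assume "x \<in> W"
      then obtain a where a: "a \<in> C \<rightarrow> carrier K" "lincomb a C = x"
        using finite_in_span[OF C(1), of x] spanC CW WV by auto
      let ?a = "\<lambda>b. if b \<in> C then a b else \<zero>\<^bsub>K\<^esub>"
      have "lincomb ?a (C \<union> (B - C)) = lincomb ?a C \<oplus>\<^bsub>V\<^esub> lincomb ?a (B - C)"
        using B(1) C(1) BV CW WV a by (intro lincomb_union) auto
      also have "lincomb ?a C = x"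
        using a CW WV by (subst lincomb_cong[of C C ?a a]) auto
      also have "lincomb ?a (B - C) = \<zero>\<^bsub>V\<^esub>"
        using BV by (intro lincomb_zero) auto
      finally have ax: "lincomb ?a B = x" using CB x by (simp add: Un_absorb1)
      have aK: "?a \<in> B \<rightarrow> carrier K" using a(1) by auto
      show "\<forall>b\<in>B - C. coord b x = \<zero>\<^bsub>K\<^esub>"
      proof
        fix b assume b: "b \<in> B - C"
        then have "?a b = coord b x" using uniq[OF aK ax] by blast
        then show "coord b x = \<zero>\<^bsub>K\<^esub>" using b by simp
      qed
    next
      assume z: "\<forall>b\<in>B - C. coord b x = \<zero>\<^bsub>K\<^esub>"
      have "x = lincomb (\<lambda>b. coord b x) (C \<union> (B - C))"
        using coord[OF x] CB by (simp add: Un_absorb1)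
      also have "\<dots> = lincomb (\<lambda>b. coord b x) C \<oplus>\<^bsub>V\<^esub> lincomb (\<lambda>b. coord b x) (B - C)"
        using B(1) C(1) BV CW WV coordK by (intro lincomb_union) auto
      also have "lincomb (\<lambda>b. coord b x) (B - C) = \<zero>\<^bsub>V\<^esub>"
        using BV z by (intro lincomb_zero) auto
      finally have "x = lincomb (\<lambda>b. coord b x) C"
        using CW WV coordK by (simp add: lincomb_closed)
      moreover have "lincomb (\<lambda>b. coord b x) C \<in> span C"
        unfolding span_def mem_Collect_eq
        by (intro exI conjI) (rule HOL.refl, use C(1) coordK in auto)
      ultimately show "x \<in> W" using subsetD[OF span_is_subset[OF CW sm]] by simp
    qed
    show "\<exists>b\<in>B. coord b x \<noteq> \<zero>\<^bsub>K\<^esub>" if "x \<in> carrier V" "x \<noteq> \<zero>\<^bsub>V\<^esub>" for x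
      using lincomb_zero[OF BV, of "\<lambda>b. coord b x"] coord[OF that(1)] that(2) by auto
    show "x = lincomb (\<lambda>b. coord b x) B" if "x \<in> carrier V" for x
      using coord[OF that] by simp
  qed
qed

section \<open>Lie terms acting on functions of words\<close>

text \<open>
  A Lie algebra \<open>D\<close> with basis vectors \<open>em k\<close> and dual basis \<open>co k\<close>, for letters \<open>k\<close> in \<open>K\<close>, where the
  letters fall into classes of \<open>E\<close> that span subalgebras. For the free product, \<open>D\<close> is the direct sum
  of the factors, and there are two classes. In this way both factors share one proof of the Jacobi
  identity for the structure constants.
\<close>

locale lettered_lie_algebra = D: lie_algebra F D
  for F :: "('f, 'k) ring_scheme" (structure) and D :: "('f, 'd, 'm) module_scheme" +
  fixes K :: "'l set" and E :: "'l \<Rightarrow> 'l \<Rightarrow> bool" and em :: "'l \<Rightarrow> 'd" and co :: "'l \<Rightarrow> 'd \<Rightarrow> 'f"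
  assumes finite_K: "finite K"
    and em_closed: "k \<in> K \<Longrightarrow> em k \<in> carrier D"
    and co_closed [simp]: "co k x \<in> carrier F"
    and co_lin: "lin_functional F D (co k)"
    and expand: "\<lbrakk>lin_functional F D g; x \<in> carrier D\<rbrakk>
      \<Longrightarrow> g x = (\<Oplus>k\<in>K. co k x \<otimes> g (em k))"
    and E_K: "E i j \<Longrightarrow> i \<in> K"
    and E_sym: "E i j \<Longrightarrow> E j i"
    and E_trans: "\<lbrakk>E i j; E j k\<rbrakk> \<Longrightarrow> E i k"
    and E_bracket: "\<lbrakk>E i j; k \<in> K; co k (em i \<otimes>\<^bsub>D\<^esub> em j) \<noteq> \<zero>\<rbrakk> \<Longrightarrow> E i k"
begin

lemma E_K2: "E x y \<Longrightarrow> y \<in> K"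
  using E_K E_sym by blast

definition struct :: "'l \<Rightarrow> 'l \<Rightarrow> 'l \<Rightarrow> 'f" where
  "struct x y k = (if E x y then co k (em x \<otimes>\<^bsub>D\<^esub> em y) else \<zero>)"

lemma struct_closed [simp]: "struct x y k \<in> carrier F"
  by (simp add: struct_def)

lemma co_add: "\<lbrakk>x \<in> carrier D; y \<in> carrier D\<rbrakk> \<Longrightarrow> co k (x \<oplus>\<^bsub>D\<^esub> y) = co k x \<oplus> co k y"
  using co_lin[of k] by (simp add: lin_functional_def)

lemma co_smult: "\<lbrakk>c \<in> carrier F; x \<in> carrier D\<rbrakk> \<Longrightarrow> co k (c \<odot>\<^bsub>D\<^esub> x) = c \<otimes> co k x"
  using co_lin[of k] by (simp add: lin_functional_def)

lemma co_neg: "x \<in> carrier D \<Longrightarrow> co k (\<ominus>\<^bsub>D\<^esub> x) = \<ominus> co k x"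
  by (simp add: D.neg_eq_smult co_smult D.l_minus)

lemma co_zero: "co k \<zero>\<^bsub>D\<^esub> = \<zero>"
  using co_smult[of \<zero> "\<zero>\<^bsub>D\<^esub>" k] by simp

lemma lin_bracket: "\<lbrakk>lin_functional F D g; y \<in> carrier D\<rbrakk> \<Longrightarrow> lin_functional F D (\<lambda>x. g (x \<otimes>\<^bsub>D\<^esub> y))"
  by (simp add: lin_functional_def D.bracket_closed D.bracket_add_left D.bracket_smult_left)

lemma struct_sum:
  assumes "E x y" "E y z"
  shows "(\<Oplus>k\<in>K. struct x y k \<otimes> struct k z m) = co m ((em x \<otimes>\<^bsub>D\<^esub> em y) \<otimes>\<^bsub>D\<^esub> em z)"
proof -
  have cl: "em x \<in> carrier D" "em y \<in> carrier D" "em z \<in> carrier D"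
    using assms E_K E_K2 em_closed by blast+
  have "(\<Oplus>k\<in>K. struct x y k \<otimes> struct k z m) =
      (\<Oplus>k\<in>K. co k (em x \<otimes>\<^bsub>D\<^esub> em y) \<otimes> co m (em k \<otimes>\<^bsub>D\<^esub> em z))"
  proof (rule D.R.finsum_cong')
    fix k assume k: "k \<in> K"
    show "struct x y k \<otimes> struct k z m = co k (em x \<otimes>\<^bsub>D\<^esub> em y) \<otimes> co m (em k \<otimes>\<^bsub>D\<^esub> em z)"
    proof (cases "co k (em x \<otimes>\<^bsub>D\<^esub> em y) = \<zero>")
      case False
      then have "E k z" using E_bracket[OF assms(1) k] assms E_sym E_trans by blast
      then show ?thesis using assms by (simp add: struct_def)
    qed (simp add: struct_def assms)
  qed auto
  also have "\<dots> = co m ((em x \<otimes>\<^bsub>D\<^esub> em y) \<otimes>\<^bsub>D\<^esub> em z)"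
    using expand[OF lin_bracket[OF co_lin cl(3)], of "em x \<otimes>\<^bsub>D\<^esub> em y" m] cl
    by (simp add: D.bracket_closed)
  finally show ?thesis .
qed

lemma straightening:
  assumes gt: "\<And>x y. gt x y \<longleftrightarrow> E x y \<and> rank y < (rank x :: nat)" and "inj_on rank K"
    and v: "\<And>w. v w \<in> carrier F"
  shows "straightening F K E gt struct v"
proof
  show "finite K" by (rule finite_K)
  show "v w \<in> carrier F" for w by (rule v)
  show "E x k" if "k \<in> K" "E x y" "struct x y k \<noteq> \<zero>" for x y k
    using E_bracket[OF that(2,1)] that(2,3) by (simp add: struct_def)
  show "struct y x k = \<ominus> struct x y k" if "E x y" for x y k
    using that E_sym[OF that] E_K E_K2 em_closed D.bracket_swap[of "em x" "em y"]
    by (auto simp: struct_def co_neg D.bracket_closed)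
  show "struct x x k = \<zero>" if "E x x" for x k
    using that E_K[OF that] em_closed by (simp add: struct_def D.bracket_self co_zero)
  show "(\<Oplus>k\<in>K. struct y z k \<otimes> struct k x m) \<oplus> (\<Oplus>k\<in>K. struct x y k \<otimes> struct k z m) =
      (\<Oplus>k\<in>K. struct x z k \<otimes> struct k y m)" if e: "E x y" "E y z" for x y z m
  proof -
    have cl: "em x \<in> carrier D" "em y \<in> carrier D" "em z \<in> carrier D"
      using e E_K E_K2 em_closed by blast+
    note bc = D.bracket_closed
    have e': "E z x" "E x z" "E z y" using e E_sym E_trans by blast+
    have "(em x \<otimes>\<^bsub>D\<^esub> em z) \<otimes>\<^bsub>D\<^esub> em y =
        \<ominus>\<^bsub>D\<^esub> (em y \<otimes>\<^bsub>D\<^esub> (em x \<otimes>\<^bsub>D\<^esub> em z))"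
      using cl bc by (intro D.bracket_swap) auto
    moreover have "(em y \<otimes>\<^bsub>D\<^esub> em z) \<otimes>\<^bsub>D\<^esub> em x =
        \<ominus>\<^bsub>D\<^esub> (em x \<otimes>\<^bsub>D\<^esub> (em y \<otimes>\<^bsub>D\<^esub> em z))"
      using cl bc by (intro D.bracket_swap) auto
    ultimately have "((em y \<otimes>\<^bsub>D\<^esub> em z) \<otimes>\<^bsub>D\<^esub> em x) \<oplus>\<^bsub>D\<^esub> ((em x \<otimes>\<^bsub>D\<^esub> em y) \<otimes>\<^bsub>D\<^esub> em z)
        = (em x \<otimes>\<^bsub>D\<^esub> em z) \<otimes>\<^bsub>D\<^esub> em y"
      using cl bc by (simp add: D.bracket_bracket_left[of "em x" "em y" "em z"]
        D.M.a_assoc[symmetric] D.M.l_neg)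
    then show ?thesis
      using struct_sum e e' cl bc by (simp add: co_add[symmetric])
  qed
  show "gt x y \<or> gt y x" if "E x y" "x \<noteq> y" for x y
  proof -
    have "rank x \<noteq> rank y" using that E_K E_K2 assms(2) by (auto dest: inj_onD)
    then show ?thesis using that E_sym by (auto simp: gt)
  qed
  show "E x y \<Longrightarrow> E y x" for x y by (rule E_sym)
  show "\<lbrakk>E x y; E y z\<rbrakk> \<Longrightarrow> E x z" for x y z by (rule E_trans)
  show "\<lbrakk>gt x y; gt y z\<rbrakk> \<Longrightarrow> gt x z" for x y z using E_trans[of x y z] by (simp add: gt)
qed (simp_all add: gt)

text \<open>
  The functionals on words that vanish on the relations \<open>xy - yx - [x, y]\<close> for related letters, at
  every place of a word. On these the Lie algebra acts by appending letters.
\<close>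

definition adm :: "('l list \<Rightarrow> 'f) \<Rightarrow> bool" where
  "adm \<psi> \<longleftrightarrow> (\<forall>w. \<psi> w \<in> carrier F) \<and> (\<forall>a x y b. E x y \<longrightarrow> \<psi> (a @ [x, y] @ b) =
     \<psi> (a @ [y, x] @ b) \<oplus> (\<Oplus>k\<in>K. struct x y k \<otimes> \<psi> (a @ [k] @ b)))"

definition letter_act :: "'d \<Rightarrow> ('l list \<Rightarrow> 'f) \<Rightarrow> 'l list \<Rightarrow> 'f" where
  "letter_act d \<psi> w = (\<Oplus>k\<in>K. co k d \<otimes> \<psi> (w @ [k]))"

primrec word_act :: "('x \<Rightarrow> 'd) \<Rightarrow> ('f, 'x) lie_term \<Rightarrow> ('l list \<Rightarrow> 'f) \<Rightarrow> 'l list \<Rightarrow> 'f" where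
  "word_act e (LGen z) \<psi> = letter_act (e z) \<psi>"
| "word_act e LZero \<psi> = (\<lambda>w. \<zero>)"
| "word_act e (LAdd s t) \<psi> = (\<lambda>w. word_act e s \<psi> w \<oplus> word_act e t \<psi> w)"
| "word_act e (LSmult c t) \<psi> = (\<lambda>w. c \<otimes> word_act e t \<psi> w)"
| "word_act e (LBracket s t) \<psi> =
     (\<lambda>w. word_act e s (word_act e t \<psi>) w \<ominus> word_act e t (word_act e s \<psi>) w)"

lemma letter_act_closed [simp]: "(\<And>w. \<psi> w \<in> carrier F) \<Longrightarrow> letter_act d \<psi> w \<in> carrier F"
  unfolding letter_act_def by (intro D.R.finsum_closed) auto

lemma word_act_closed [simp]:
  "\<lbrakk>t \<in> lie_terms F X; \<And>w. \<psi> w \<in> carrier F\<rbrakk> \<Longrightarrow> word_act e t \<psi> w \<in> carrier F"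
  by (induction arbitrary: \<psi> w rule: lie_terms.induct) auto

lemma sum_pull:
  assumes "c \<in> carrier F" "\<And>k. g k \<in> carrier F" "\<And>k. h k \<in> carrier F"
  shows "c \<otimes> (\<Oplus>k\<in>K. g k \<otimes> h k) = (\<Oplus>k\<in>K. g k \<otimes> (c \<otimes> h k))"
proof -
  have "c \<otimes> (\<Oplus>k\<in>K. g k \<otimes> h k) = (\<Oplus>k\<in>K. c \<otimes> (g k \<otimes> h k))"
    using assms finite_K by (simp add: D.R.finsum_rdistr)
  also have "\<dots> = (\<Oplus>k\<in>K. g k \<otimes> (c \<otimes> h k))"
    using assms by (intro D.R.finsum_cong') (simp_all add: D.R.m_lcomm)
  finally show ?thesis .
qed

lemma letter_act_add:
  assumes "\<And>w. \<psi> w \<in> carrier F" "\<And>w. \<phi> w \<in> carrier F"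
  shows "letter_act d (\<lambda>w. \<psi> w \<oplus> \<phi> w) = (\<lambda>w. letter_act d \<psi> w \<oplus> letter_act d \<phi> w)"
  using assms by (auto simp: letter_act_def D.R.finsum_addf D.R.r_distr Pi_def)

lemma letter_act_smult:
  assumes "\<And>w. \<psi> w \<in> carrier F" "c \<in> carrier F"
  shows "letter_act d (\<lambda>w. c \<otimes> \<psi> w) = (\<lambda>w. c \<otimes> letter_act d \<psi> w)"
  using assms by (auto simp: letter_act_def sum_pull)

lemma word_act_smult:
  "\<lbrakk>t \<in> lie_terms F X; \<And>w. \<psi> w \<in> carrier F; c \<in> carrier F\<rbrakk>
    \<Longrightarrow> word_act e t (\<lambda>w. c \<otimes> \<psi> w) = (\<lambda>w. c \<otimes> word_act e t \<psi> w)"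
proof (induction arbitrary: \<psi> rule: lie_terms.induct)
  case (smult c' t)
  then show ?case by (simp add: D.R.m_lcomm[of c' c])
next
  case (bracket s t)
  then show ?case by (auto simp: D.R.r_distr D.R.r_minus D.R.minus_eq)
qed (auto simp: letter_act_smult D.R.r_distr)

lemma word_act_add:
  "\<lbrakk>t \<in> lie_terms F X; \<And>w. \<psi> w \<in> carrier F; \<And>w. \<phi> w \<in> carrier F\<rbrakk>
    \<Longrightarrow> word_act e t (\<lambda>w. \<psi> w \<oplus> \<phi> w) = (\<lambda>w. word_act e t \<psi> w \<oplus> word_act e t \<phi> w)"
proof (induction arbitrary: \<psi> \<phi> rule: lie_terms.induct)
  case (add s t)
  then show ?case by (auto simp: D.R.a_ac)
next
  case (smult c' t)
  then show ?case by (auto simp: D.R.r_distr)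
next
  case (bracket s t)
  then show ?case by (auto simp: D.R.minus_eq D.R.minus_add D.R.a_ac)
qed (auto simp: letter_act_add)

lemma word_act_minus:
  assumes "t \<in> lie_terms F X" "\<And>w. \<psi> w \<in> carrier F" "\<And>w. \<phi> w \<in> carrier F"
  shows "word_act e t (\<lambda>w. \<psi> w \<ominus> \<phi> w) = (\<lambda>w. word_act e t \<psi> w \<ominus> word_act e t \<phi> w)"
proof -
  have "(\<lambda>w. \<psi> w \<ominus> \<phi> w) = (\<lambda>w. \<psi> w \<oplus> (\<ominus> \<one>) \<otimes> \<phi> w)"
    using assms by (auto simp: D.R.minus_eq D.R.l_minus)
  then have "word_act e t (\<lambda>w. \<psi> w \<ominus> \<phi> w) = (\<lambda>w. word_act e t \<psi> w \<oplus> (\<ominus> \<one>) \<otimes> word_act e t \<phi> w)"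
    using assms by (simp add: word_act_add[of t X] word_act_smult[of t X])
  then show ?thesis using assms by (auto simp: D.R.minus_eq D.R.l_minus)
qed

lemma adm_closed: "adm \<psi> \<Longrightarrow> \<psi> w \<in> carrier F"
  by (simp add: adm_def)

lemma adm_rel: "\<lbrakk>adm \<psi>; E x y\<rbrakk> \<Longrightarrow> \<psi> (a @ [x, y] @ b) =
     \<psi> (a @ [y, x] @ b) \<oplus> (\<Oplus>k\<in>K. struct x y k \<otimes> \<psi> (a @ [k] @ b))"
  by (simp add: adm_def)

lemma adm_zero: "adm (\<lambda>w. \<zero>)"
  by (simp add: adm_def)

lemma adm_add:
  assumes "adm \<psi>" "adm \<phi>"
  shows "adm (\<lambda>w. \<psi> w \<oplus> \<phi> w)"
  unfolding adm_def
proof (intro conjI allI impI)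
  fix a x y b assume "E x y"
  note cl = adm_closed[OF assms(1)] adm_closed[OF assms(2)]
  show "\<psi> (a @ [x, y] @ b) \<oplus> \<phi> (a @ [x, y] @ b) =
     (\<psi> (a @ [y, x] @ b) \<oplus> \<phi> (a @ [y, x] @ b)) \<oplus>
     (\<Oplus>k\<in>K. struct x y k \<otimes> (\<psi> (a @ [k] @ b) \<oplus> \<phi> (a @ [k] @ b)))"
    unfolding adm_rel[OF assms(1) \<open>E x y\<close>] adm_rel[OF assms(2) \<open>E x y\<close>]
    using cl by (simp add: D.R.r_distr D.R.finsum_addf D.R.a_ac Pi_def)
qed (use assms in \<open>auto simp: adm_closed\<close>)

lemma adm_smult:
  assumes "adm \<psi>" "c \<in> carrier F"
  shows "adm (\<lambda>w. c \<otimes> \<psi> w)"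
  unfolding adm_def
proof (intro conjI allI impI)
  fix a x y b assume "E x y"
  note cl = adm_closed[OF assms(1)]
  have "(\<Oplus>k\<in>K. struct x y k \<otimes> (c \<otimes> \<psi> (a @ [k] @ b))) =
      c \<otimes> (\<Oplus>k\<in>K. struct x y k \<otimes> \<psi> (a @ [k] @ b))"
    using cl assms(2) by (simp add: sum_pull)
  then show "c \<otimes> \<psi> (a @ [x, y] @ b) = c \<otimes> \<psi> (a @ [y, x] @ b) \<oplus>
     (\<Oplus>k\<in>K. struct x y k \<otimes> (c \<otimes> \<psi> (a @ [k] @ b)))"
    unfolding adm_rel[OF assms(1) \<open>E x y\<close>]
    using cl assms(2) by (simp add: D.R.r_distr D.R.finsum_closed Pi_def)
qed (use assms in \<open>auto simp: adm_closed\<close>)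

lemma adm_minus:
  assumes "adm \<psi>" "adm \<phi>"
  shows "adm (\<lambda>w. \<psi> w \<ominus> \<phi> w)"
proof -
  have "(\<lambda>w. \<psi> w \<ominus> \<phi> w) = (\<lambda>w. \<psi> w \<oplus> (\<ominus> \<one>) \<otimes> \<phi> w)"
    using assms adm_closed by (auto simp: D.R.minus_eq D.R.l_minus)
  then show ?thesis using assms by (simp add: adm_add adm_smult)
qed

lemma adm_letter_act:
  assumes "adm \<psi>"
  shows "adm (letter_act d \<psi>)"
  unfolding adm_def
proof (intro conjI allI impI)
  note cl = adm_closed[OF assms]
  fix a x y b assume "E x y"
  have "letter_act d \<psi> (a @ [x, y] @ b) = (\<Oplus>j\<in>K. co j d \<otimes> \<psi> (a @ [y, x] @ b @ [j]) \<oplus>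
      co j d \<otimes> (\<Oplus>k\<in>K. struct x y k \<otimes> \<psi> (a @ [k] @ b @ [j])))"
    unfolding letter_act_def using cl adm_rel[OF assms \<open>E x y\<close>, of a "b @ [_]"]
    by (intro D.R.finsum_cong') (auto simp: D.R.r_distr D.R.finsum_closed)
  also have "\<dots> = letter_act d \<psi> (a @ [y, x] @ b) \<oplus>
      (\<Oplus>j\<in>K. co j d \<otimes> (\<Oplus>k\<in>K. struct x y k \<otimes> \<psi> (a @ [k] @ b @ [j])))"
    unfolding letter_act_def using cl
    by (subst D.R.finsum_addf) (auto simp: D.R.finsum_closed)
  also have "(\<Oplus>j\<in>K. co j d \<otimes> (\<Oplus>k\<in>K. struct x y k \<otimes> \<psi> (a @ [k] @ b @ [j]))) =
      (\<Oplus>j\<in>K. \<Oplus>k\<in>K. struct x y k \<otimes> (co j d \<otimes> \<psi> (a @ [k] @ b @ [j])))"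
    using cl by (intro D.R.finsum_cong') (simp_all add: sum_pull D.R.finsum_closed Pi_def)
  also have "\<dots> = (\<Oplus>k\<in>K. \<Oplus>j\<in>K. struct x y k \<otimes> (co j d \<otimes> \<psi> (a @ [k] @ b @ [j])))"
    using cl finite_K by (intro D.R.finsum_finsum_swap) auto
  also have "\<dots> = (\<Oplus>k\<in>K. struct x y k \<otimes> letter_act d \<psi> (a @ [k] @ b))"
    using cl finite_K by (intro D.R.finsum_cong')
      (simp_all add: letter_act_def D.R.finsum_rdistr D.R.finsum_closed Pi_def)
  finally show "letter_act d \<psi> (a @ [x, y] @ b) = letter_act d \<psi> (a @ [y, x] @ b) \<oplus>
      (\<Oplus>k\<in>K. struct x y k \<otimes> letter_act d \<psi> (a @ [k] @ b))" .
qed (use adm_closed[OF assms] in auto)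

lemma adm_word_act: "\<lbrakk>t \<in> lie_terms F X; adm \<psi>\<rbrakk> \<Longrightarrow> adm (word_act e t \<psi>)"
  by (induction arbitrary: \<psi> rule: lie_terms.induct)
    (auto intro: adm_letter_act adm_zero adm_add adm_smult adm_minus)

lemma letter_act_letter_act:
  assumes "\<And>w. \<psi> w \<in> carrier F"
  shows "letter_act d (letter_act d' \<psi>) w = (\<Oplus>i\<in>K. co i d \<otimes> (\<Oplus>j\<in>K. co j d' \<otimes> \<psi> (w @ [i, j])))"
  by (simp add: letter_act_def)

lemma letter_act_lin:
  assumes "\<And>w. \<psi> w \<in> carrier F"
  shows "lin_functional F D (\<lambda>x. letter_act x \<psi> w)"
  using assms finite_K
  by (auto simp: lin_functional_def letter_act_def co_add co_smult D.R.l_distr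
      D.R.finsum_addf D.R.finsum_rdistr D.R.m_assoc intro!: D.R.finsum_cong')

text \<open>
  Vectors \<open>d\<close> and \<open>d'\<close> from the same class of letters act with the correct commutator. For vectors of
  different classes this fails, as it must in a free product.
\<close>

lemma letter_act_bracket:
  assumes \<psi>: "adm \<psi>" and d: "d \<in> carrier D" "d' \<in> carrier D"
    and hom: "\<And>i j. \<lbrakk>i \<in> K; j \<in> K; co i d \<noteq> \<zero>; co j d' \<noteq> \<zero>\<rbrakk> \<Longrightarrow> E i j"
  shows "letter_act (d \<otimes>\<^bsub>D\<^esub> d') \<psi> w =
    letter_act d (letter_act d' \<psi>) w \<ominus> letter_act d' (letter_act d \<psi>) w"
proof -
  note cl = adm_closed[OF \<psi>]
  \<comment> \<open>The functional that evaluates \<open>\<psi>\<close> at \<open>w\<close> followed by a vector.\<close>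
  let ?g = "\<lambda>x. letter_act x \<psi> w"
  have lin: "lin_functional F D ?g" using letter_act_lin cl .
  have lin2: "lin_functional F D (\<lambda>y. ?g (x \<otimes>\<^bsub>D\<^esub> y))" if "x \<in> carrier D" for x
    using lin that by (simp add: lin_functional_def D.bracket_closed D.bracket_add_right
      D.bracket_smult_right)
  let ?T = "\<lambda>x y. letter_act x (letter_act y \<psi>) w"
  have sw: "?T d' d = (\<Oplus>i\<in>K. co i d \<otimes> (\<Oplus>j\<in>K. co j d' \<otimes> \<psi> (w @ [j, i])))"
  proof -
    have "?T d' d = (\<Oplus>j\<in>K. \<Oplus>i\<in>K. co i d \<otimes> (co j d' \<otimes> \<psi> (w @ [j, i])))"
      unfolding letter_act_letter_act[OF cl] using cl
      by (intro D.R.finsum_cong') (simp_all add: sum_pull D.R.finsum_closed Pi_def)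
    also have "\<dots> = (\<Oplus>i\<in>K. \<Oplus>j\<in>K. co i d \<otimes> (co j d' \<otimes> \<psi> (w @ [j, i])))"
      using cl finite_K by (intro D.R.finsum_finsum_swap) auto
    also have "\<dots> = (\<Oplus>i\<in>K. co i d \<otimes> (\<Oplus>j\<in>K. co j d' \<otimes> \<psi> (w @ [j, i])))"
      using cl finite_K
      by (intro D.R.finsum_cong') (simp_all add: D.R.finsum_rdistr D.R.finsum_closed Pi_def)
    finally show ?thesis .
  qed
  have "?g (d \<otimes>\<^bsub>D\<^esub> d') = (\<Oplus>i\<in>K. co i d \<otimes> ?g (em i \<otimes>\<^bsub>D\<^esub> d'))"
    by (rule expand[OF lin_bracket[OF lin d(2)] d(1)])
  also have "\<dots> = (\<Oplus>i\<in>K. co i d \<otimes> (\<Oplus>j\<in>K. co j d' \<otimes> ?g (em i \<otimes>\<^bsub>D\<^esub> em j)))"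
    using expand[OF lin2 d(2)] em_closed cl by (intro D.R.finsum_cong') (auto simp: D.R.finsum_closed)
  finally have 1: "?g (d \<otimes>\<^bsub>D\<^esub> d') = \<dots>" .
  have "?g (d \<otimes>\<^bsub>D\<^esub> d') \<oplus> ?T d' d = (\<Oplus>i\<in>K. co i d \<otimes>
     (\<Oplus>j\<in>K. co j d' \<otimes> ?g (em i \<otimes>\<^bsub>D\<^esub> em j)) \<oplus> co i d \<otimes> (\<Oplus>j\<in>K. co j d' \<otimes> \<psi> (w @ [j, i])))"
    unfolding 1 sw using cl by (subst D.R.finsum_addf) (auto simp: D.R.finsum_closed)
  also have "\<dots> = (\<Oplus>i\<in>K. co i d \<otimes>
     (\<Oplus>j\<in>K. co j d' \<otimes> ?g (em i \<otimes>\<^bsub>D\<^esub> em j) \<oplus> co j d' \<otimes> \<psi> (w @ [j, i])))"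
    using cl by (intro D.R.finsum_cong')
      (auto simp: D.R.finsum_closed D.R.r_distr D.R.finsum_addf Pi_def)
  also have "\<dots> = (\<Oplus>i\<in>K. co i d \<otimes> (\<Oplus>j\<in>K. co j d' \<otimes> \<psi> (w @ [i, j])))"
  proof (rule D.R.finsum_cong')
    fix i assume i: "i \<in> K"
    show "co i d \<otimes> (\<Oplus>j\<in>K. co j d' \<otimes> ?g (em i \<otimes>\<^bsub>D\<^esub> em j) \<oplus> co j d' \<otimes> \<psi> (w @ [j, i])) =
        co i d \<otimes> (\<Oplus>j\<in>K. co j d' \<otimes> \<psi> (w @ [i, j]))"
    proof (cases "co i d = \<zero>")
      case True
      then show ?thesis using cl by (simp add: D.R.finsum_closed)
    next
      case False
      have "co j d' \<otimes> ?g (em i \<otimes>\<^bsub>D\<^esub> em j) \<oplus> co j d' \<otimes> \<psi> (w @ [j, i]) = co j d' \<otimes> \<psi> (w @ [i, j])"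
        if j: "j \<in> K" for j
      proof (cases "co j d' = \<zero>")
        case True
        then show ?thesis using cl by simp
      next
        case nz: False
        have "E i j" using hom[OF i j False nz] .
        then have "\<psi> (w @ [i, j]) = \<psi> (w @ [j, i]) \<oplus> ?g (em i \<otimes>\<^bsub>D\<^esub> em j)"
          using adm_rel[OF \<psi> \<open>E i j\<close>, of w "[]"] by (simp add: letter_act_def struct_def)
        then show ?thesis using cl by (simp add: D.R.r_distr D.R.a_comm)
      qed
      then show ?thesis using cl by (intro arg_cong[of _ _ "\<lambda>x. co i d \<otimes> x"] D.R.finsum_cong') auto
    qed
  qed (use cl in \<open>auto simp: D.R.finsum_closed\<close>)
  also have "\<dots> = ?T d d'" by (simp add: letter_act_letter_act[OF cl])
  finally have "?g (d \<otimes>\<^bsub>D\<^esub> d') \<oplus> ?T d' d = ?T d d'" .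
  then show ?thesis
    using cl by (simp add: D.R.minus_eq D.R.add.inv_solve_right)
qed

text \<open>
  The axioms of Lie algebras hold for commutators of linear operators, so that only the defining
  relations have to be checked. Stating this for terms avoids constructing the Lie algebra of
  operators on admissible functions.
\<close>

lemma word_act_cong:
  assumes rels: "\<And>s t \<psi>. \<lbrakk>(s, t) \<in> R; s \<in> lie_terms F X; t \<in> lie_terms F X; adm \<psi>\<rbrakk>
      \<Longrightarrow> word_act e s \<psi> = word_act e t \<psi>"
  shows "lie_pres_eq F X R s t \<Longrightarrow> adm \<psi> \<Longrightarrow> word_act e s \<psi> = word_act e t \<psi>"
proof (induction arbitrary: \<psi> rule: lie_pres_eq.induct)
  case (rel s t) then show ?case by (intro rels)
next
  case (bracket_cong s s' t t')
  interpret lie_presentation F X R by unfold_locales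
  have "adm (word_act e t' \<psi>)" "adm (word_act e s' \<psi>)"
    using bracket_cong eqv_terms adm_word_act by blast+
  then show ?case using bracket_cong by simp
next
  case (bracket_add_left s t u)
  then show ?case
    by (auto simp: adm_closed word_act_add[of u X] D.R.minus_eq D.R.minus_add D.R.a_ac)
next
  case (bracket_add_right s t u)
  then show ?case
    by (auto simp: adm_closed word_act_add[of s X] D.R.minus_eq D.R.minus_add D.R.a_ac)
next
  case (bracket_smult_left c s t)
  then show ?case
    by (auto simp: adm_closed word_act_smult[of t X] D.R.minus_eq D.R.r_distr D.R.r_minus)
next
  case (bracket_smult_right c s t)
  then show ?case
    by (auto simp: adm_closed word_act_smult[of s X] D.R.minus_eq D.R.r_distr D.R.r_minus)
next
  case (bracket_self t)
  then show ?case by (auto simp: adm_closed D.R.minus_eq D.R.r_neg)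
next
  case (jacobi s t u)
  have *: "((a1 \<ominus> a2) \<ominus> (a3 \<ominus> a4)) \<oplus> ((a3 \<ominus> a5) \<ominus> (a6 \<ominus> a2)) \<oplus> ((a6 \<ominus> a4) \<ominus> (a1 \<ominus> a5)) = \<zero>"
    if "a1 \<in> carrier F" "a2 \<in> carrier F" "a3 \<in> carrier F" "a4 \<in> carrier F" "a5 \<in> carrier F"
       "a6 \<in> carrier F" for a1 a2 a3 a4 a5 a6
    using that by algebra
  show ?case
    using jacobi by (auto simp: adm_closed word_act_minus[of _ X] intro!: *)
qed (auto simp: adm_closed D.R.a_ac D.R.l_distr D.R.r_distr D.R.m_assoc)

end


section \<open>When the free product of two ideals is an ideal\<close>

context lettered_lie_algebra
begin

lemma word_act_zero:
  assumes "t \<in> lie_terms F X" and e: "\<And>z k. \<lbrakk>z \<in> X; k \<in> K; k \<notin> S\<rbrakk> \<Longrightarrow> co k (e z) = \<zero>"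
    and "\<And>w. \<psi> w \<in> carrier F" "\<And>w. set w \<subseteq> S \<Longrightarrow> \<psi> w = \<zero>" "set w \<subseteq> S"
  shows "word_act e t \<psi> w = \<zero>"
  using assms(1,3-)
proof (induction arbitrary: \<psi> w rule: lie_terms.induct)
  case (gen z)
  have "co k (e z) \<otimes> \<psi> (w @ [k]) = \<zero>" if "k \<in> K" for k
    using gen e[OF gen(1) that] by (cases "k \<in> S") auto
  then have "letter_act (e z) \<psi> w = (\<Oplus>k\<in>K. \<zero>)"
    unfolding letter_act_def by (intro D.R.finsum_cong') auto
  then show ?case by simp
next
  case (bracket s t)
  have "word_act e s (word_act e t \<psi>) w = \<zero>" "word_act e t (word_act e s \<psi>) w = \<zero>"
    using bracket by (auto intro!: bracket.IH)
  then show ?case by (simp add: D.R.minus_eq)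
qed auto

end

context lie_free_prod
begin

definition side_eq :: "'a set \<Rightarrow> 'b set \<Rightarrow> 'a + 'b \<Rightarrow> 'a + 'b \<Rightarrow> bool" where
  "side_eq B1 B2 i j \<longleftrightarrow> i \<in> Inl ` B1 \<and> j \<in> Inl ` B1 \<or> i \<in> Inr ` B2 \<and> j \<in> Inr ` B2"

abbreviation em :: "'a + 'b \<Rightarrow> 'a \<times> 'b" where
  "em \<equiv> case_sum (\<lambda>x. (x, \<zero>\<^bsub>L2\<^esub>)) (\<lambda>y. (\<zero>\<^bsub>L1\<^esub>, y))"

text \<open>
  In bases adapted to \<open>N1\<close> and \<open>N2\<close> choose letters \<open>i\<close> and \<open>j\<close> that occur in \<open>l1\<close> and \<open>l2\<close>, one of them
  outside the ideals. The word \<open>ij\<close> is in normal form. The functional that is 1 at \<open>ij\<close> and 0 at all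
  other normal forms vanishes on all words in letters of \<open>N1\<close> and \<open>N2\<close>, hence on \<open>N1 * N2\<close>, but at
  \<open>l1 l2 - l2 l1\<close> its value is the product of two nonzero coordinates.
\<close>

lemma bracket_not_in_sub:
  assumes fd: "vectorspace.fin_dim F L1" "vectorspace.fin_dim F L2"
    and N: "lie_ideal F N1 L1" "lie_ideal F N2 L2"
    and l: "l1 \<in> carrier L1" "l2 \<in> carrier L2"
    and l12: "l1 \<notin> N1 \<and> l2 \<noteq> \<zero>\<^bsub>L2\<^esub> \<or> l2 \<notin> N2 \<and> l1 \<noteq> \<zero>\<^bsub>L1\<^esub>"
  shows "inl l1 \<otimes>\<^bsub>FP\<^esub> inr l2 \<notin> lie_free_product_sub F L1 L2 N1 N2"
proof
  assume in_sub: "inl l1 \<otimes>\<^bsub>FP\<^esub> inr l2 \<in> lie_free_product_sub F L1 L2 N1 N2"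
  have sN: "subspace F N1 L1" "subspace F N2 L2" using N by (simp_all add: lie_ideal_def)
  obtain B1 C1 co1 where B1: "finite B1" "C1 \<subseteq> B1" "B1 \<subseteq> carrier L1" "C1 \<subseteq> N1"
    and co1: "\<And>b x. co1 b x \<in> carrier F" "\<And>b. lin_functional F L1 (co1 b)"
      "\<And>g x. \<lbrakk>lin_functional F L1 g; x \<in> carrier L1\<rbrakk> \<Longrightarrow> g x = (\<Oplus>\<^bsub>F\<^esub>b\<in>B1. co1 b x \<otimes>\<^bsub>F\<^esub> g b)"
      "\<And>x. x \<in> carrier L1 \<Longrightarrow> x \<in> N1 \<longleftrightarrow> (\<forall>b\<in>B1 - C1. co1 b x = \<zero>\<^bsub>F\<^esub>)"
      "\<And>x. x \<in> carrier L1 \<Longrightarrow> x \<noteq> \<zero>\<^bsub>L1\<^esub> \<Longrightarrow> \<exists>b\<in>B1. co1 b x \<noteq> \<zero>\<^bsub>F\<^esub>"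
    apply (rule A.adapted_coordinates[OF fd(1) sN(1)])
    subgoal premises p for B C co by (rule p(1); (rule p(2-); assumption))
    done
  obtain B2 C2 co2 where B2: "finite B2" "C2 \<subseteq> B2" "B2 \<subseteq> carrier L2" "C2 \<subseteq> N2"
    and co2: "\<And>b x. co2 b x \<in> carrier F" "\<And>b. lin_functional F L2 (co2 b)"
      "\<And>g x. \<lbrakk>lin_functional F L2 g; x \<in> carrier L2\<rbrakk> \<Longrightarrow> g x = (\<Oplus>\<^bsub>F\<^esub>b\<in>B2. co2 b x \<otimes>\<^bsub>F\<^esub> g b)"
      "\<And>x. x \<in> carrier L2 \<Longrightarrow> x \<in> N2 \<longleftrightarrow> (\<forall>b\<in>B2 - C2. co2 b x = \<zero>\<^bsub>F\<^esub>)"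
      "\<And>x. x \<in> carrier L2 \<Longrightarrow> x \<noteq> \<zero>\<^bsub>L2\<^esub> \<Longrightarrow> \<exists>b\<in>B2. co2 b x \<noteq> \<zero>\<^bsub>F\<^esub>"
    apply (rule B.adapted_coordinates[OF fd(2) sN(2)])
    subgoal premises p for B C co by (rule p(1); (rule p(2-); assumption))
    done
  let ?D = "lie_direct_sum L1 L2"
  let ?K = "B1 <+> B2"
  define E where "E = side_eq B1 B2"
  define co where "co k v = (case k of Inl b \<Rightarrow> co1 b (fst v) | Inr b \<Rightarrow> co2 b (snd v))" for k v
  interpret D: lie_algebra F ?D
    by (rule lie_algebra_direct_sum) unfold_locales
  have co1_0: "co1 b \<zero>\<^bsub>L1\<^esub> = \<zero>\<^bsub>F\<^esub>" for b
  proof -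
    have "co1 b (\<zero>\<^bsub>F\<^esub> \<odot>\<^bsub>L1\<^esub> \<zero>\<^bsub>L1\<^esub>) = \<zero>\<^bsub>F\<^esub> \<otimes>\<^bsub>F\<^esub> co1 b \<zero>\<^bsub>L1\<^esub>"
      using co1(2)[of b] A.R.zero_closed A.M.zero_closed unfolding lin_functional_def by blast
    then show ?thesis using co1(1) by simp
  qed
  have co2_0: "co2 b \<zero>\<^bsub>L2\<^esub> = \<zero>\<^bsub>F\<^esub>" for b
  proof -
    have "co2 b (\<zero>\<^bsub>F\<^esub> \<odot>\<^bsub>L2\<^esub> \<zero>\<^bsub>L2\<^esub>) = \<zero>\<^bsub>F\<^esub> \<otimes>\<^bsub>F\<^esub> co2 b \<zero>\<^bsub>L2\<^esub>"
      using co2(2)[of b] A.R.zero_closed B.M.zero_closed unfolding lin_functional_def by blast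
    then show ?thesis using co2(1) by simp
  qed
  interpret S: lettered_lie_algebra F ?D ?K E em co
  proof
    show "finite ?K" using B1(1) B2(1) by simp
    show "em k \<in> carrier ?D" if "k \<in> ?K" for k
      using that B1(3) B2(3) by auto
    show "co k x \<in> carrier F" for k x
      by (cases k) (auto simp: co_def co1 co2)
    show "lin_functional F ?D (co k)" for k
      using co1(2) co2(2) by (cases k) (auto simp: co_def lin_functional_def)
    show "g x = (\<Oplus>\<^bsub>F\<^esub>k\<in>?K. co k x \<otimes>\<^bsub>F\<^esub> g (em k))"
      if g: "lin_functional F ?D g" and x: "x \<in> carrier ?D" for g x
    proof -
      have gc: "g v \<in> carrier F" if "v \<in> carrier ?D" for v
        using g that unfolding lin_functional_def by blast
      have gadd: "g (v \<oplus>\<^bsub>?D\<^esub> v') = g v \<oplus>\<^bsub>F\<^esub> g v'"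
        if "v \<in> carrier ?D" "v' \<in> carrier ?D" for v v'
        using g that unfolding lin_functional_def by blast
      have gsmult: "g (c \<odot>\<^bsub>?D\<^esub> v) = c \<otimes>\<^bsub>F\<^esub> g v"
        if "c \<in> carrier F" "v \<in> carrier ?D" for c v
        using g that unfolding lin_functional_def by blast
      have "lin_functional F L1 (\<lambda>u. g (u, \<zero>\<^bsub>L2\<^esub>))"
        unfolding lin_functional_def
      proof (intro conjI ballI)
        show "g (u, \<zero>\<^bsub>L2\<^esub>) \<in> carrier F" if "u \<in> carrier L1" for u using that by (intro gc) auto
        show "g (u \<oplus>\<^bsub>L1\<^esub> u', \<zero>\<^bsub>L2\<^esub>) = g (u, \<zero>\<^bsub>L2\<^esub>) \<oplus>\<^bsub>F\<^esub> g (u', \<zero>\<^bsub>L2\<^esub>)"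
          if "u \<in> carrier L1" "u' \<in> carrier L1" for u u'
          using gadd[of "(u, \<zero>\<^bsub>L2\<^esub>)" "(u', \<zero>\<^bsub>L2\<^esub>)"] that by simp
        show "g (c \<odot>\<^bsub>L1\<^esub> u, \<zero>\<^bsub>L2\<^esub>) = c \<otimes>\<^bsub>F\<^esub> g (u, \<zero>\<^bsub>L2\<^esub>)"
          if "c \<in> carrier F" "u \<in> carrier L1" for c u
          using gsmult[of c "(u, \<zero>\<^bsub>L2\<^esub>)"] that by simp
      qed
      from co1(3)[OF this] have e1: "g (fst x, \<zero>\<^bsub>L2\<^esub>) =
          (\<Oplus>\<^bsub>F\<^esub>b\<in>B1. co1 b (fst x) \<otimes>\<^bsub>F\<^esub> g (b, \<zero>\<^bsub>L2\<^esub>))" using x by auto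
      have "lin_functional F L2 (\<lambda>u. g (\<zero>\<^bsub>L1\<^esub>, u))"
        unfolding lin_functional_def
      proof (intro conjI ballI)
        show "g (\<zero>\<^bsub>L1\<^esub>, u) \<in> carrier F" if "u \<in> carrier L2" for u using that by (intro gc) auto
        show "g (\<zero>\<^bsub>L1\<^esub>, u \<oplus>\<^bsub>L2\<^esub> u') = g (\<zero>\<^bsub>L1\<^esub>, u) \<oplus>\<^bsub>F\<^esub> g (\<zero>\<^bsub>L1\<^esub>, u')"
          if "u \<in> carrier L2" "u' \<in> carrier L2" for u u'
          using gadd[of "(\<zero>\<^bsub>L1\<^esub>, u)" "(\<zero>\<^bsub>L1\<^esub>, u')"] that by simp
        show "g (\<zero>\<^bsub>L1\<^esub>, c \<odot>\<^bsub>L2\<^esub> u) = c \<otimes>\<^bsub>F\<^esub> g (\<zero>\<^bsub>L1\<^esub>, u)"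
          if "c \<in> carrier F" "u \<in> carrier L2" for c u
          using gsmult[of c "(\<zero>\<^bsub>L1\<^esub>, u)"] that by simp
      qed
      from co2(3)[OF this] have e2: "g (\<zero>\<^bsub>L1\<^esub>, snd x) =
          (\<Oplus>\<^bsub>F\<^esub>b\<in>B2. co2 b (snd x) \<otimes>\<^bsub>F\<^esub> g (\<zero>\<^bsub>L1\<^esub>, b))" using x by auto
      have "g x = g ((fst x, \<zero>\<^bsub>L2\<^esub>) \<oplus>\<^bsub>?D\<^esub> (\<zero>\<^bsub>L1\<^esub>, snd x))"
        using x by auto
      also have "\<dots> = g (fst x, \<zero>\<^bsub>L2\<^esub>) \<oplus>\<^bsub>F\<^esub> g (\<zero>\<^bsub>L1\<^esub>, snd x)"
        using x by (intro gadd) auto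
      finally have gx: "g x = \<dots>" .
      let ?h = "\<lambda>k. co k x \<otimes>\<^bsub>F\<^esub> g (em k)"
      have hc: "?h k \<in> carrier F" if "k \<in> ?K" for k
        using that B1(3) B2(3) co1(1) co2(1)
        by (auto simp: co_def intro!: gc A.R.m_closed)
      have "(\<Oplus>\<^bsub>F\<^esub>k\<in>?K. ?h k) = (\<Oplus>\<^bsub>F\<^esub>k\<in>Inl ` B1. ?h k) \<oplus>\<^bsub>F\<^esub> (\<Oplus>\<^bsub>F\<^esub>k\<in>Inr ` B2. ?h k)"
        unfolding Plus_def using B1(1) B2(1) hc by (intro A.R.finsum_Un_disjoint) auto
      also have "(\<Oplus>\<^bsub>F\<^esub>k\<in>Inl ` B1. ?h k) = g (fst x, \<zero>\<^bsub>L2\<^esub>)"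
        unfolding e1 by (subst A.R.finsum_reindex) (use hc in \<open>auto simp: co_def\<close>)
      also have "(\<Oplus>\<^bsub>F\<^esub>k\<in>Inr ` B2. ?h k) = g (\<zero>\<^bsub>L1\<^esub>, snd x)"
        unfolding e2 by (subst A.R.finsum_reindex) (use hc in \<open>auto simp: co_def\<close>)
      finally show ?thesis by (simp add: gx)
    qed
    show "E i k" if "E i j" "k \<in> ?K" "co k (em i \<otimes>\<^bsub>?D\<^esub> em j) \<noteq> \<zero>\<^bsub>F\<^esub>" for i j k
      using that B1(3) B2(3) by (auto simp: E_def side_eq_def co_def co1_0 co2_0 subset_iff)
  qed (auto simp: E_def side_eq_def)
  obtain i j where ij: "i \<in> B1" "j \<in> B2" "co1 i l1 \<noteq> \<zero>\<^bsub>F\<^esub>" "co2 j l2 \<noteq> \<zero>\<^bsub>F\<^esub>" "i \<notin> C1 \<or> j \<notin> C2"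
  proof (cases "l1 \<notin> N1 \<and> l2 \<noteq> \<zero>\<^bsub>L2\<^esub>")
    case True
    obtain i where "i \<in> B1 - C1" "co1 i l1 \<noteq> \<zero>\<^bsub>F\<^esub>" using co1(4)[OF l(1)] True by blast
    moreover obtain j where "j \<in> B2" "co2 j l2 \<noteq> \<zero>\<^bsub>F\<^esub>" using co2(5)[OF l(2)] True by blast
    ultimately show ?thesis using that by blast
  next
    case False
    then have *: "l2 \<notin> N2" "l1 \<noteq> \<zero>\<^bsub>L1\<^esub>" using l12 by auto
    obtain i where "i \<in> B1" "co1 i l1 \<noteq> \<zero>\<^bsub>F\<^esub>" using co1(5)[OF l(1)] * by blast
    moreover obtain j where "j \<in> B2 - C2" "co2 j l2 \<noteq> \<zero>\<^bsub>F\<^esub>" using co2(4)[OF l(2)] * by blast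
    ultimately show ?thesis using that by blast
  qed
  have z1: "co1 b x = \<zero>\<^bsub>F\<^esub>" if "x \<in> N1" "b \<in> B1" "b \<notin> C1" for b x
    using iffD1[OF co1(4) that(1)] subsetD[OF lie_idealD(1)[OF N(1)] that(1)] that(2,3) by blast
  have z2: "co2 b x = \<zero>\<^bsub>F\<^esub>" if "x \<in> N2" "b \<in> B2" "b \<notin> C2" for b x
    using iffD1[OF co2(4) that(1)] subsetD[OF lie_idealD(1)[OF N(2)] that(1)] that(2,3) by blast
  define v where "v w = (if w = [Inl i, Inr j] then \<one>\<^bsub>F\<^esub> else \<zero>\<^bsub>F\<^esub>)" for w :: "('a + 'b) list"
  obtain rank :: "'a + 'b \<Rightarrow> nat" where rank: "inj_on rank ?K"
    using finite_imp_inj_to_nat_seg[OF S.finite_K] by blast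
  define gt where "gt x y \<longleftrightarrow> E x y \<and> rank y < rank x" for x y
  interpret W: straightening F ?K E gt S.struct v
    by (rule S.straightening[OF gt_def rank]) (simp add: v_def)
  let ?\<phi> = W.straighten
  have adm: "S.adm ?\<phi>"
    unfolding S.adm_def using W.straighten_relation by simp
  note cl = S.adm_closed[OF adm]
  have mixed: "?\<phi> [x, y] = v [x, y]" if "\<not> E x y" for x y
    using that by (intro W.straighten_irreducible) (auto simp: W.descent_def gt_def less_Suc_eq)
  \<comment> \<open>The action is compatible with the relations of the free product.\<close>
  have lin: "lin_functional F ?D (\<lambda>x. S.letter_act x \<psi> w)" if "S.adm \<psi>" for \<psi> w
    using S.letter_act_lin S.adm_closed[OF that] by blast
  have rels: "S.word_act em s \<psi> = S.word_act em t \<psi>"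
    if st: "(s, t) \<in> lie_free_product_rels F L1 L2" and \<psi>: "S.adm \<psi>" for s t \<psi>
  proof
    fix w
    note lin' = lin[OF \<psi>, of w, unfolded lin_functional_def]
    have add: "S.letter_act (d \<oplus>\<^bsub>?D\<^esub> d') \<psi> w = S.letter_act d \<psi> w \<oplus>\<^bsub>F\<^esub> S.letter_act d' \<psi> w"
      if "d \<in> carrier ?D" "d' \<in> carrier ?D" for d d' using lin' that by blast
    have smult: "S.letter_act (c \<odot>\<^bsub>?D\<^esub> d) \<psi> w = c \<otimes>\<^bsub>F\<^esub> S.letter_act d \<psi> w"
      if "c \<in> carrier F" "d \<in> carrier ?D" for c d using lin' that by blast
    have br1: "S.letter_act ((x, \<zero>\<^bsub>L2\<^esub>) \<otimes>\<^bsub>?D\<^esub> (y, \<zero>\<^bsub>L2\<^esub>)) \<psi> w =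
      S.letter_act (x, \<zero>\<^bsub>L2\<^esub>) (S.letter_act (y, \<zero>\<^bsub>L2\<^esub>) \<psi>) w \<ominus>\<^bsub>F\<^esub>
      S.letter_act (y, \<zero>\<^bsub>L2\<^esub>) (S.letter_act (x, \<zero>\<^bsub>L2\<^esub>) \<psi>) w"
      if "x \<in> carrier L1" "y \<in> carrier L1" for x y
      using that by (intro S.letter_act_bracket \<psi>) (auto simp: co_def co2_0 E_def side_eq_def)
    have br2: "S.letter_act ((\<zero>\<^bsub>L1\<^esub>, x) \<otimes>\<^bsub>?D\<^esub> (\<zero>\<^bsub>L1\<^esub>, y)) \<psi> w =
      S.letter_act (\<zero>\<^bsub>L1\<^esub>, x) (S.letter_act (\<zero>\<^bsub>L1\<^esub>, y) \<psi>) w \<ominus>\<^bsub>F\<^esub>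
      S.letter_act (\<zero>\<^bsub>L1\<^esub>, y) (S.letter_act (\<zero>\<^bsub>L1\<^esub>, x) \<psi>) w"
      if "x \<in> carrier L2" "y \<in> carrier L2" for x y
      using that by (intro S.letter_act_bracket \<psi>) (auto simp: co_def co1_0 E_def side_eq_def)
    from st show "S.word_act em s \<psi> w = S.word_act em t \<psi> w"
      unfolding lie_free_product_rels_def lie_alg_rels_def
      using add[of "(_, \<zero>\<^bsub>L2\<^esub>)" "(_, \<zero>\<^bsub>L2\<^esub>)"] add[of "(\<zero>\<^bsub>L1\<^esub>, _)" "(\<zero>\<^bsub>L1\<^esub>, _)"]
        smult[of _ "(_, \<zero>\<^bsub>L2\<^esub>)"] smult[of _ "(\<zero>\<^bsub>L1\<^esub>, _)"] br1 br2
      by auto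
  qed
  obtain t where t: "t \<in> lie_terms F (N1 <+> N2)" "inl l1 \<otimes>\<^bsub>FP\<^esub> inr l2 = pres.cls t"
    using in_sub by (auto simp: sub_eq_terms[OF N])
  let ?s = "LBracket (LGen (Inl l1)) (LGen (Inr l2))"
  have tt: "t \<in> pres.terms"
    using t(1) by (rule lie_terms_mono) (use lie_idealD(1)[OF N(1)] lie_idealD(1)[OF N(2)] in auto)
  have st: "?s \<in> pres.terms" using l by (auto intro!: lie_terms.intros)
  have "pres.cls ?s = pres.cls t"
    using t(2) l by (simp add: FP_def incl_def pres.bracket_cls lie_terms.gen InlI InrI)
  then have "pres.eqv ?s t" using pres.cls_eq_iff[OF st tt] by simp
  then have eq: "S.word_act em ?s ?\<phi> [] = S.word_act em t ?\<phi> []"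
    using S.word_act_cong[of "lie_free_product_rels F L1 L2" "carrier L1 <+> carrier L2" em ?s t ?\<phi>]
      rels adm by metis
  \<comment> \<open>On one side the value is zero, since \<open>t\<close> only involves letters of \<open>N1\<close> and \<open>N2\<close>.\<close>
  let ?S = "Inl ` C1 \<union> Inr ` C2"
  have "?\<phi> w = \<zero>\<^bsub>F\<^esub>" if "set w \<subseteq> ?S" for w
  proof (rule W.straighten_zero[of ?S, OF _ _ that])
    fix x y k assume a: "x \<in> ?S" "y \<in> ?S" "E x y" "k \<in> ?K" "S.struct x y k \<noteq> \<zero>\<^bsub>F\<^esub>"
    show "k \<in> ?S"
    proof (rule ccontr)
      assume k: "k \<notin> ?S"
      have f: "fst (em x \<otimes>\<^bsub>?D\<^esub> em y) \<in> N1" "snd (em x \<otimes>\<^bsub>?D\<^esub> em y) \<in> N2"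
      proof -
        have C: "C1 \<subseteq> carrier L1" "C2 \<subseteq> carrier L2" using B1 B2 by auto
        from a(1-3) consider
            x' y' where "x = Inl x'" "y = Inl y'" "x' \<in> C1" "y' \<in> C1"
          | x' y' where "x = Inr x'" "y = Inr y'" "x' \<in> C2" "y' \<in> C2"
          unfolding E_def side_eq_def by blast
        then have "fst (em x \<otimes>\<^bsub>?D\<^esub> em y) \<in> N1 \<and> snd (em x \<otimes>\<^bsub>?D\<^esub> em y) \<in> N2"
        proof cases
          case 1
          then show ?thesis
            using lie_idealD(5)[OF N(1), of x' y'] lie_idealD(2)[OF N(2)] C B1(4) by auto
        next
          case 2
          then show ?thesis
            using lie_idealD(5)[OF N(2), of x' y'] lie_idealD(2)[OF N(1)] C B2(4) by auto
        qed
        then show "fst (em x \<otimes>\<^bsub>?D\<^esub> em y) \<in> N1" "snd (em x \<otimes>\<^bsub>?D\<^esub> em y) \<in> N2"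
          by blast+
      qed
      have "co k (em x \<otimes>\<^bsub>?D\<^esub> em y) = \<zero>\<^bsub>F\<^esub>"
        using a(4) k z1[OF f(1)] z2[OF f(2)]
        by (auto simp: co_def image_iff simp del: bracket_direct_sum)
      then show False using a(3,5) by (simp add: S.struct_def)
    qed
  next
    show "v w = \<zero>\<^bsub>F\<^esub>" if "set w \<subseteq> ?S" for w
      using that ij(5) by (auto simp: v_def)
  qed
  then have rhs: "S.word_act em t ?\<phi> [] = \<zero>\<^bsub>F\<^esub>"
  proof (intro S.word_act_zero[OF t(1), of ?S])
    fix z k assume "z \<in> N1 <+> N2" "k \<in> ?K" "k \<notin> ?S"
    then show "co k (em z) = \<zero>\<^bsub>F\<^esub>"
      by (auto simp: co_def co1_0 co2_0 image_iff z1 z2)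
  qed (use cl in auto)
  \<comment> \<open>On the other side it is the product of two nonzero coordinates.\<close>
  have "S.letter_act (\<zero>\<^bsub>L1\<^esub>, l2) (S.letter_act (l1, \<zero>\<^bsub>L2\<^esub>) ?\<phi>) [] = (\<Oplus>\<^bsub>F\<^esub>x\<in>?K. \<zero>\<^bsub>F\<^esub>)"
    unfolding S.letter_act_letter_act[OF cl]
  proof (rule A.R.finsum_cong')
    fix x assume x: "x \<in> ?K"
    have "co y (l1, \<zero>\<^bsub>L2\<^esub>) \<otimes>\<^bsub>F\<^esub> ?\<phi> ([] @ [x, y]) = \<zero>\<^bsub>F\<^esub>"
      if "y \<in> ?K" "co x (\<zero>\<^bsub>L1\<^esub>, l2) \<noteq> \<zero>\<^bsub>F\<^esub>" for y
    proof (cases "y \<in> Inl ` B1")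
      case True
      then have "\<not> E x y" "?\<phi> ([] @ [x, y]) = v [x, y]"
        using that x mixed by (auto simp: co_def co1_0 E_def side_eq_def)
      moreover have "v [x, y] = \<zero>\<^bsub>F\<^esub>" using True by (auto simp: v_def)
      ultimately show ?thesis by simp
    next
      case False
      then show ?thesis using that cl by (auto simp: co_def co2_0)
    qed
    then have "(\<Oplus>\<^bsub>F\<^esub>y\<in>?K. co y (l1, \<zero>\<^bsub>L2\<^esub>) \<otimes>\<^bsub>F\<^esub> ?\<phi> ([] @ [x, y])) = (\<Oplus>\<^bsub>F\<^esub>y\<in>?K. \<zero>\<^bsub>F\<^esub>)"
      if "co x (\<zero>\<^bsub>L1\<^esub>, l2) \<noteq> \<zero>\<^bsub>F\<^esub>"
      using that by (intro A.R.finsum_cong') auto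
    then show "co x (\<zero>\<^bsub>L1\<^esub>, l2) \<otimes>\<^bsub>F\<^esub>
        (\<Oplus>\<^bsub>F\<^esub>y\<in>?K. co y (l1, \<zero>\<^bsub>L2\<^esub>) \<otimes>\<^bsub>F\<^esub> ?\<phi> ([] @ [x, y])) = \<zero>\<^bsub>F\<^esub>"
      using cl by (cases "co x (\<zero>\<^bsub>L1\<^esub>, l2) = \<zero>\<^bsub>F\<^esub>") (simp_all add: A.R.finsum_closed Pi_def)
  qed auto
  then have second: "S.letter_act (\<zero>\<^bsub>L1\<^esub>, l2) (S.letter_act (l1, \<zero>\<^bsub>L2\<^esub>) ?\<phi>) [] = \<zero>\<^bsub>F\<^esub>" by simp
  let ?c = "co1 i l1" and ?d = "co2 j l2"
  have inner: "(\<Oplus>\<^bsub>F\<^esub>y\<in>?K. co y (\<zero>\<^bsub>L1\<^esub>, l2) \<otimes>\<^bsub>F\<^esub> ?\<phi> ([] @ [x, y])) =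
      (if Inl i = x then ?d else \<zero>\<^bsub>F\<^esub>)" if x: "x \<in> Inl ` B1" for x
  proof -
    have "co y (\<zero>\<^bsub>L1\<^esub>, l2) \<otimes>\<^bsub>F\<^esub> ?\<phi> ([] @ [x, y]) =
        (if Inr j = y then (if Inl i = x then ?d else \<zero>\<^bsub>F\<^esub>) else \<zero>\<^bsub>F\<^esub>)"
      if y: "y \<in> ?K" for y
    proof (cases "y \<in> Inr ` B2")
      case True
      then have "\<not> E x y" using x by (auto simp: E_def side_eq_def)
      then show ?thesis using mixed[of x y] co2(1) True by (auto simp: v_def co_def)
    next
      case False
      then show ?thesis using y cl by (auto simp: co_def co1_0)
    qed
    then have "(\<Oplus>\<^bsub>F\<^esub>y\<in>?K. co y (\<zero>\<^bsub>L1\<^esub>, l2) \<otimes>\<^bsub>F\<^esub> ?\<phi> ([] @ [x, y])) =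
        (\<Oplus>\<^bsub>F\<^esub>y\<in>?K. if Inr j = y then (if Inl i = x then ?d else \<zero>\<^bsub>F\<^esub>) else \<zero>\<^bsub>F\<^esub>)"
      using co2(1) by (intro A.R.finsum_cong') auto
    also have "\<dots> = (if Inl i = x then ?d else \<zero>\<^bsub>F\<^esub>)"
      using ij co2(1) S.finite_K
      by (intro A.R.add.finprod_singleton[where f = "\<lambda>_. if Inl i = x then ?d else \<zero>\<^bsub>F\<^esub>"]) auto
    finally show ?thesis .
  qed
  have "S.letter_act (l1, \<zero>\<^bsub>L2\<^esub>) (S.letter_act (\<zero>\<^bsub>L1\<^esub>, l2) ?\<phi>) [] =
      (\<Oplus>\<^bsub>F\<^esub>x\<in>?K. if Inl i = x then ?c \<otimes>\<^bsub>F\<^esub> ?d else \<zero>\<^bsub>F\<^esub>)"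
    unfolding S.letter_act_letter_act[OF cl]
  proof (rule A.R.finsum_cong')
    fix x assume x: "x \<in> ?K"
    show "co x (l1, \<zero>\<^bsub>L2\<^esub>) \<otimes>\<^bsub>F\<^esub> (\<Oplus>\<^bsub>F\<^esub>y\<in>?K. co y (\<zero>\<^bsub>L1\<^esub>, l2) \<otimes>\<^bsub>F\<^esub> ?\<phi> ([] @ [x, y])) =
        (if Inl i = x then ?c \<otimes>\<^bsub>F\<^esub> ?d else \<zero>\<^bsub>F\<^esub>)"
    proof (cases "x \<in> Inl ` B1")
      case True
      then show ?thesis unfolding inner[OF True] using co1(1) by (auto simp: co_def)
    next
      case False
      then have "co x (l1, \<zero>\<^bsub>L2\<^esub>) = \<zero>\<^bsub>F\<^esub>" "Inl i \<noteq> x"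
        using x ij(1) by (auto simp: co_def co2_0)
      then show ?thesis using cl by (simp add: A.R.finsum_closed Pi_def)
    qed
  qed (use co1(1) co2(1) in auto)
  also have "\<dots> = ?c \<otimes>\<^bsub>F\<^esub> ?d"
    using ij co1(1) co2(1) S.finite_K
    by (intro A.R.add.finprod_singleton[where f = "\<lambda>_. ?c \<otimes>\<^bsub>F\<^esub> ?d"]) auto
  finally have "S.word_act em ?s ?\<phi> [] = ?c \<otimes>\<^bsub>F\<^esub> ?d"
    using second co1(1) co2(1) by (simp add: A.R.minus_eq)
  then have "?c \<otimes>\<^bsub>F\<^esub> ?d = \<zero>\<^bsub>F\<^esub>" using eq rhs by simp
  then show False using ij(3,4) co1(1) co2(1) A.field.integral by blast
qed

text \<open>
  For an ideal \<open>N1 * N2\<close> the bracket of an element of \<open>N2\<close> with one of \<open>L1\<close> lies in \<open>N1 * N2\<close>, which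
  contradicts the previous lemma unless the first is zero or the second lies in \<open>N1\<close>.
\<close>

theorem sub_ideal_cases:
  assumes fd: "vectorspace.fin_dim F L1" "vectorspace.fin_dim F L2"
    and N: "lie_ideal F N1 L1" "lie_ideal F N2 L2"
    and I: "lie_ideal F (lie_free_product_sub F L1 L2 N1 N2) FP"
  shows "(N1 = carrier L1 \<or> N2 = {\<zero>\<^bsub>L2\<^esub>}) \<and> (N2 = carrier L2 \<or> N1 = {\<zero>\<^bsub>L1\<^esub>})"
proof (intro conjI)
  show "N1 = carrier L1 \<or> N2 = {\<zero>\<^bsub>L2\<^esub>}"
  proof (rule ccontr)
    assume "\<not> ?thesis"
    then obtain l n where "l \<in> carrier L1" "l \<notin> N1" "n \<in> N2" "n \<noteq> \<zero>\<^bsub>L2\<^esub>"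
      using lie_idealD(1,2)[OF N(1)] lie_idealD(1,2)[OF N(2)] by blast
    moreover from this have "n \<in> carrier L2" using lie_idealD(1)[OF N(2)] by blast
    ultimately show False
      using bracket_not_in_sub[OF fd N, of l n] lie_idealD(5)[OF I, of "inl l" "inr n"]
        inr_in_sub[OF N] inl(1) by blast
  qed
  show "N2 = carrier L2 \<or> N1 = {\<zero>\<^bsub>L1\<^esub>}"
  proof (rule ccontr)
    assume "\<not> ?thesis"
    then obtain l n where "l \<in> carrier L2" "l \<notin> N2" "n \<in> N1" "n \<noteq> \<zero>\<^bsub>L1\<^esub>"
      using lie_idealD(1,2)[OF N(1)] lie_idealD(1,2)[OF N(2)] by blast
    moreover from this have "n \<in> carrier L1" using lie_idealD(1)[OF N(1)] by blast
    ultimately show False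
      using bracket_not_in_sub[OF fd N, of n l] inl_in_sub[OF N] inr(1)
        lie_ideal_bracket_left[OF I FP.lie_algebra_axioms, of "inl n" "inr l"] by blast
  qed
qed

end


section \<open>The three isomorphisms from a decomposition of the kernel\<close>

lemma lie_commutator_ideal:
  assumes "lie_pair F L N"
  shows "lie_commutator F L N (carrier L) \<subseteq> N"
    and "lie_ideal F (lie_commutator F L N (carrier L)) (L\<lparr>carrier := N\<rparr>)"
    and "\<lbrakk>n \<in> N; l \<in> carrier L\<rbrakk> \<Longrightarrow> n \<otimes>\<^bsub>L\<^esub> l \<in> lie_commutator F L N (carrier L)"
proof -
  interpret lie_pair_tensor F L N by (simp add: lie_pair_tensor_def assms)
  let ?G = "{a \<otimes>\<^bsub>L\<^esub> b | a b. a \<in> N \<and> b \<in> carrier L}"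
  have GN: "?G \<subseteq> N" using N_bracket_left by auto
  then have GL: "?G \<subseteq> carrier L" using N_closed(1) by auto
  have sN: "submodule F N L" using ideal_N by (simp add: lie_ideal_def)
  show CN: "lie_commutator F L N (carrier L) \<subseteq> N"
    unfolding lie_commutator_def by (rule span_is_subset[OF GN sN])
  have G: "?G \<subseteq> lie_commutator F L N (carrier L)"
    unfolding lie_commutator_def by (rule in_own_span[OF GL])
  then show C: "\<lbrakk>n \<in> N; l \<in> carrier L\<rbrakk> \<Longrightarrow> n \<otimes>\<^bsub>L\<^esub> l \<in> lie_commutator F L N (carrier L)" for n l
    by auto
  interpret S: submodule F "lie_commutator F L N (carrier L)" L
    unfolding lie_commutator_def by (rule span_is_submodule[OF GL])
  show "lie_ideal F (lie_commutator F L N (carrier L)) (L\<lparr>carrier := N\<rparr>)"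
  proof (rule lie_idealI)
    show "lie_algebra F (L\<lparr>carrier := N\<rparr>)" by (rule N_lie_algebra)
  qed (use CN C N_sub in auto)
qed

locale free_pair = lie_free_prod F L1 L2
  for F :: "('f, 'k) ring_scheme" and L1 :: "('f, 'a, 'm) module_scheme"
    and L2 :: "('f, 'b, 'n) module_scheme" +
  fixes N1 :: "'a set" and N2 :: "'b set"
  assumes pair1: "lie_pair F L1 N1" and pair2: "lie_pair F L2 N2"
    and pairFP: "lie_pair F FP (lie_free_product_sub F L1 L2 N1 N2)"
begin

abbreviation "N \<equiv> lie_free_product_sub F L1 L2 N1 N2"
abbreviation "D \<equiv> lie_direct_sum L1 L2"

sublocale P1: lie_pair_tensor F L1 N1 by (simp add: lie_pair_tensor_def pair1)
sublocale P2: lie_pair_tensor F L2 N2 by (simp add: lie_pair_tensor_def pair2)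
sublocale P: lie_pair_tensor F FP N by (simp add: lie_pair_tensor_def pairFP)
sublocale PD: lie_pair_tensor F D "N1 \<times> N2"
  by (simp add: lie_pair_tensor_def lie_pair_direct_sum pair1 pair2)

lemmas N_incl = inl_in_sub[OF P1.ideal_N P2.ideal_N] inr_in_sub[OF P1.ideal_N P2.ideal_N]
lemmas N_proj = prl_sub[OF P1.ideal_N P2.ideal_N] prr_sub[OF P1.ideal_N P2.ideal_N]

abbreviation "T1 \<equiv> pair_tensor F L1 N1"
abbreviation "T2 \<equiv> pair_tensor F L2 N2"
abbreviation "T \<equiv> pair_tensor F FP N"
abbreviation "TD \<equiv> pair_tensor F D (N1 \<times> N2)"

text \<open>
  The retractions \<open>r1\<close> and \<open>r2\<close> of \<open>i1\<close> and \<open>i2\<close> start from the tensor product \<open>TD\<close> of the pair of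
  direct sums; the map \<open>pD\<close> to \<open>TD\<close> is the one that part (ii) of the theorem is about.
\<close>

definition "i1 = tensor_map F FP N (\<lambda>x. inl x)"
definition "i2 = tensor_map F FP N (\<lambda>y. inr y)"
definition "r1 = tensor_map F L1 N1 fst"
definition "r2 = tensor_map F L2 N2 snd"
definition "pD = tensor_map F D (N1 \<times> N2) (\<lambda>x. (prl x, prr x))"

lemma i1: "i1 \<in> lie_hom F T1 T"
    "\<And>l n. \<lbrakk>l \<in> carrier L1; n \<in> N1\<rbrakk> \<Longrightarrow> i1 (P1.tens l n) = P.tens (inl l) (inl n)"
    "\<And>t. t \<in> carrier T1 \<Longrightarrow> pair_kappa FP (i1 t) = inl (pair_kappa L1 t)"
    "\<And>t. t \<in> diagonal_ideal F L1 N1 \<Longrightarrow> i1 t \<in> diagonal_ideal F FP N"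
  unfolding i1_def using tensor_map[OF pair1 pairFP inl_hom N_incl(1)] by blast+

lemma i2: "i2 \<in> lie_hom F T2 T"
    "\<And>l n. \<lbrakk>l \<in> carrier L2; n \<in> N2\<rbrakk> \<Longrightarrow> i2 (P2.tens l n) = P.tens (inr l) (inr n)"
    "\<And>t. t \<in> carrier T2 \<Longrightarrow> pair_kappa FP (i2 t) = inr (pair_kappa L2 t)"
    "\<And>t. t \<in> diagonal_ideal F L2 N2 \<Longrightarrow> i2 t \<in> diagonal_ideal F FP N"
  unfolding i2_def using tensor_map[OF pair2 pairFP inr_hom N_incl(2)] by blast+

lemma fst_N: "n \<in> N1 \<times> N2 \<Longrightarrow> fst n \<in> N1" and snd_N: "n \<in> N1 \<times> N2 \<Longrightarrow> snd n \<in> N2"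
  by auto

lemma r1: "r1 \<in> lie_hom F TD T1"
    "\<And>l n. \<lbrakk>l \<in> carrier D; n \<in> N1 \<times> N2\<rbrakk> \<Longrightarrow> r1 (PD.tens l n) = P1.tens (fst l) (fst n)"
    "\<And>t. t \<in> carrier TD \<Longrightarrow> pair_kappa L1 (r1 t) = fst (pair_kappa D t)"
    "\<And>t. t \<in> diagonal_ideal F D (N1 \<times> N2) \<Longrightarrow> r1 t \<in> diagonal_ideal F L1 N1"
  unfolding r1_def using tensor_map[OF PD.pair pair1 lie_hom_fst fst_N] by blast+

lemma r2: "r2 \<in> lie_hom F TD T2"
    "\<And>l n. \<lbrakk>l \<in> carrier D; n \<in> N1 \<times> N2\<rbrakk> \<Longrightarrow> r2 (PD.tens l n) = P2.tens (snd l) (snd n)"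
    "\<And>t. t \<in> carrier TD \<Longrightarrow> pair_kappa L2 (r2 t) = snd (pair_kappa D t)"
    "\<And>t. t \<in> diagonal_ideal F D (N1 \<times> N2) \<Longrightarrow> r2 t \<in> diagonal_ideal F L2 N2"
  unfolding r2_def using tensor_map[OF PD.pair pair2 lie_hom_snd snd_N] by blast+

lemma proj_N: "n \<in> N \<Longrightarrow> (prl n, prr n) \<in> N1 \<times> N2"
  using N_proj by auto

lemma pD: "pD \<in> lie_hom F T TD"
    "\<And>l n. \<lbrakk>l \<in> carrier FP; n \<in> N\<rbrakk> \<Longrightarrow> pD (P.tens l n) = PD.tens (prl l, prr l) (prl n, prr n)"
    "\<And>t. t \<in> carrier T \<Longrightarrow> pair_kappa D (pD t) = (prl (pair_kappa FP t), prr (pair_kappa FP t))"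
    "\<And>t. t \<in> diagonal_ideal F FP N \<Longrightarrow> pD t \<in> diagonal_ideal F D (N1 \<times> N2)"
  unfolding pD_def using tensor_map[OF pairFP PD.pair lie_hom_pair[OF prl_hom prr_hom] proj_N]
  by blast+

lemmas homs = lie_homD[OF i1(1)] lie_homD[OF i2(1)] lie_homD[OF r1(1)] lie_homD[OF r2(1)]
  lie_homD[OF pD(1)]
lemmas zeros =
  lie_hom_zero[OF i1(1) P1.TT.lie_algebra_axioms P.TT.lie_algebra_axioms]
  lie_hom_zero[OF i2(1) P2.TT.lie_algebra_axioms P.TT.lie_algebra_axioms]
  lie_hom_zero[OF r1(1) PD.TT.lie_algebra_axioms P1.TT.lie_algebra_axioms]
  lie_hom_zero[OF r2(1) PD.TT.lie_algebra_axioms P2.TT.lie_algebra_axioms]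
  lie_hom_zero[OF pD(1) P.TT.lie_algebra_axioms PD.TT.lie_algebra_axioms]

lemma zero_N: "\<zero>\<^bsub>L1\<^esub> \<in> N1" "\<zero>\<^bsub>L2\<^esub> \<in> N2"
  by (simp_all add: P1.N_closed P2.N_closed)

lemma pD_i1: "\<lbrakk>l \<in> carrier L1; n \<in> N1\<rbrakk>
    \<Longrightarrow> pD (i1 (P1.tens l n)) = PD.tens (l, \<zero>\<^bsub>L2\<^esub>) (n, \<zero>\<^bsub>L2\<^esub>)"
  by (simp add: i1 pD inl N_incl P1.N_sub)

lemma pD_i2: "\<lbrakk>l \<in> carrier L2; n \<in> N2\<rbrakk>
    \<Longrightarrow> pD (i2 (P2.tens l n)) = PD.tens (\<zero>\<^bsub>L1\<^esub>, l) (\<zero>\<^bsub>L1\<^esub>, n)"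
  by (simp add: i2 pD inr N_incl P2.N_sub)

lemma r1_i1: "t \<in> carrier T1 \<Longrightarrow> r1 (pD (i1 t)) = t"
  by (rule P1.TT_hom_ext[OF lie_hom_comp[OF i1(1) lie_hom_comp[OF pD(1) r1(1)]] lie_hom_ident
        P1.TT.lie_algebra_axioms])
    (simp_all add: pD_i1 r1 zero_N)

lemma r2_i2: "t \<in> carrier T2 \<Longrightarrow> r2 (pD (i2 t)) = t"
  by (rule P2.TT_hom_ext[OF lie_hom_comp[OF i2(1) lie_hom_comp[OF pD(1) r2(1)]] lie_hom_ident
        P2.TT.lie_algebra_axioms])
    (simp_all add: pD_i2 r2 zero_N)

lemma r2_i1: "t \<in> carrier T1 \<Longrightarrow> r2 (pD (i1 t)) = \<zero>\<^bsub>T2\<^esub>"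
  by (rule P1.TT_hom_ext[OF lie_hom_comp[OF i1(1) lie_hom_comp[OF pD(1) r2(1)]]
        lie_hom_zero_map[OF P1.TT.lie_algebra_axioms P2.TT.lie_algebra_axioms]
        P2.TT.lie_algebra_axioms])
    (simp_all add: pD_i1 r2 zero_N)

lemma r1_i2: "t \<in> carrier T2 \<Longrightarrow> r1 (pD (i2 t)) = \<zero>\<^bsub>T1\<^esub>"
  by (rule P2.TT_hom_ext[OF lie_hom_comp[OF i2(1) lie_hom_comp[OF pD(1) r1(1)]]
        lie_hom_zero_map[OF P2.TT.lie_algebra_axioms P1.TT.lie_algebra_axioms]
        P1.TT.lie_algebra_axioms])
    (simp_all add: pD_i2 r1 zero_N)

abbreviation "C1 \<equiv> lie_commutator F L1 N1 (carrier L1)"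
abbreviation "C2 \<equiv> lie_commutator F L2 N2 (carrier L2)"
abbreviation "A1 \<equiv> pair_abelianization F L1 N1"
abbreviation "A2 \<equiv> pair_abelianization F L2 N2"

sublocale Q1: lie_quotient_algebra F "L1\<lparr>carrier := N1\<rparr>" C1
  by (simp add: lie_quotient_algebra_def lie_quotient_algebra_axioms_def P1.N_lie_algebra
    lie_commutator_ideal[OF pair1])
sublocale Q2: lie_quotient_algebra F "L2\<lparr>carrier := N2\<rparr>" C2
  by (simp add: lie_quotient_algebra_def lie_quotient_algebra_axioms_def P2.N_lie_algebra
    lie_commutator_ideal[OF pair2])

lemma A1_def: "A1 = Q1.Q" and A2_def: "A2 = Q2.Q"
  by (simp_all add: pair_abelianization_def)

sublocale W: lie_actions F A1 A2 "\<lambda>_ _. \<zero>\<^bsub>A2\<^esub>" "\<lambda>_ _. \<zero>\<^bsub>A1\<^esub>"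
proof -
  interpret A1: lie_algebra F A1 unfolding A1_def by (rule Q1.lie_algebra_Q)
  interpret A2: lie_algebra F A2 unfolding A2_def by (rule Q2.lie_algebra_Q)
  show "lie_actions F A1 A2 (\<lambda>_ _. \<zero>\<^bsub>A2\<^esub>) (\<lambda>_ _. \<zero>\<^bsub>A1\<^esub>)"
    by unfold_locales auto
qed

abbreviation "WT \<equiv> lie_tensor_trivial F A1 A2"

lemma WT_def: "WT = W.T"
  by (simp add: lie_tensor_trivial_def)

sublocale WT: lie_algebra F WT
  unfolding WT_def by (rule W.T.lie_algebra_axioms)

definition ab_tens where "ab_tens x y = W.gen (Q1.q x) (Q2.q y)"

lemma W_bracket:
  assumes "x \<in> carrier WT" "y \<in> carrier WT"
  shows "x \<otimes>\<^bsub>WT\<^esub> y = \<zero>\<^bsub>WT\<^esub>"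
proof -
  have z: "W.gen \<zero>\<^bsub>A1\<^esub> v = \<zero>\<^bsub>W.T\<^esub>" if "v \<in> carrier A2" for v
    using W.gen_smult_left[of "\<zero>\<^bsub>F\<^esub>" "\<zero>\<^bsub>A1\<^esub>" v] that by simp
  have "x \<otimes>\<^bsub>W.T\<^esub> y = \<zero>\<^bsub>W.T\<^esub>" using assms(1)[unfolded WT_def]
  proof (induction rule: W.T_induct)
    case (gen m n)
    from assms(2)[unfolded WT_def] show ?case
      by (induction rule: W.T_induct)
        (auto simp: W.bracket_gen gen z W.T.bracket_add_right W.T.bracket_smult_right)
  qed (use assms(2) in \<open>auto simp: WT_def W.T.bracket_add_left W.T.bracket_smult_left\<close>)
  then show ?thesis by (simp add: WT_def)
qed

lemma A1_cases:
  assumes "u \<in> carrier A1" obtains x where "x \<in> N1" "u = Q1.q x"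
  using Q1.Q_cases[of u] assms by (auto simp: A1_def)

lemma A2_cases:
  assumes "u \<in> carrier A2" obtains x where "x \<in> N2" "u = Q2.q x"
  using Q2.Q_cases[of u] assms by (auto simp: A2_def)

lemma q1_ops:
  "\<lbrakk>x \<in> N1; x' \<in> N1\<rbrakk> \<Longrightarrow> Q1.q x \<otimes>\<^bsub>A1\<^esub> Q1.q x' = Q1.q (x \<otimes>\<^bsub>L1\<^esub> x')"
  "\<lbrakk>x \<in> N1; x' \<in> N1\<rbrakk> \<Longrightarrow> Q1.q x \<oplus>\<^bsub>A1\<^esub> Q1.q x' = Q1.q (x \<oplus>\<^bsub>L1\<^esub> x')"
  "\<lbrakk>c \<in> carrier F; x \<in> N1\<rbrakk> \<Longrightarrow> c \<odot>\<^bsub>A1\<^esub> Q1.q x = Q1.q (c \<odot>\<^bsub>L1\<^esub> x)"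
  using Q1.q_bracket[of x x'] Q1.q_add[of x x'] Q1.q_smult[of c x] by (simp_all add: A1_def)

lemma q2_ops:
  "\<lbrakk>y \<in> N2; y' \<in> N2\<rbrakk> \<Longrightarrow> Q2.q y \<otimes>\<^bsub>A2\<^esub> Q2.q y' = Q2.q (y \<otimes>\<^bsub>L2\<^esub> y')"
  "\<lbrakk>y \<in> N2; y' \<in> N2\<rbrakk> \<Longrightarrow> Q2.q y \<oplus>\<^bsub>A2\<^esub> Q2.q y' = Q2.q (y \<oplus>\<^bsub>L2\<^esub> y')"
  "\<lbrakk>c \<in> carrier F; y \<in> N2\<rbrakk> \<Longrightarrow> c \<odot>\<^bsub>A2\<^esub> Q2.q y = Q2.q (c \<odot>\<^bsub>L2\<^esub> y)"
  using Q2.q_bracket[of y y'] Q2.q_add[of y y'] Q2.q_smult[of c y] by (simp_all add: A2_def)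

lemma q1_in_A1: "x \<in> N1 \<Longrightarrow> Q1.q x \<in> carrier A1" and q2_in_A2: "y \<in> N2 \<Longrightarrow> Q2.q y \<in> carrier A2"
  using Q1.q_closed[of x] Q2.q_closed[of y] by (simp_all add: A1_def A2_def)

lemma ab_tens_linear:
  "\<lbrakk>x \<in> N1; x' \<in> N1; y \<in> N2\<rbrakk> \<Longrightarrow> ab_tens (x \<oplus>\<^bsub>L1\<^esub> x') y = ab_tens x y \<oplus>\<^bsub>WT\<^esub> ab_tens x' y"
  "\<lbrakk>x \<in> N1; y \<in> N2; y' \<in> N2\<rbrakk> \<Longrightarrow> ab_tens x (y \<oplus>\<^bsub>L2\<^esub> y') = ab_tens x y \<oplus>\<^bsub>WT\<^esub> ab_tens x y'"
  "\<lbrakk>c \<in> carrier F; x \<in> N1; y \<in> N2\<rbrakk> \<Longrightarrow> ab_tens (c \<odot>\<^bsub>L1\<^esub> x) y = c \<odot>\<^bsub>WT\<^esub> ab_tens x y"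
  "\<lbrakk>c \<in> carrier F; x \<in> N1; y \<in> N2\<rbrakk> \<Longrightarrow> ab_tens x (c \<odot>\<^bsub>L2\<^esub> y) = c \<odot>\<^bsub>WT\<^esub> ab_tens x y"
  using W.gen_add_left[of "Q1.q x" "Q1.q x'" "Q2.q y"] W.gen_add_right[of "Q1.q x" "Q2.q y" "Q2.q y'"]
    W.gen_smult_left[of c "Q1.q x" "Q2.q y"] W.gen_smult_right[of c "Q1.q x" "Q2.q y"]
  by (simp_all add: ab_tens_def WT_def q1_ops q2_ops q1_in_A1 q2_in_A2)

lemma ab_tens_closed [simp]: "\<lbrakk>x \<in> N1; y \<in> N2\<rbrakk> \<Longrightarrow> ab_tens x y \<in> carrier WT"
  unfolding ab_tens_def WT_def
  by (rule W.gen_closed) (use Q1.q_closed[of x] Q2.q_closed[of y] in \<open>auto simp: A1_def A2_def\<close>)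

lemma WT_hom_ext:
  assumes "h \<in> lie_hom F WT A" "k \<in> lie_hom F WT A" "lie_algebra F A"
    and "\<And>x y. \<lbrakk>x \<in> N1; y \<in> N2\<rbrakk> \<Longrightarrow> h (ab_tens x y) = k (ab_tens x y)" and "w \<in> carrier WT"
  shows "h w = k w"
proof (rule W.T_hom_ext[of h A k w])
  fix u v assume "u \<in> carrier A1" "v \<in> carrier A2"
  then show "h (W.gen u v) = k (W.gen u v)"
    using assms(4) by (auto elim!: A1_cases A2_cases simp: ab_tens_def)
qed (use assms in \<open>auto simp: WT_def\<close>)

definition sym_tens where
  "sym_tens x y = P.tens (inl x) (inr y) \<oplus>\<^bsub>T\<^esub> P.tens (inr y) (inl x)"

lemma incl_closed [simp]: "x \<in> N1 \<Longrightarrow> inl x \<in> carrier FP" "y \<in> N2 \<Longrightarrow> inr y \<in> carrier FP"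
  using inl(1) inr(1) P1.N_sub P2.N_sub by blast+

lemma sym_tens_closed [simp]: "\<lbrakk>x \<in> N1; y \<in> N2\<rbrakk> \<Longrightarrow> sym_tens x y \<in> carrier T"
  by (simp add: sym_tens_def N_incl)

lemma sym_tens_kappa: "\<lbrakk>x \<in> N1; y \<in> N2\<rbrakk> \<Longrightarrow> pair_kappa FP (sym_tens x y) = \<zero>\<^bsub>FP\<^esub>"
  using FP.bracket_swap[of "inr y" "inl x"]
  by (simp add: sym_tens_def P.kappa P.kappa_tens N_incl FP.bracket_closed FP.M.l_neg)

text \<open>
  Polarization: \<open>(x + y) \<otimes> (x + y) - x \<otimes> x - y \<otimes> y\<close> is the symmetrized tensor of \<open>x\<close> and \<open>y\<close>.
\<close>

lemma sym_tens_diagonal: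
  assumes "x \<in> N1" "y \<in> N2"
  shows "sym_tens x y \<in> diagonal_ideal F FP N"
proof -
  let ?x = "inl x" and ?y = "inr y"
  note D = lie_idealD[OF P.diagonal_ideal_lie_ideal]
    lie_ideal_minus[OF P.diagonal_ideal_lie_ideal P.TT.lie_algebra_axioms]
  have xy: "?x \<in> N" "?y \<in> N" using assms N_incl by auto
  have cancel: "v = (u \<oplus>\<^bsub>T\<^esub> v) \<oplus>\<^bsub>T\<^esub> \<ominus>\<^bsub>T\<^esub> u" if "u \<in> carrier T" "v \<in> carrier T" for u v
    using that by (simp add: P.TT.M.a_comm[of u v] P.TT.M.a_assoc P.TT.M.r_neg)
  have cl: "P.tens u v \<in> carrier T" if "u \<in> {?x, ?y}" "v \<in> {?x, ?y}" for u v
    using that assms xy by auto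
  have "P.tens (?x \<oplus>\<^bsub>FP\<^esub> ?y) (?x \<oplus>\<^bsub>FP\<^esub> ?y) =
      (P.tens ?x ?x \<oplus>\<^bsub>T\<^esub> P.tens ?x ?y) \<oplus>\<^bsub>T\<^esub> (P.tens ?y ?x \<oplus>\<^bsub>T\<^esub> P.tens ?y ?y)"
    using xy assms by (simp add: P.tens_add_left P.tens_add_right P.N_closed P.TT.M.a_ac)
  also have "\<dots> = (P.tens ?x ?x \<oplus>\<^bsub>T\<^esub> P.tens ?y ?y) \<oplus>\<^bsub>T\<^esub> sym_tens x y"
    using cl by (simp add: sym_tens_def P.TT.M.a_ac)
  finally have "sym_tens x y = P.tens (?x \<oplus>\<^bsub>FP\<^esub> ?y) (?x \<oplus>\<^bsub>FP\<^esub> ?y) \<oplus>\<^bsub>T\<^esub>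
      \<ominus>\<^bsub>T\<^esub> (P.tens ?x ?x \<oplus>\<^bsub>T\<^esub> P.tens ?y ?y)"
    using cl assms cancel[of "P.tens ?x ?x \<oplus>\<^bsub>T\<^esub> P.tens ?y ?y" "sym_tens x y"] by simp
  moreover have "P.tens (?x \<oplus>\<^bsub>FP\<^esub> ?y) (?x \<oplus>\<^bsub>FP\<^esub> ?y) \<in> diagonal_ideal F FP N"
    using xy by (intro P.tens_diagonal) (simp add: P.N_closed)
  ultimately show ?thesis using P.tens_diagonal xy D by simp
qed

lemma sym_tens_add_left: "\<lbrakk>x \<in> N1; x' \<in> N1; y \<in> N2\<rbrakk> \<Longrightarrow> sym_tens (x \<oplus>\<^bsub>L1\<^esub> x') y = sym_tens x y \<oplus>\<^bsub>T\<^esub> sym_tens x' y"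
  by (simp add: sym_tens_def inl P1.N_sub P.tens_add_left P.tens_add_right N_incl P.TT.M.a_ac)

lemma sym_tens_add_right: "\<lbrakk>x \<in> N1; y \<in> N2; y' \<in> N2\<rbrakk> \<Longrightarrow> sym_tens x (y \<oplus>\<^bsub>L2\<^esub> y') = sym_tens x y \<oplus>\<^bsub>T\<^esub> sym_tens x y'"
  by (simp add: sym_tens_def inr P2.N_sub P.tens_add_left P.tens_add_right N_incl P.TT.M.a_ac)

lemma sym_tens_smult_left: "\<lbrakk>c \<in> carrier F; x \<in> N1; y \<in> N2\<rbrakk> \<Longrightarrow> sym_tens (c \<odot>\<^bsub>L1\<^esub> x) y = c \<odot>\<^bsub>T\<^esub> sym_tens x y"
  by (simp add: sym_tens_def inl P1.N_sub P.tens_smult_left P.tens_smult_right N_incl P.TT.smult_r_distr)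

lemma sym_tens_smult_right: "\<lbrakk>c \<in> carrier F; x \<in> N1; y \<in> N2\<rbrakk> \<Longrightarrow> sym_tens x (c \<odot>\<^bsub>L2\<^esub> y) = c \<odot>\<^bsub>T\<^esub> sym_tens x y"
  by (simp add: sym_tens_def inr P2.N_sub P.tens_smult_left P.tens_smult_right N_incl P.TT.smult_r_distr)

text \<open>
  The map \<open>W \<rightarrow> T\<close> induced by symmetrized tensors, defined on cosets by means of representatives.
\<close>

definition sym_map where
  "sym_map = lie_pres_lift T (\<lambda>(u, v). sym_tens (SOME x. x \<in> N1 \<and> Q1.q x = u) (SOME y. y \<in> N2 \<and> Q2.q y = v))"

end

text \<open>
  The hypotheses say that \<open>sym_map\<close> is independent of the representatives. They hold trivially if \<open>N1\<close>
  or \<open>N2\<close> is zero, and by the identity for symmetrized brackets if \<open>N1 = L1\<close> and \<open>N2 = L2\<close>.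
\<close>

locale free_pair_sym = free_pair +
  assumes sym_tens_C1: "\<lbrakk>c \<in> C1; y \<in> N2\<rbrakk> \<Longrightarrow> sym_tens c y = \<zero>\<^bsub>T\<^esub>"
    and sym_tens_C2: "\<lbrakk>x \<in> N1; d \<in> C2\<rbrakk> \<Longrightarrow> sym_tens x d = \<zero>\<^bsub>T\<^esub>"
begin

lemma C_sub: "c \<in> C1 \<Longrightarrow> c \<in> N1" "d \<in> C2 \<Longrightarrow> d \<in> N2"
  using lie_commutator_ideal(1)[OF pair1] lie_commutator_ideal(1)[OF pair2] by auto

lemma sym_tens_cong:
  assumes "x \<in> N1" "x' \<in> N1" "Q1.q x = Q1.q x'" "y \<in> N2" "y' \<in> N2" "Q2.q y = Q2.q y'"
  shows "sym_tens x y = sym_tens x' y'"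
proof -
  obtain c where c: "c \<in> C1" "x = c \<oplus>\<^bsub>L1\<^esub> x'"
    using Q1.sub.a_rcos_self[of x] assms(1,3) by (auto simp: a_r_coset_def')
  obtain d where d: "d \<in> C2" "y = d \<oplus>\<^bsub>L2\<^esub> y'"
    using Q2.sub.a_rcos_self[of y] assms(4,6) by (auto simp: a_r_coset_def')
  have "sym_tens x y = sym_tens c y \<oplus>\<^bsub>T\<^esub> sym_tens x' y" using assms c C_sub by (simp add: sym_tens_add_left)
  also have "\<dots> = sym_tens x' y" using assms c by (simp add: sym_tens_C1)
  also have "\<dots> = sym_tens x' d \<oplus>\<^bsub>T\<^esub> sym_tens x' y'" using assms d C_sub by (simp add: sym_tens_add_right)
  also have "\<dots> = sym_tens x' y'" using assms d by (simp add: sym_tens_C2)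
  finally show ?thesis .
qed

lemma sym_map_hom: "sym_map \<in> lie_hom F WT T"
  and sym_map_ab_tens: "\<lbrakk>x \<in> N1; y \<in> N2\<rbrakk> \<Longrightarrow> sym_map (ab_tens x y) = sym_tens x y"
proof -
  let ?x = "\<lambda>u. SOME x. x \<in> N1 \<and> Q1.q x = u" and ?y = "\<lambda>v. SOME y. y \<in> N2 \<and> Q2.q y = v"
  let ?g = "\<lambda>u v. sym_tens (?x u) (?y v)"
  have x: "?x (Q1.q x) \<in> N1 \<and> Q1.q (?x (Q1.q x)) = Q1.q x" if "x \<in> N1" for x
    using someI[of "\<lambda>z. z \<in> N1 \<and> Q1.q z = Q1.q x" x] that by blast
  have y: "?y (Q2.q y) \<in> N2 \<and> Q2.q (?y (Q2.q y)) = Q2.q y" if "y \<in> N2" for y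
    using someI[of "\<lambda>z. z \<in> N2 \<and> Q2.q z = Q2.q y" y] that by blast
  have g: "?g (Q1.q x) (Q2.q y) = sym_tens x y" if "x \<in> N1" "y \<in> N2" for x y
    using x[OF that(1)] y[OF that(2)] that by (intro sym_tens_cong) auto
  have z1: "\<zero>\<^bsub>A1\<^esub> = Q1.q \<zero>\<^bsub>L1\<^esub>" using Q1.q_zero by (simp add: A1_def)
  have z2: "\<zero>\<^bsub>A2\<^esub> = Q2.q \<zero>\<^bsub>L2\<^esub>" using Q2.q_zero by (simp add: A2_def)
  have z1': "sym_tens \<zero>\<^bsub>L1\<^esub> y = \<zero>\<^bsub>T\<^esub>" if "y \<in> N2" for y
    using sym_tens_smult_left[of "\<zero>\<^bsub>F\<^esub>" "\<zero>\<^bsub>L1\<^esub>" y] that zero_N by simp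
  have z2': "sym_tens x \<zero>\<^bsub>L2\<^esub> = \<zero>\<^bsub>T\<^esub>" if "x \<in> N1" for x
    using sym_tens_smult_right[of "\<zero>\<^bsub>F\<^esub>" x "\<zero>\<^bsub>L2\<^esub>"] that zero_N by simp
  have comm: "x \<otimes>\<^bsub>L1\<^esub> x' \<in> C1" if "x \<in> N1" "x' \<in> N1" for x x'
    using lie_commutator_ideal(3)[OF pair1] that P1.N_sub by blast
  have comm2: "x \<otimes>\<^bsub>L2\<^esub> x' \<in> C2" if "x \<in> N2" "x' \<in> N2" for x x'
    using lie_commutator_ideal(3)[OF pair2] that P2.N_sub by blast
  have mz: "\<ominus>\<^bsub>T\<^esub> \<zero>\<^bsub>T\<^esub> = \<zero>\<^bsub>T\<^esub>" by (rule P.TT.M.minus_equality) simp_all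
  note simps = mz g z1 z2 z1' z2' q1_ops q2_ops comm comm2 P1.N_closed P2.N_closed P1.N_sub
    P2.N_sub sym_tens_add_left sym_tens_add_right sym_tens_smult_left sym_tens_smult_right sym_tens_C1 sym_tens_C2 C_sub
  have br: "sym_tens x y \<otimes>\<^bsub>T\<^esub> sym_tens x' y' = \<zero>\<^bsub>T\<^esub>" if "x \<in> N1" "y \<in> N2" "x' \<in> N1" "y' \<in> N2" for x y x' y'
    using that by (intro P.bracket_TT_zero) (simp_all add: sym_tens_kappa)
  note lift = W.T_lift[of T ?g]
  show "sym_map \<in> lie_hom F WT T"
    unfolding sym_map_def WT_def
    by (rule lift(1)) (auto elim!: A1_cases A2_cases simp: simps br P.TT.lie_algebra_axioms)
  show "sym_map (ab_tens x y) = sym_tens x y" if xy: "x \<in> N1" "y \<in> N2"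
  proof -
    have "Q1.q x \<in> carrier A1" "Q2.q y \<in> carrier A2"
      using Q1.q_closed[of x] Q2.q_closed[of y] xy by (simp_all add: A1_def A2_def)
    then have "sym_map (ab_tens x y) = ?g (Q1.q x) (Q2.q y)"
      unfolding sym_map_def ab_tens_def
      by (intro lift(2)) (auto elim!: A1_cases A2_cases simp: simps br P.TT.lie_algebra_axioms)
    then show ?thesis using g xy by simp
  qed
qed

lemmas sym_map = lie_homD[OF sym_map_hom] lie_hom_zero[OF sym_map_hom WT.lie_algebra_axioms P.TT.lie_algebra_axioms]

lemma sym_map_kappa: "w \<in> carrier WT \<Longrightarrow> pair_kappa FP (sym_map w) = \<zero>\<^bsub>FP\<^esub>"
  by (rule WT_hom_ext[OF lie_hom_comp[OF sym_map_hom P.kappa_hom]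
        lie_hom_zero_map[OF WT.lie_algebra_axioms FP.lie_algebra_axioms] FP.lie_algebra_axioms])
    (auto simp: sym_map_ab_tens sym_tens_kappa)

lemma WT_induct [consumes 1, case_names ab_tens zero add smult]:
  assumes "w \<in> carrier WT"
    and "\<And>x y. \<lbrakk>x \<in> N1; y \<in> N2\<rbrakk> \<Longrightarrow> Q (ab_tens x y)" "Q \<zero>\<^bsub>WT\<^esub>"
    and "\<And>x y. \<lbrakk>x \<in> carrier WT; y \<in> carrier WT; Q x; Q y\<rbrakk> \<Longrightarrow> Q (x \<oplus>\<^bsub>WT\<^esub> y)"
    and "\<And>c x. \<lbrakk>c \<in> carrier F; x \<in> carrier WT; Q x\<rbrakk> \<Longrightarrow> Q (c \<odot>\<^bsub>WT\<^esub> x)"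
  shows "Q w"
  using assms(1)[unfolded WT_def]
  by (induction rule: W.T_induct) (use assms(2-) in \<open>auto elim!: A1_cases A2_cases simp: WT_def ab_tens_def\<close>)

lemma sym_map_diagonal: "w \<in> carrier WT \<Longrightarrow> sym_map w \<in> diagonal_ideal F FP N"
  by (induction rule: WT_induct)
    (auto simp: sym_map sym_map_ab_tens sym_tens_diagonal lie_idealD[OF P.diagonal_ideal_lie_ideal])

lemma pD_sym_map_ab_tens: "\<lbrakk>x \<in> N1; y \<in> N2\<rbrakk> \<Longrightarrow> pD (sym_map (ab_tens x y)) =
   PD.tens (x, \<zero>\<^bsub>L2\<^esub>) (\<zero>\<^bsub>L1\<^esub>, y) \<oplus>\<^bsub>TD\<^esub> PD.tens (\<zero>\<^bsub>L1\<^esub>, y) (x, \<zero>\<^bsub>L2\<^esub>)"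
  by (simp add: sym_map_ab_tens sym_tens_def homs pD N_incl P1.N_sub P2.N_sub inl inr)

lemma r1_sym_map: "w \<in> carrier WT \<Longrightarrow> r1 (pD (sym_map w)) = \<zero>\<^bsub>T1\<^esub>"
  by (rule WT_hom_ext[OF lie_hom_comp[OF sym_map_hom lie_hom_comp[OF pD(1) r1(1)]]
        lie_hom_zero_map[OF WT.lie_algebra_axioms P1.TT.lie_algebra_axioms] P1.TT.lie_algebra_axioms])
    (auto simp: pD_sym_map_ab_tens homs r1 zero_N P1.N_sub P2.N_sub)

lemma r2_sym_map: "w \<in> carrier WT \<Longrightarrow> r2 (pD (sym_map w)) = \<zero>\<^bsub>T2\<^esub>"
  by (rule WT_hom_ext[OF lie_hom_comp[OF sym_map_hom lie_hom_comp[OF pD(1) r2(1)]]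
        lie_hom_zero_map[OF WT.lie_algebra_axioms P2.TT.lie_algebra_axioms] P2.TT.lie_algebra_axioms])
    (auto simp: pD_sym_map_ab_tens homs r2 zero_N P1.N_sub P2.N_sub)

end


lemma (in lie_pair_tensor) exterior_quotient: "lie_quotient_algebra F TT (diagonal_ideal F L N)"
  by (simp add: lie_quotient_algebra_def lie_quotient_algebra_axioms_def TT.lie_algebra_axioms
    diagonal_ideal_lie_ideal)

lemma (in lie_pair_tensor) carrier_schur_multiplier:
  "carrier (schur_multiplier F L N) =
     (\<lambda>t. diagonal_ideal F L N +>\<^bsub>TT\<^esub> t) ` {t \<in> carrier TT. pair_kappa L t = \<zero>\<^bsub>L\<^esub>}"
proof -
  interpret E: lie_quotient_algebra F TT "diagonal_ideal F L N" by (rule exterior_quotient)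
  have "pair_kappa_ext L (E.q t) = pair_kappa L t" if "t \<in> carrier TT" for t
    unfolding pair_kappa_ext_def using diagonal_ideal_kappa that
    by (intro E.the_elem_q[OF kappa_hom lie_algebra_axioms]) auto
  then show ?thesis
    by (auto simp: schur_multiplier_def lie_kernel_def pair_exterior_def E.carrier_Q)
qed

text \<open>
  The hypotheses on \<open>r3\<close> make it a left inverse of \<open>sym_map\<close> on \<open>TD\<close> that annihilates the images of
  \<open>i1\<close> and \<open>i2\<close>. Together with the decomposition of the kernel of \<open>\<kappa>\<close> they imply all three parts of the
  theorem.
\<close>

locale free_pair_split = free_pair_sym +
  fixes r3
  assumes r3_hom: "r3 \<in> lie_hom F TD WT"
    and r3_left: "\<lbrakk>l \<in> carrier L1; x \<in> N1\<rbrakk>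
      \<Longrightarrow> r3 (PD.tens (l, \<zero>\<^bsub>L2\<^esub>) (x, \<zero>\<^bsub>L2\<^esub>)) = \<zero>\<^bsub>WT\<^esub>"
    and r3_right: "\<lbrakk>m \<in> carrier L2; y \<in> N2\<rbrakk>
      \<Longrightarrow> r3 (PD.tens (\<zero>\<^bsub>L1\<^esub>, m) (\<zero>\<^bsub>L1\<^esub>, y)) = \<zero>\<^bsub>WT\<^esub>"
    and r3_mixed: "\<lbrakk>x \<in> N1; y \<in> N2\<rbrakk>
      \<Longrightarrow> r3 (PD.tens (x, \<zero>\<^bsub>L2\<^esub>) (\<zero>\<^bsub>L1\<^esub>, y)) = ab_tens x y"
      "\<lbrakk>x \<in> N1; y \<in> N2\<rbrakk> \<Longrightarrow> r3 (PD.tens (\<zero>\<^bsub>L1\<^esub>, y) (x, \<zero>\<^bsub>L2\<^esub>)) = \<zero>\<^bsub>WT\<^esub>"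
    and decomposition: "\<lbrakk>t \<in> carrier T; pair_kappa FP t = \<zero>\<^bsub>FP\<^esub>\<rbrakk> \<Longrightarrow>
      \<exists>t1\<in>carrier T1. \<exists>t2\<in>carrier T2. \<exists>w\<in>carrier WT. t = i1 t1 \<oplus>\<^bsub>T\<^esub> i2 t2 \<oplus>\<^bsub>T\<^esub> sym_map w"
begin

lemmas r3 = lie_homD[OF r3_hom] lie_hom_zero[OF r3_hom PD.TT.lie_algebra_axioms WT.lie_algebra_axioms]

lemma r3_i1: "t \<in> carrier T1 \<Longrightarrow> r3 (pD (i1 t)) = \<zero>\<^bsub>WT\<^esub>"
  by (rule P1.TT_hom_ext[OF lie_hom_comp[OF i1(1) lie_hom_comp[OF pD(1) r3_hom]]
        lie_hom_zero_map[OF P1.TT.lie_algebra_axioms WT.lie_algebra_axioms] WT.lie_algebra_axioms])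
    (simp_all add: pD_i1 r3_left)

lemma r3_i2: "t \<in> carrier T2 \<Longrightarrow> r3 (pD (i2 t)) = \<zero>\<^bsub>WT\<^esub>"
  by (rule P2.TT_hom_ext[OF lie_hom_comp[OF i2(1) lie_hom_comp[OF pD(1) r3_hom]]
        lie_hom_zero_map[OF P2.TT.lie_algebra_axioms WT.lie_algebra_axioms] WT.lie_algebra_axioms])
    (simp_all add: pD_i2 r3_right)

lemma r3_sym_map: "w \<in> carrier WT \<Longrightarrow> r3 (pD (sym_map w)) = w"
  by (rule WT_hom_ext[OF lie_hom_comp[OF sym_map_hom lie_hom_comp[OF pD(1) r3_hom]]
        lie_hom_ident WT.lie_algebra_axioms])
    (simp_all add: pD_sym_map_ab_tens r3 r3_mixed zero_N P1.N_sub P2.N_sub)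

lemma components:
  assumes "t1 \<in> carrier T1" "t2 \<in> carrier T2" "w \<in> carrier WT"
  shows "r1 (pD (i1 t1 \<oplus>\<^bsub>T\<^esub> i2 t2 \<oplus>\<^bsub>T\<^esub> sym_map w)) = t1"
    and "r2 (pD (i1 t1 \<oplus>\<^bsub>T\<^esub> i2 t2 \<oplus>\<^bsub>T\<^esub> sym_map w)) = t2"
    and "r3 (pD (i1 t1 \<oplus>\<^bsub>T\<^esub> i2 t2 \<oplus>\<^bsub>T\<^esub> sym_map w)) = w"
  using assms by (simp_all add: homs sym_map r3 r1_i1 r1_i2 r1_sym_map r2_i1 r2_i2 r2_sym_map r3_i1 r3_i2 r3_sym_map)

lemma reconstruct:
  assumes "t \<in> carrier T" "pair_kappa FP t = \<zero>\<^bsub>FP\<^esub>"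
  shows "t = i1 (r1 (pD t)) \<oplus>\<^bsub>T\<^esub> i2 (r2 (pD t)) \<oplus>\<^bsub>T\<^esub> sym_map (r3 (pD t))"
proof -
  obtain t1 t2 w where "t1 \<in> carrier T1" "t2 \<in> carrier T2" "w \<in> carrier WT"
    "t = i1 t1 \<oplus>\<^bsub>T\<^esub> i2 t2 \<oplus>\<^bsub>T\<^esub> sym_map w"
    using decomposition[OF assms] by blast
  then show ?thesis using components by simp
qed

lemma J2_ops [simp]:
  "carrier (J2 F L1 N1) = {t \<in> carrier T1. pair_kappa L1 t = \<zero>\<^bsub>L1\<^esub>}"
  "carrier (J2 F L2 N2) = {t \<in> carrier T2. pair_kappa L2 t = \<zero>\<^bsub>L2\<^esub>}"
  "carrier (J2 F FP N) = {t \<in> carrier T. pair_kappa FP t = \<zero>\<^bsub>FP\<^esub>}"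
  "add (J2 F L1 N1) = add T1" "add (J2 F L2 N2) = add T2" "add (J2 F FP N) = add T"
  "mult (J2 F L1 N1) = mult T1" "mult (J2 F L2 N2) = mult T2" "mult (J2 F FP N) = mult T"
  "smult (J2 F L1 N1) = smult T1" "smult (J2 F L2 N2) = smult T2" "smult (J2 F FP N) = smult T"
  by (simp_all add: J2_def lie_kernel_def)

lemma kappa_components:
  assumes "t \<in> carrier T" "pair_kappa FP t = \<zero>\<^bsub>FP\<^esub>"
  shows "pair_kappa L1 (r1 (pD t)) = \<zero>\<^bsub>L1\<^esub>" "pair_kappa L2 (r2 (pD t)) = \<zero>\<^bsub>L2\<^esub>"
  using assms by (simp_all add: r1 r2 homs pD prl prr)

theorem J2_isomorphic:
  "lie_isomorphic F (J2 F FP N) (lie_direct_sum (lie_direct_sum (J2 F L1 N1) (J2 F L2 N2)) WT)"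
proof -
  let ?h = "\<lambda>t. ((r1 (pD t), r2 (pD t)), r3 (pD t))"
  let ?S = "lie_direct_sum (lie_direct_sum (J2 F L1 N1) (J2 F L2 N2)) WT"
  have hom: "?h \<in> lie_hom F (J2 F FP N) ?S"
    by (rule lie_homI) (auto simp: homs r3 kappa_components)
  have "bij_betw ?h (carrier (J2 F FP N)) (carrier ?S)"
  proof (rule bij_betw_byWitness[where f' = "\<lambda>u. i1 (fst (fst u)) \<oplus>\<^bsub>T\<^esub> i2 (snd (fst u)) \<oplus>\<^bsub>T\<^esub> sym_map (snd u)"])
    show "\<forall>t\<in>carrier (J2 F FP N). i1 (fst (fst (?h t))) \<oplus>\<^bsub>T\<^esub> i2 (snd (fst (?h t))) \<oplus>\<^bsub>T\<^esub>
        sym_map (snd (?h t)) = t"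
      using reconstruct by auto
    show "\<forall>u\<in>carrier ?S. ?h (i1 (fst (fst u)) \<oplus>\<^bsub>T\<^esub> i2 (snd (fst u)) \<oplus>\<^bsub>T\<^esub> sym_map (snd u)) = u"
      using components by auto
    show "?h ` carrier (J2 F FP N) \<subseteq> carrier ?S"
      using lie_homD(1)[OF hom] by blast
    show "(\<lambda>u. i1 (fst (fst u)) \<oplus>\<^bsub>T\<^esub> i2 (snd (fst u)) \<oplus>\<^bsub>T\<^esub> sym_map (snd u)) ` carrier ?S
        \<subseteq> carrier (J2 F FP N)"
      by (auto simp: homs sym_map P.kappa i1(3) i2(3) sym_map_kappa inl inr)
  qed
  then show ?thesis unfolding lie_isomorphic_def using hom by blast
qed

text \<open>
  The diagonal ideal lies in the kernel of \<open>\<kappa>\<close>, and an element of this kernel is determined by its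
  image under \<open>pD\<close>, because the three left inverses factor through \<open>pD\<close>. Surjectivity is clear on the
  generators, and the image of an ideal in the kernel of \<open>\<kappa>\<close> is an ideal since the kernel is central.
\<close>

theorem square_isomorphic:
  "lie_isomorphic F (pair_square F FP N) (pair_square F D (N1 \<times> N2))"
proof -
  let ?d = "diagonal_ideal F FP N" and ?dD = "diagonal_ideal F D (N1 \<times> N2)"
  have d: "t \<in> carrier T" "pair_kappa FP t = \<zero>\<^bsub>FP\<^esub>" if "t \<in> ?d" for t
    using P.diagonal_ideal_kappa[OF that] by auto
  have hom: "pD \<in> lie_hom F (pair_square F FP N) (pair_square F D (N1 \<times> N2))"
    by (rule lie_homI) (auto simp: pair_square_def homs pD d)
  have "inj_on pD ?d"
    by (rule inj_onI) (metis reconstruct d)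
  moreover have "?dD \<subseteq> pD ` ?d"
  proof (rule PD.diagonal_ideal_least)
    note I = lie_idealD[OF P.diagonal_ideal_lie_ideal]
    show "lie_ideal F (pD ` ?d) TD"
    proof (rule lie_idealI[OF PD.TT.lie_algebra_axioms])
      show "pD ` ?d \<subseteq> carrier TD" using d homs by auto
      show "\<zero>\<^bsub>TD\<^esub> \<in> pD ` ?d" using I(2) zeros by (metis imageI)
      show "x \<oplus>\<^bsub>TD\<^esub> y \<in> pD ` ?d" if "x \<in> pD ` ?d" "y \<in> pD ` ?d" for x y
        using that I(3) d by (auto simp: lie_homD(2)[OF pD(1), symmetric])
      show "c \<odot>\<^bsub>TD\<^esub> x \<in> pD ` ?d" if "c \<in> carrier F" "x \<in> pD ` ?d" for c x
        using that I(4) d by (auto simp: lie_homD(3)[OF pD(1), symmetric])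
      show "x \<otimes>\<^bsub>TD\<^esub> y \<in> pD ` ?d" if xy: "x \<in> carrier TD" "y \<in> pD ` ?d" for x y
      proof -
        obtain t where t: "t \<in> ?d" "y = pD t" using xy(2) by blast
        then have "y \<in> ?dD" using pD(4) by simp
        then have "x \<otimes>\<^bsub>TD\<^esub> y = \<zero>\<^bsub>TD\<^esub>"
          using PD.diagonal_ideal_kappa xy(1) by (intro PD.bracket_TT_zero) auto
        then show ?thesis using I(2) zeros by (metis imageI)
      qed
    qed
    show "PD.tens n n \<in> pD ` ?d" if "n \<in> N1 \<times> N2" for n
    proof -
      let ?m = "inl (fst n) \<oplus>\<^bsub>FP\<^esub> inr (snd n)"
      have m: "?m \<in> N" "prl ?m = fst n" "prr ?m = snd n"
        using that by (auto simp: N_incl P.N_closed prl prr P1.N_sub P2.N_sub inl inr)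
      then have "pD (P.tens ?m ?m) = PD.tens n n" using P.N_sub by (simp add: pD)
      then show ?thesis using P.tens_diagonal[OF m(1)] by (metis imageI)
    qed
  qed
  moreover have "pD ` ?d \<subseteq> ?dD" using pD(4) by auto
  ultimately have "bij_betw pD (carrier (pair_square F FP N)) (carrier (pair_square F D (N1 \<times> N2)))"
    by (auto simp: bij_betw_def pair_square_def)
  then show ?thesis unfolding lie_isomorphic_def using hom by blast
qed

text \<open>
  The isomorphism of part (i) maps the diagonal ideal onto the sum of the diagonal ideals of the two
  factors and \<open>W\<close>.
\<close>

theorem multiplier_isomorphic:
  "lie_isomorphic F (schur_multiplier F FP N)
     (lie_direct_sum (schur_multiplier F L1 N1) (schur_multiplier F L2 N2))"
proof -
  interpret E: lie_quotient_algebra F T "diagonal_ideal F FP N" by (rule P.exterior_quotient)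
  interpret E1: lie_quotient_algebra F T1 "diagonal_ideal F L1 N1" by (rule P1.exterior_quotient)
  interpret E2: lie_quotient_algebra F T2 "diagonal_ideal F L2 N2" by (rule P2.exterior_quotient)
  let ?M = "schur_multiplier F FP N" and ?M1 = "schur_multiplier F L1 N1"
    and ?M2 = "schur_multiplier F L2 N2"
  let ?S = "lie_direct_sum ?M1 ?M2"
  let ?k1 = "\<lambda>t. E1.q (r1 (pD t))" and ?k2 = "\<lambda>t. E2.q (r2 (pD t))"
  have k1: "?k1 \<in> lie_hom F T E1.Q"
    by (rule lie_hom_comp[OF lie_hom_comp[OF pD(1) r1(1)] E1.q_hom])
  have k2: "?k2 \<in> lie_hom F T E2.Q"
    by (rule lie_hom_comp[OF lie_hom_comp[OF pD(1) r2(1)] E2.q_hom])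
  let ?J = "{t \<in> carrier T. pair_kappa FP t = \<zero>\<^bsub>FP\<^esub>}"
  let ?J1 = "{t \<in> carrier T1. pair_kappa L1 t = \<zero>\<^bsub>L1\<^esub>}"
  let ?J2 = "{t \<in> carrier T2. pair_kappa L2 t = \<zero>\<^bsub>L2\<^esub>}"
  have M: "carrier ?M = E.q ` ?J" "carrier ?M1 = E1.q ` ?J1" "carrier ?M2 = E2.q ` ?J2"
    by (rule P.carrier_schur_multiplier P1.carrier_schur_multiplier P2.carrier_schur_multiplier)+
  have Mc: "\<exists>t. t \<in> ?J \<and> W = E.q t" if "W \<in> carrier ?M" for W
    using that unfolding M image_iff Bex_def .
  have M1c: "\<exists>t. t \<in> ?J1 \<and> W = E1.q t" if "W \<in> carrier ?M1" for W
    using that unfolding M image_iff Bex_def .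
  have M2c: "\<exists>t. t \<in> ?J2 \<and> W = E2.q t" if "W \<in> carrier ?M2" for W
    using that unfolding M image_iff Bex_def .
  have ops: "add ?M = add E.Q" "add ?M1 = add E1.Q" "add ?M2 = add E2.Q"
    "mult ?M = mult E.Q" "mult ?M1 = mult E1.Q" "mult ?M2 = mult E2.Q"
    "smult ?M = smult E.Q" "smult ?M1 = smult E1.Q" "smult ?M2 = smult E2.Q"
    by (simp_all add: schur_multiplier_def lie_kernel_def pair_exterior_def)
  define h where "h W = (the_elem (?k1 ` W), the_elem (?k2 ` W))" for W
  have h: "h (E.q t) = (?k1 t, ?k2 t)" if t: "t \<in> carrier T" for t
  proof -
    have "the_elem (?k1 ` E.q t) = ?k1 t"
      using pD(4) r1(4) E1.q_zero_iff homs P.diagonal_ideal_kappa t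
      by (intro E.the_elem_q[OF k1 E1.lie_algebra_Q]) (auto simp: E1.zero_Q)
    moreover have "the_elem (?k2 ` E.q t) = ?k2 t"
      using pD(4) r2(4) E2.q_zero_iff homs P.diagonal_ideal_kappa t
      by (intro E.the_elem_q[OF k2 E2.lie_algebra_Q]) (auto simp: E2.zero_Q)
    ultimately show ?thesis by (simp add: h_def)
  qed
  have hom: "h \<in> lie_hom F ?M ?S"
  proof (rule lie_homI)
    show "h W \<in> carrier ?S" if W: "W \<in> carrier ?M" for W
    proof -
      obtain t where t: "t \<in> ?J" "W = E.q t" using Mc[OF W] by (elim exE conjE)
      then have "r1 (pD t) \<in> ?J1" "r2 (pD t) \<in> ?J2" using kappa_components homs by auto
      then show ?thesis using h t by (simp add: M)
    qed
    fix W V assume WV: "W \<in> carrier ?M" "V \<in> carrier ?M"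
    obtain t where t: "t \<in> ?J" "W = E.q t" using Mc[OF WV(1)] by (elim exE conjE)
    obtain s where s: "s \<in> ?J" "V = E.q s" using Mc[OF WV(2)] by (elim exE conjE)
    show "h (W \<oplus>\<^bsub>?M\<^esub> V) = h W \<oplus>\<^bsub>?S\<^esub> h V"
      using t s by (simp add: ops E.q_add h lie_homD[OF k1] lie_homD[OF k2])
    show "h (W \<otimes>\<^bsub>?M\<^esub> V) = h W \<otimes>\<^bsub>?S\<^esub> h V"
      using t s by (simp add: ops E.q_bracket P.TT.bracket_closed h lie_homD[OF k1] lie_homD[OF k2])
    show "h (c \<odot>\<^bsub>?M\<^esub> W) = c \<odot>\<^bsub>?S\<^esub> h W" if "c \<in> carrier F" for c
      using t that by (simp add: ops E.q_smult h lie_homD[OF k1] lie_homD[OF k2])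
  qed
  have "bij_betw h (carrier ?M) (carrier ?S)"
  proof (rule bij_betw_imageI)
    show "inj_on h (carrier ?M)"
    proof (rule inj_onI)
      fix W V assume WV: "W \<in> carrier ?M" "V \<in> carrier ?M" and eq: "h W = h V"
      obtain t where t: "t \<in> ?J" "W = E.q t" using Mc[OF WV(1)] by (elim exE conjE)
      obtain s where s: "s \<in> ?J" "V = E.q s" using Mc[OF WV(2)] by (elim exE conjE)
      let ?u = "t \<oplus>\<^bsub>T\<^esub> \<ominus>\<^bsub>T\<^esub> s"
      have u: "?u \<in> carrier T" "pair_kappa FP ?u = \<zero>\<^bsub>FP\<^esub>"
        using t s lie_hom_neg[OF P.kappa_hom P.TT.lie_algebra_axioms FP.lie_algebra_axioms, of s]
        by (auto simp: P.kappa FP.M.r_neg)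
      have hom_u: "r1 (pD ?u) = r1 (pD t) \<oplus>\<^bsub>T1\<^esub> \<ominus>\<^bsub>T1\<^esub> r1 (pD s)"
          "r2 (pD ?u) = r2 (pD t) \<oplus>\<^bsub>T2\<^esub> \<ominus>\<^bsub>T2\<^esub> r2 (pD s)"
        using t s lie_hom_neg[OF lie_hom_comp[OF pD(1) r1(1)] P.TT.lie_algebra_axioms
            P1.TT.lie_algebra_axioms, of s]
          lie_hom_neg[OF lie_hom_comp[OF pD(1) r2(1)] P.TT.lie_algebra_axioms
            P2.TT.lie_algebra_axioms, of s]
        by (auto simp: lie_homD[OF lie_hom_comp[OF pD(1) r1(1)]]
            lie_homD[OF lie_hom_comp[OF pD(1) r2(1)]])
      have "?k1 t = ?k1 s" "?k2 t = ?k2 s" using eq t s h by auto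
      then have "r1 (pD ?u) \<in> diagonal_ideal F L1 N1" "r2 (pD ?u) \<in> diagonal_ideal F L2 N2"
        using E1.q_eq_iff E2.q_eq_iff t s homs hom_u by auto
      then have "i1 (r1 (pD ?u)) \<in> diagonal_ideal F FP N" "i2 (r2 (pD ?u)) \<in> diagonal_ideal F FP N"
        using i1(4) i2(4) by auto
      moreover have "sym_map (r3 (pD ?u)) \<in> diagonal_ideal F FP N"
        using u homs r3 by (intro sym_map_diagonal) auto
      ultimately have "i1 (r1 (pD ?u)) \<oplus>\<^bsub>T\<^esub> i2 (r2 (pD ?u)) \<oplus>\<^bsub>T\<^esub> sym_map (r3 (pD ?u))
          \<in> diagonal_ideal F FP N"
        by (intro lie_idealD(3)[OF P.diagonal_ideal_lie_ideal])
      then have "?u \<in> diagonal_ideal F FP N" using reconstruct[OF u] by simp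
      then show "W = V" using E.q_eq_iff t s by auto
    qed
    show "h ` carrier ?M = carrier ?S"
    proof
      show "h ` carrier ?M \<subseteq> carrier ?S" using lie_homD(1)[OF hom] by blast
      show "carrier ?S \<subseteq> h ` carrier ?M"
      proof
        fix Z assume "Z \<in> carrier ?S"
        then have Z: "fst Z \<in> carrier ?M1" "snd Z \<in> carrier ?M2" by auto
        obtain t1 where t1: "t1 \<in> ?J1" "fst Z = E1.q t1" using M1c[OF Z(1)] by (elim exE conjE)
        obtain t2 where t2: "t2 \<in> ?J2" "snd Z = E2.q t2" using M2c[OF Z(2)] by (elim exE conjE)
        have t: "t1 \<in> ?J1" "t2 \<in> ?J2" "Z = (E1.q t1, E2.q t2)"
          using t1 t2 by (simp_all add: prod_eq_iff)
        let ?t = "i1 t1 \<oplus>\<^bsub>T\<^esub> i2 t2 \<oplus>\<^bsub>T\<^esub> sym_map \<zero>\<^bsub>WT\<^esub>"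
        have tJ: "?t \<in> ?J"
          using t by (auto simp: homs sym_map P.kappa i1(3) i2(3) sym_map_kappa inl inr)
        have tk: "t1 \<in> carrier T1" "t2 \<in> carrier T2" "?t \<in> carrier T" using t tJ by simp_all
        have "h (E.q ?t) = Z"
          unfolding h[OF tk(3)] components(1,2)[OF tk(1,2) WT.M.zero_closed] t(3) ..
        moreover have "E.q ?t \<in> carrier ?M" unfolding M by (rule imageI[OF tJ])
        ultimately show "Z \<in> h ` carrier ?M" by (metis imageI)
      qed
    qed
  qed
  then show ?thesis unfolding lie_isomorphic_def using hom by blast
qed

end


section \<open>Symmetrized tensors of commutators vanish\<close>

text \<open>
  Let \<open>s u v = u \<otimes> v + v \<otimes> u\<close> and \<open>g(x, y, z) = s [x, y] z\<close>. The two defining relations for brackets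
  on either side give \<open>g(x, y, z) = g(y, z, x) - g(x, z, y)\<close>. Moreover \<open>g\<close> is alternating, since
  \<open>[x, y] \<otimes> y = - y \<otimes> [x, y]\<close>. So both terms on the right are \<open>g(x, y, z)\<close> up to sign, and \<open>g = g + g\<close>.
  The argument does not divide by 2 and so holds in every characteristic.
\<close>

lemma (in lie_pair_tensor) symmetrized_bracket:
  assumes N: "N = carrier L" and xyz: "x \<in> carrier L" "y \<in> carrier L" "z \<in> carrier L"
  shows "tens (x \<otimes>\<^bsub>L\<^esub> y) z \<oplus>\<^bsub>TT\<^esub> tens z (x \<otimes>\<^bsub>L\<^esub> y) = \<zero>\<^bsub>TT\<^esub>"
proof -
  define s where "s u v = tens u v \<oplus>\<^bsub>TT\<^esub> tens v u" for u v
  note bc = bracket_closed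
  have NL: "u \<in> N" if "u \<in> carrier L" for u using that N by simp
  have tc: "tens u v \<in> carrier TT" if "u \<in> carrier L" "v \<in> carrier L" for u v
    using that NL by simp
  have sc: "s u v \<in> carrier TT" if "u \<in> carrier L" "v \<in> carrier L" for u v
    using that tc by (simp add: s_def)
  have s_add: "s (u \<oplus>\<^bsub>L\<^esub> u') v = s u v \<oplus>\<^bsub>TT\<^esub> s u' v" "s v (u \<oplus>\<^bsub>L\<^esub> u') = s v u \<oplus>\<^bsub>TT\<^esub> s v u'"
    if "u \<in> carrier L" "u' \<in> carrier L" "v \<in> carrier L" for u u' v
    using that tc NL by (simp_all add: s_def tens_add_left tens_add_right TT.M.a_ac)
  have s_neg: "s (\<ominus>\<^bsub>L\<^esub> u) v = \<ominus>\<^bsub>TT\<^esub> s u v" if "u \<in> carrier L" "v \<in> carrier L" for u v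
    using that tc NL by (simp add: s_def tens_neg_left tens_neg_right TT.M.minus_add)
  have A: "s (u \<otimes>\<^bsub>L\<^esub> v) w = s (v \<otimes>\<^bsub>L\<^esub> w) u \<oplus>\<^bsub>TT\<^esub> \<ominus>\<^bsub>TT\<^esub> s (u \<otimes>\<^bsub>L\<^esub> w) v"
    if "u \<in> carrier L" "v \<in> carrier L" "w \<in> carrier L" for u v w
  proof -
    have "s (u \<otimes>\<^bsub>L\<^esub> v) w = (tens u (v \<otimes>\<^bsub>L\<^esub> w) \<oplus>\<^bsub>TT\<^esub> \<ominus>\<^bsub>TT\<^esub> tens v (u \<otimes>\<^bsub>L\<^esub> w)) \<oplus>\<^bsub>TT\<^esub>
        (tens (v \<otimes>\<^bsub>L\<^esub> w) u \<oplus>\<^bsub>TT\<^esub> \<ominus>\<^bsub>TT\<^esub> tens (u \<otimes>\<^bsub>L\<^esub> w) v)"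
      unfolding s_def using that NL tens_bracket_left[of u v w] tens_bracket_right[of w u v] by simp
    then show ?thesis
      using that tc bc by (simp add: s_def TT.M.minus_add TT.M.a_ac)
  qed
  have B: "s (u \<otimes>\<^bsub>L\<^esub> v) v = \<zero>\<^bsub>TT\<^esub>" if "u \<in> carrier L" "v \<in> carrier L" for u v
  proof -
    have "tens (u \<otimes>\<^bsub>L\<^esub> v) v = \<ominus>\<^bsub>TT\<^esub> tens v (u \<otimes>\<^bsub>L\<^esub> v)"
      using that NL tens_bracket_left[of u v v] tc bc by (simp add: bracket_self)
    then show ?thesis using that tc bc by (simp add: s_def TT.M.l_neg)
  qed
  have C: "s (u \<otimes>\<^bsub>L\<^esub> w) v = \<ominus>\<^bsub>TT\<^esub> s (u \<otimes>\<^bsub>L\<^esub> v) w"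
    if "u \<in> carrier L" "v \<in> carrier L" "w \<in> carrier L" for u v w
  proof -
    have "\<zero>\<^bsub>TT\<^esub> = s (u \<otimes>\<^bsub>L\<^esub> (v \<oplus>\<^bsub>L\<^esub> w)) (v \<oplus>\<^bsub>L\<^esub> w)" using B that by simp
    also have "\<dots> = (s (u \<otimes>\<^bsub>L\<^esub> v) v \<oplus>\<^bsub>TT\<^esub> s (u \<otimes>\<^bsub>L\<^esub> v) w) \<oplus>\<^bsub>TT\<^esub>
        (s (u \<otimes>\<^bsub>L\<^esub> w) v \<oplus>\<^bsub>TT\<^esub> s (u \<otimes>\<^bsub>L\<^esub> w) w)"
      using that bc sc by (simp add: bracket_add_right s_add TT.M.a_ac)
    also have "\<dots> = s (u \<otimes>\<^bsub>L\<^esub> w) v \<oplus>\<^bsub>TT\<^esub> s (u \<otimes>\<^bsub>L\<^esub> v) w"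
      using that bc sc B by (simp add: TT.M.a_comm)
    finally have "s (u \<otimes>\<^bsub>L\<^esub> w) v \<oplus>\<^bsub>TT\<^esub> s (u \<otimes>\<^bsub>L\<^esub> v) w = \<zero>\<^bsub>TT\<^esub>" by (rule HOL.sym)
    then show ?thesis
      using that bc sc by (intro TT.M.minus_equality[symmetric]) auto
  qed
  let ?g = "s (x \<otimes>\<^bsub>L\<^esub> y) z"
  have gc: "?g \<in> carrier TT" using xyz bc sc by simp
  have "s (y \<otimes>\<^bsub>L\<^esub> z) x = \<ominus>\<^bsub>TT\<^esub> s (y \<otimes>\<^bsub>L\<^esub> x) z" using C[of y x z] xyz by simp
  also have "\<dots> = ?g"
    using xyz bc sc bracket_swap[of x y] by (simp add: s_neg)
  finally have yz: "s (y \<otimes>\<^bsub>L\<^esub> z) x = ?g" .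
  have "s (y \<otimes>\<^bsub>L\<^esub> z) x \<oplus>\<^bsub>TT\<^esub> \<ominus>\<^bsub>TT\<^esub> s (x \<otimes>\<^bsub>L\<^esub> z) y = ?g \<oplus>\<^bsub>TT\<^esub> ?g"
    unfolding yz C[OF xyz] using gc by simp
  with A[OF xyz] have "?g = ?g \<oplus>\<^bsub>TT\<^esub> ?g" by (rule HOL.trans)
  then have "?g = \<zero>\<^bsub>TT\<^esub>" using gc TT.M.add.r_cancel_one'[of ?g ?g] by blast
  then show ?thesis by (simp add: s_def)
qed

section \<open>The degenerate cases\<close>

context free_pair_sym
begin

definition decomposable where
  "decomposable t \<longleftrightarrow>
     (\<exists>t1\<in>carrier T1. \<exists>t2\<in>carrier T2. \<exists>w\<in>carrier WT. t = i1 t1 \<oplus>\<^bsub>T\<^esub> i2 t2 \<oplus>\<^bsub>T\<^esub> sym_map w)"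

lemma decomposable_i1: "t \<in> carrier T1 \<Longrightarrow> decomposable (i1 t)"
  unfolding decomposable_def
  by (intro bexI[of _ t] bexI[of _ "\<zero>\<^bsub>T2\<^esub>"] bexI[of _ "\<zero>\<^bsub>WT\<^esub>"])
    (auto simp: zeros sym_map homs)

lemma decomposable_i2: "t \<in> carrier T2 \<Longrightarrow> decomposable (i2 t)"
  unfolding decomposable_def
  by (intro bexI[of _ "\<zero>\<^bsub>T1\<^esub>"] bexI[of _ t] bexI[of _ "\<zero>\<^bsub>WT\<^esub>"])
    (auto simp: zeros sym_map homs)

lemma decomposable_zero: "decomposable \<zero>\<^bsub>T\<^esub>"
  using decomposable_i1[of "\<zero>\<^bsub>T1\<^esub>"] by (simp add: zeros)

lemma sum_decompositions:
  assumes "t1 \<in> carrier T1" "t2 \<in> carrier T2" "w \<in> carrier WT"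
    "s1 \<in> carrier T1" "s2 \<in> carrier T2" "v \<in> carrier WT"
  shows "(i1 t1 \<oplus>\<^bsub>T\<^esub> i2 t2 \<oplus>\<^bsub>T\<^esub> sym_map w) \<oplus>\<^bsub>T\<^esub> (i1 s1 \<oplus>\<^bsub>T\<^esub> i2 s2 \<oplus>\<^bsub>T\<^esub> sym_map v) =
    i1 (t1 \<oplus>\<^bsub>T1\<^esub> s1) \<oplus>\<^bsub>T\<^esub> i2 (t2 \<oplus>\<^bsub>T2\<^esub> s2) \<oplus>\<^bsub>T\<^esub> sym_map (w \<oplus>\<^bsub>WT\<^esub> v)"
  using assms by (simp add: homs sym_map P.TT.M.a_ac)

lemma smult_decomposition:
  assumes "t1 \<in> carrier T1" "t2 \<in> carrier T2" "w \<in> carrier WT" "c \<in> carrier F"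
  shows "c \<odot>\<^bsub>T\<^esub> (i1 t1 \<oplus>\<^bsub>T\<^esub> i2 t2 \<oplus>\<^bsub>T\<^esub> sym_map w) =
    i1 (c \<odot>\<^bsub>T1\<^esub> t1) \<oplus>\<^bsub>T\<^esub> i2 (c \<odot>\<^bsub>T2\<^esub> t2) \<oplus>\<^bsub>T\<^esub> sym_map (c \<odot>\<^bsub>WT\<^esub> w)"
  using assms by (simp add: homs sym_map P.TT.smult_r_distr)

lemma decomposable_all:
  assumes gen: "\<And>l n. \<lbrakk>l \<in> carrier FP; n \<in> N\<rbrakk> \<Longrightarrow> decomposable (P.tens l n)"
  shows "t \<in> carrier T \<Longrightarrow> decomposable t"
proof (induction rule: P.TT_induct)
  case (add x y)
  then show ?case unfolding decomposable_def
    using sum_decompositions by (metis P1.TT.M.add.m_closed P2.TT.M.add.m_closed WT.M.add.m_closed)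
next
  case (smult c x)
  then show ?case unfolding decomposable_def
    using smult_decomposition by (metis P1.TT.smult_closed P2.TT.smult_closed WT.smult_closed)
qed (use gen decomposable_zero in auto)

end

context free_pair
begin

lemma sym_tens_zero: "y \<in> N2 \<Longrightarrow> sym_tens \<zero>\<^bsub>L1\<^esub> y = \<zero>\<^bsub>T\<^esub>" "x \<in> N1 \<Longrightarrow> sym_tens x \<zero>\<^bsub>L2\<^esub> = \<zero>\<^bsub>T\<^esub>"
  by (simp_all add: sym_tens_def inl inr N_incl)

lemma ab_tens_C1: "\<lbrakk>c \<in> C1; y \<in> N2\<rbrakk> \<Longrightarrow> ab_tens c y = \<zero>\<^bsub>WT\<^esub>"
  and ab_tens_C2: "\<lbrakk>x \<in> N1; d \<in> C2\<rbrakk> \<Longrightarrow> ab_tens x d = \<zero>\<^bsub>WT\<^esub>"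
proof -
  have z: "W.gen \<zero>\<^bsub>A1\<^esub> v = \<zero>\<^bsub>WT\<^esub>" if "v \<in> carrier A2" for v
    using W.gen_smult_left[of "\<zero>\<^bsub>F\<^esub>" "\<zero>\<^bsub>A1\<^esub>" v] that by (simp add: WT_def)
  have z': "W.gen u \<zero>\<^bsub>A2\<^esub> = \<zero>\<^bsub>WT\<^esub>" if "u \<in> carrier A1" for u
    using W.gen_smult_right[of "\<zero>\<^bsub>F\<^esub>" u "\<zero>\<^bsub>A2\<^esub>"] that by (simp add: WT_def)
  show "ab_tens c y = \<zero>\<^bsub>WT\<^esub>" if "c \<in> C1" "y \<in> N2"
  proof -
    have "Q1.q c = \<zero>\<^bsub>A1\<^esub>" using Q1.sub.a_rcos_const[OF that(1)] Q1.zero_Q by (simp add: A1_def)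
    moreover have "Q2.q y \<in> carrier A2" using Q2.q_closed[of y] that by (simp add: A2_def)
    ultimately show ?thesis using z by (simp add: ab_tens_def)
  qed
  show "ab_tens x d = \<zero>\<^bsub>WT\<^esub>" if "x \<in> N1" "d \<in> C2"
  proof -
    have "Q2.q d = \<zero>\<^bsub>A2\<^esub>" using Q2.sub.a_rcos_const[OF that(2)] Q2.zero_Q by (simp add: A2_def)
    moreover have "Q1.q x \<in> carrier A1" using Q1.q_closed[of x] that by (simp add: A1_def)
    ultimately show ?thesis using z' by (simp add: ab_tens_def)
  qed
qed

lemma zero_C: "\<zero>\<^bsub>L1\<^esub> \<in> C1" "\<zero>\<^bsub>L2\<^esub> \<in> C2"
  using Q1.I_closed(2) Q2.I_closed(2) by simp_all

lemma inl_prl: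
  assumes "carrier L2 = {\<zero>\<^bsub>L2\<^esub>}" "x \<in> carrier FP"
  shows "inl (prl x) = x"
  by (rule FP_hom_ext[OF lie_hom_comp[OF prl_hom inl_hom] lie_hom_ident FP.lie_algebra_axioms])
    (use assms in \<open>auto simp: inl inr prl prr\<close>)

lemma inr_prr:
  assumes "carrier L1 = {\<zero>\<^bsub>L1\<^esub>}" "x \<in> carrier FP"
  shows "inr (prr x) = x"
  by (rule FP_hom_ext[OF lie_hom_comp[OF prr_hom inr_hom] lie_hom_ident FP.lie_algebra_axioms])
    (use assms in \<open>auto simp: inl inr prl prr\<close>)

lemma sub_trivial:
  assumes "N1 = {\<zero>\<^bsub>L1\<^esub>}" "N2 = {\<zero>\<^bsub>L2\<^esub>}" "n \<in> N"
  shows "n = \<zero>\<^bsub>FP\<^esub>"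
proof -
  have "lie_ideal F {\<zero>\<^bsub>FP\<^esub>} FP"
    by (rule lie_idealI) (auto simp: FP.lie_algebra_axioms)
  then have "n \<in> {\<zero>\<^bsub>FP\<^esub>}"
    using sub_image[OF P1.ideal_N P2.ideal_N lie_hom_ident FP.lie_algebra_axioms _ _ _ assms(3)]
    by (auto simp: assms inl inr)
  then show ?thesis by simp
qed

text \<open>
  If one factor is zero, the free product is the other factor, and if \<open>N1 = N2 = 0\<close>, then \<open>T = 0\<close>. In
  each case \<open>T\<close> is spanned by images of \<open>i1\<close> or of \<open>i2\<close>, and \<open>W = 0\<close>.
\<close>

lemma degenerate_split:
  assumes "N1 = {\<zero>\<^bsub>L1\<^esub>} \<and> carrier L1 = {\<zero>\<^bsub>L1\<^esub>} \<or> N2 = {\<zero>\<^bsub>L2\<^esub>} \<and> carrier L2 = {\<zero>\<^bsub>L2\<^esub>} \<or>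
    N1 = {\<zero>\<^bsub>L1\<^esub>} \<and> N2 = {\<zero>\<^bsub>L2\<^esub>}"
  shows "free_pair_split F L1 L2 N1 N2 (\<lambda>_. \<zero>\<^bsub>WT\<^esub>)"
proof -
  have sym_tens: "sym_tens x y = \<zero>\<^bsub>T\<^esub>" "ab_tens x y = \<zero>\<^bsub>WT\<^esub>" if "x \<in> N1" "y \<in> N2" for x y
    using assms that sym_tens_zero ab_tens_C1 ab_tens_C2 zero_C by auto
  interpret S: free_pair_sym F L1 L2 N1 N2
    using lie_commutator_ideal(1)[OF pair1] lie_commutator_ideal(1)[OF pair2]
    by unfold_locales (auto intro!: sym_tens)
  have "S.decomposable (P.tens l n)" if l: "l \<in> carrier FP" and n: "n \<in> N" for l n
  proof -
    consider "carrier L1 = {\<zero>\<^bsub>L1\<^esub>}" | "carrier L2 = {\<zero>\<^bsub>L2\<^esub>}"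
      | "N1 = {\<zero>\<^bsub>L1\<^esub>}" "N2 = {\<zero>\<^bsub>L2\<^esub>}" using assms by blast
    then show ?thesis
    proof cases
      case 1
      have "P.tens l n = i2 (P2.tens (prr l) (prr n))"
        using i2(2)[of "prr l" "prr n"] inr_prr[OF 1] l n N_proj P.N_sub prr by simp
      then show ?thesis using S.decomposable_i2 l n N_proj prr by simp
    next
      case 2
      have "P.tens l n = i1 (P1.tens (prl l) (prl n))"
        using i1(2)[of "prl l" "prl n"] inl_prl[OF 2] l n N_proj P.N_sub prl by simp
      then show ?thesis using S.decomposable_i1 l n N_proj prl by simp
    next
      case 3
      have "P.tens l n = \<zero>\<^bsub>T\<^esub>" using sub_trivial[OF 3 n] l by simp
      then show ?thesis using S.decomposable_zero by simp
    qed
  qed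
  then have dec: "S.decomposable t" if "t \<in> carrier T" for t
    using S.decomposable_all that by blast
  show ?thesis
    by unfold_locales (use dec sym_tens in \<open>auto simp: S.decomposable_def
      lie_hom_zero_map[OF PD.TT.lie_algebra_axioms WT.lie_algebra_axioms]\<close>)
qed

end

section \<open>Central extensions and linear sections\<close>

text \<open>
  The central extension of \<open>L\<close> by \<open>P\<close> with cocycle \<open>b\<close>, where \<open>P\<close> is regarded as an abelian Lie algebra.
\<close>

definition cocycle_extension where
  "cocycle_extension L P b =
     (lie_direct_sum L P)\<lparr>mult := \<lambda>u v. (fst u \<otimes>\<^bsub>L\<^esub> fst v, b (fst u) (fst v))\<rparr>"

lemma cocycle_extension_simps [simp]:
  "carrier (cocycle_extension L P b) = carrier L \<times> carrier P"
  "\<zero>\<^bsub>cocycle_extension L P b\<^esub> = (\<zero>\<^bsub>L\<^esub>, \<zero>\<^bsub>P\<^esub>)"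
  "x \<oplus>\<^bsub>cocycle_extension L P b\<^esub> y = (fst x \<oplus>\<^bsub>L\<^esub> fst y, snd x \<oplus>\<^bsub>P\<^esub> snd y)"
  "c \<odot>\<^bsub>cocycle_extension L P b\<^esub> x = (c \<odot>\<^bsub>L\<^esub> fst x, c \<odot>\<^bsub>P\<^esub> snd x)"
  "x \<otimes>\<^bsub>cocycle_extension L P b\<^esub> y = (fst x \<otimes>\<^bsub>L\<^esub> fst y, b (fst x) (fst y))"
  by (simp_all add: cocycle_extension_def lie_direct_sum_def direct_sum_def case_prod_beta)

lemma lie_algebra_cocycle_extension:
  assumes "lie_algebra F L" "lie_algebra F P"
    and b: "\<And>x y. \<lbrakk>x \<in> carrier L; y \<in> carrier L\<rbrakk> \<Longrightarrow> b x y \<in> carrier P"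
    "\<And>x y z. \<lbrakk>x \<in> carrier L; y \<in> carrier L; z \<in> carrier L\<rbrakk> \<Longrightarrow> b (x \<oplus>\<^bsub>L\<^esub> y) z = b x z \<oplus>\<^bsub>P\<^esub> b y z"
    "\<And>x y z. \<lbrakk>x \<in> carrier L; y \<in> carrier L; z \<in> carrier L\<rbrakk> \<Longrightarrow> b x (y \<oplus>\<^bsub>L\<^esub> z) = b x y \<oplus>\<^bsub>P\<^esub> b x z"
    "\<And>c x y. \<lbrakk>c \<in> carrier F; x \<in> carrier L; y \<in> carrier L\<rbrakk> \<Longrightarrow> b (c \<odot>\<^bsub>L\<^esub> x) y = c \<odot>\<^bsub>P\<^esub> b x y"
    "\<And>c x y. \<lbrakk>c \<in> carrier F; x \<in> carrier L; y \<in> carrier L\<rbrakk> \<Longrightarrow> b x (c \<odot>\<^bsub>L\<^esub> y) = c \<odot>\<^bsub>P\<^esub> b x y"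
    "\<And>x. x \<in> carrier L \<Longrightarrow> b x x = \<zero>\<^bsub>P\<^esub>"
    "\<And>x y z. \<lbrakk>x \<in> carrier L; y \<in> carrier L; z \<in> carrier L\<rbrakk> \<Longrightarrow>
      b x (y \<otimes>\<^bsub>L\<^esub> z) \<oplus>\<^bsub>P\<^esub> b y (z \<otimes>\<^bsub>L\<^esub> x) \<oplus>\<^bsub>P\<^esub> b z (x \<otimes>\<^bsub>L\<^esub> y) = \<zero>\<^bsub>P\<^esub>"
  shows "lie_algebra F (cocycle_extension L P b)"
proof -
  interpret L: lie_algebra F L by fact
  interpret P: lie_algebra F P by fact
  let ?E = "cocycle_extension L P b"
  show ?thesis
  proof (rule lie_algebraI)
    show "field F" by unfold_locales
    show "\<exists>y\<in>carrier ?E. x \<oplus>\<^bsub>?E\<^esub> y = \<zero>\<^bsub>?E\<^esub>" if "x \<in> carrier ?E" for x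
      using that by (intro bexI[of _ "(\<ominus>\<^bsub>L\<^esub> fst x, \<ominus>\<^bsub>P\<^esub> snd x)"]) (auto simp: L.M.r_neg P.M.r_neg)
    show "x \<oplus>\<^bsub>?E\<^esub> y = y \<oplus>\<^bsub>?E\<^esub> x" if "x \<in> carrier ?E" "y \<in> carrier ?E" for x y
      using that by (auto simp: L.M.a_comm P.M.a_comm)
    show "(x \<oplus>\<^bsub>?E\<^esub> y) \<oplus>\<^bsub>?E\<^esub> z = x \<oplus>\<^bsub>?E\<^esub> (y \<oplus>\<^bsub>?E\<^esub> z)"
      if "x \<in> carrier ?E" "y \<in> carrier ?E" "z \<in> carrier ?E" for x y z
      using that by (auto simp: L.M.a_assoc P.M.a_assoc)
  qed (auto simp: b L.bracket_closed
      L.smult_assoc1 L.smult_l_distr L.smult_r_distr P.smult_assoc1 P.smult_l_distr P.smult_r_distr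
      L.bracket_add_left L.bracket_add_right L.bracket_smult_left L.bracket_smult_right
      L.bracket_self L.jacobi)
qed

lemma (in vectorspace) linear_projection:
  assumes "fin_dim" "subspace K W V"
  obtains p where "\<And>x. x \<in> carrier V \<Longrightarrow> p x \<in> W" "\<And>x. x \<in> W \<Longrightarrow> p x = x"
    "\<And>x y. \<lbrakk>x \<in> carrier V; y \<in> carrier V\<rbrakk> \<Longrightarrow> p (x \<oplus>\<^bsub>V\<^esub> y) = p x \<oplus>\<^bsub>V\<^esub> p y"
    "\<And>c x. \<lbrakk>c \<in> carrier K; x \<in> carrier V\<rbrakk> \<Longrightarrow> p (c \<odot>\<^bsub>V\<^esub> x) = c \<odot>\<^bsub>V\<^esub> p x"
proof (rule adapted_coordinates[OF assms])
  fix B C coord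
  assume B: "finite B" "C \<subseteq> B" "B \<subseteq> carrier V" "C \<subseteq> W"
    and coord: "\<And>b x. coord b x \<in> carrier K" "\<And>b. lin_functional K V (coord b)"
      "\<And>x. x \<in> carrier V \<Longrightarrow> x \<in> W \<longleftrightarrow> (\<forall>b\<in>B - C. coord b x = \<zero>\<^bsub>K\<^esub>)"
      "\<And>x. x \<in> carrier V \<Longrightarrow> x = lincomb (\<lambda>b. coord b x) B"
  have fC: "finite C" and CV: "C \<subseteq> carrier V" using B finite_subset by auto
  have sm: "submodule K W V" using assms(2) by simp
  then have WV: "W \<subseteq> carrier V" by (rule submodule.subset)
  let ?p = "\<lambda>x. lincomb (\<lambda>b. coord b x) C"
  have "?p x \<in> span C" for x
    unfolding span_def mem_Collect_eq
    by (intro exI conjI) (rule HOL.refl, use fC coord in auto)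
  then have 1: "?p x \<in> W" for x using span_is_subset[OF B(4) sm] by blast
  have 2: "?p x = x" if "x \<in> W" for x
  proof -
    have x: "x \<in> carrier V" using that WV by blast
    have "x = lincomb (\<lambda>b. coord b x) (C \<union> (B - C))"
      using coord(4)[OF x] B(2) by (simp add: Un_absorb1)
    also have "\<dots> = ?p x \<oplus>\<^bsub>V\<^esub> lincomb (\<lambda>b. coord b x) (B - C)"
      using B fC CV coord by (intro lincomb_union) auto
    also have "lincomb (\<lambda>b. coord b x) (B - C) = \<zero>\<^bsub>V\<^esub>"
      using B coord(3)[OF x] that by (intro lincomb_zero) auto
    finally show ?thesis using CV coord by (simp add: lincomb_closed)
  qed
  have lin: "coord b (x \<oplus>\<^bsub>V\<^esub> y) = coord b x \<oplus>\<^bsub>K\<^esub> coord b y" "coord b (c \<odot>\<^bsub>V\<^esub> x) = c \<otimes>\<^bsub>K\<^esub> coord b x"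
    if "x \<in> carrier V" "y \<in> carrier V" "c \<in> carrier K" for b x y c
    using coord(2)[of b] that unfolding lin_functional_def by blast+
  show thesis
  proof (rule that[of ?p])
    show "?p (x \<oplus>\<^bsub>V\<^esub> y) = ?p x \<oplus>\<^bsub>V\<^esub> ?p y" if "x \<in> carrier V" "y \<in> carrier V" for x y
      using that lincomb_sum[OF fC CV, of "\<lambda>b. coord b x" "\<lambda>b. coord b y"] coord(1)
      by (simp add: lin(1)[OF that R.zero_closed])
    show "?p (c \<odot>\<^bsub>V\<^esub> x) = c \<odot>\<^bsub>V\<^esub> ?p x" if "c \<in> carrier K" "x \<in> carrier V" for c x
      using that lincomb_smult[OF CV, of "\<lambda>b. coord b x" c] coord(1)
      by (simp add: lin(2)[OF that(2,2,1)])
  qed (use 1 2 in auto)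
qed

text \<open>
  By the condition on the kernel, \<open>h\<close> factors through \<open>\<kappa>\<close> as a linear map on \<open>[L, N]\<close>, and \<open>\<sigma>\<close> is this
  map after a linear projection of \<open>L\<close> onto \<open>[L, N]\<close>.
\<close>

lemma (in lie_pair_tensor) linear_extension:
  assumes fd: "fin_dim" and P: "lie_algebra F P" and h: "h \<in> lie_hom F TT P"
    and ker: "\<And>t. \<lbrakk>t \<in> carrier TT; pair_kappa L t = \<zero>\<^bsub>L\<^esub>\<rbrakk> \<Longrightarrow> h t = \<zero>\<^bsub>P\<^esub>"
  obtains \<sigma> where "\<And>x. x \<in> carrier L \<Longrightarrow> \<sigma> x \<in> carrier P"
    "\<And>x y. \<lbrakk>x \<in> carrier L; y \<in> carrier L\<rbrakk> \<Longrightarrow> \<sigma> (x \<oplus>\<^bsub>L\<^esub> y) = \<sigma> x \<oplus>\<^bsub>P\<^esub> \<sigma> y"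
    "\<And>c x. \<lbrakk>c \<in> carrier F; x \<in> carrier L\<rbrakk> \<Longrightarrow> \<sigma> (c \<odot>\<^bsub>L\<^esub> x) = c \<odot>\<^bsub>P\<^esub> \<sigma> x"
    "\<And>t. t \<in> carrier TT \<Longrightarrow> \<sigma> (pair_kappa L t) = h t"
proof -
  interpret P: lie_algebra F P by fact
  note h' = lie_homD[OF h] lie_hom_neg[OF h TT.lie_algebra_axioms P]
  let ?W = "pair_kappa L ` carrier TT"
  have "submodule F ?W L"
  proof (rule submodule.intro)
    show "module F L" by (rule module_axioms)
    show "?W \<subseteq> carrier L" using kappa by auto
    show "\<zero>\<^bsub>L\<^esub> \<in> ?W" using kappa(5) TT.M.zero_closed by (metis imageI)
    show "v \<oplus>\<^bsub>L\<^esub> w \<in> ?W" if "v \<in> ?W" "w \<in> ?W" for v w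
      using that by (auto simp: kappa(2)[symmetric])
    show "c \<odot>\<^bsub>L\<^esub> v \<in> ?W" if "c \<in> carrier F" "v \<in> ?W" for c v
      using that by (auto simp: kappa(3)[symmetric])
  qed
  then have sW: "subspace F ?W L" by (simp add: subspace_def vectorspace_axioms)
  obtain p where p: "\<And>x. x \<in> carrier L \<Longrightarrow> p x \<in> ?W" "\<And>x. x \<in> ?W \<Longrightarrow> p x = x"
    "\<And>x y. \<lbrakk>x \<in> carrier L; y \<in> carrier L\<rbrakk> \<Longrightarrow> p (x \<oplus>\<^bsub>L\<^esub> y) = p x \<oplus>\<^bsub>L\<^esub> p y"
    "\<And>c x. \<lbrakk>c \<in> carrier F; x \<in> carrier L\<rbrakk> \<Longrightarrow> p (c \<odot>\<^bsub>L\<^esub> x) = c \<odot>\<^bsub>L\<^esub> p x"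
    apply (rule linear_projection[OF fd sW])
    subgoal premises q for p by (rule q(1); (rule q(2-); assumption))
    done
  define lift where "lift x = (SOME t. t \<in> carrier TT \<and> pair_kappa L t = p x)" for x
  have lift: "lift x \<in> carrier TT \<and> pair_kappa L (lift x) = p x" if "x \<in> carrier L" for x
  proof -
    have "\<exists>t. t \<in> carrier TT \<and> pair_kappa L t = p x"
      using p(1)[OF that] unfolding image_iff by (elim bexE) (intro exI conjI, assumption, simp)
    from someI_ex[OF this] show ?thesis unfolding lift_def .
  qed
  have wd: "h t = h s" if "t \<in> carrier TT" "s \<in> carrier TT" "pair_kappa L t = pair_kappa L s" for t s
  proof -
    have "pair_kappa L (t \<oplus>\<^bsub>TT\<^esub> \<ominus>\<^bsub>TT\<^esub> s) = \<zero>\<^bsub>L\<^esub>"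
      using that lie_hom_neg[OF kappa_hom TT.lie_algebra_axioms lie_algebra_axioms that(2)]
      by (simp add: kappa M.r_neg)
    then have "h t \<oplus>\<^bsub>P\<^esub> \<ominus>\<^bsub>P\<^esub> h s = \<zero>\<^bsub>P\<^esub>"
      using ker[of "t \<oplus>\<^bsub>TT\<^esub> \<ominus>\<^bsub>TT\<^esub> s"] that by (simp add: h')
    then show ?thesis
      using h'(1) that by (metis P.M.minus_equality P.M.minus_minus P.M.a_inv_closed)
  qed
  show thesis
  proof (rule that[of "\<lambda>x. h (lift x)"])
    show "h (lift x) \<in> carrier P" if "x \<in> carrier L" for x using lift that h' by blast
    show "h (lift (x \<oplus>\<^bsub>L\<^esub> y)) = h (lift x) \<oplus>\<^bsub>P\<^esub> h (lift y)"
      if "x \<in> carrier L" "y \<in> carrier L" for x y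
    proof -
      have "h (lift (x \<oplus>\<^bsub>L\<^esub> y)) = h (lift x \<oplus>\<^bsub>TT\<^esub> lift y)"
        using lift[OF that(1)] lift[OF that(2)] lift[of "x \<oplus>\<^bsub>L\<^esub> y"] that
        by (intro wd) (auto simp: kappa p)
      then show ?thesis using lift that by (simp add: h')
    qed
    show "h (lift (c \<odot>\<^bsub>L\<^esub> x)) = c \<odot>\<^bsub>P\<^esub> h (lift x)" if "c \<in> carrier F" "x \<in> carrier L" for c x
    proof -
      have "h (lift (c \<odot>\<^bsub>L\<^esub> x)) = h (c \<odot>\<^bsub>TT\<^esub> lift x)"
        using lift[OF that(2)] lift[of "c \<odot>\<^bsub>L\<^esub> x"] that by (intro wd) (auto simp: kappa p)
      then show ?thesis using lift that by (simp add: h')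
    qed
    show "h (lift (pair_kappa L t)) = h t" if "t \<in> carrier TT" for t
      using lift[of "pair_kappa L t"] that p(2)[of "pair_kappa L t"] kappa(1)
      by (intro wd) auto
  qed
qed


section \<open>The free product of two full pairs\<close>

locale full_free_pair = free_pair +
  assumes full: "N1 = carrier L1" "N2 = carrier L2"
begin

lemma N_full: "N = carrier FP"
  using sub_full full by simp

lemma in_N: "x \<in> carrier FP \<Longrightarrow> x \<in> N"
  and in_N1: "x1 \<in> carrier L1 \<Longrightarrow> x1 \<in> N1" and in_N2: "x2 \<in> carrier L2 \<Longrightarrow> x2 \<in> N2"
  using N_full full by simp_all

lemma sym_tens_bracket_left: "\<lbrakk>x \<in> N1; x' \<in> N1; y \<in> N2\<rbrakk> \<Longrightarrow> sym_tens (x \<otimes>\<^bsub>L1\<^esub> x') y = \<zero>\<^bsub>T\<^esub>"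
  using P.symmetrized_bracket[OF N_full, of "inl x" "inl x'" "inr y"] P1.N_sub
  by (simp add: sym_tens_def inl)

lemma sym_tens_bracket_right: "\<lbrakk>x \<in> N1; y \<in> N2; y' \<in> N2\<rbrakk> \<Longrightarrow> sym_tens x (y \<otimes>\<^bsub>L2\<^esub> y') = \<zero>\<^bsub>T\<^esub>"
  using P.symmetrized_bracket[OF N_full, of "inr y" "inr y'" "inl x"] P2.N_sub P2.N_closed(5)
  by (simp add: sym_tens_def inr P.TT.M.a_comm N_incl FP.bracket_closed P.N_closed)

sublocale free_pair_sym F L1 L2 N1 N2
proof
  show "sym_tens c y = \<zero>\<^bsub>T\<^esub>" if "c \<in> C1" "y \<in> N2" for c y
  proof -
    have "submodule F {c \<in> N1. sym_tens c y = \<zero>\<^bsub>T\<^esub>} L1"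
      using that P1.N_closed(1) by (intro submodule.intro)
        (auto simp: P1.N_closed P1.N_sub sym_tens_add_left sym_tens_smult_left sym_tens_zero A.module_axioms)
    moreover have "{u \<otimes>\<^bsub>L1\<^esub> v | u v. u \<in> N1 \<and> v \<in> carrier L1} \<subseteq> {c \<in> N1. sym_tens c y = \<zero>\<^bsub>T\<^esub>}"
      using that(2) by (auto simp: P1.N_bracket_left sym_tens_bracket_left in_N1)
    ultimately have "C1 \<subseteq> {c \<in> N1. sym_tens c y = \<zero>\<^bsub>T\<^esub>}"
      unfolding lie_commutator_def by (rule A.span_is_subset[rotated])
    then show ?thesis using that(1) by blast
  qed
  show "sym_tens x d = \<zero>\<^bsub>T\<^esub>" if "x \<in> N1" "d \<in> C2" for x d
  proof -
    have "submodule F {d \<in> N2. sym_tens x d = \<zero>\<^bsub>T\<^esub>} L2"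
      using that P2.N_closed(1) by (intro submodule.intro)
        (auto simp: P2.N_closed P2.N_sub sym_tens_add_right sym_tens_smult_right sym_tens_zero B.module_axioms)
    moreover have "{u \<otimes>\<^bsub>L2\<^esub> v | u v. u \<in> N2 \<and> v \<in> carrier L2} \<subseteq> {d \<in> N2. sym_tens x d = \<zero>\<^bsub>T\<^esub>}"
      using that(1) by (auto simp: P2.N_bracket_left sym_tens_bracket_right in_N2)
    ultimately have "C2 \<subseteq> {d \<in> N2. sym_tens x d = \<zero>\<^bsub>T\<^esub>}"
      unfolding lie_commutator_def by (rule B.span_is_subset[rotated])
    then show ?thesis using that(2) by blast
  qed
qed

text \<open>
  A homomorphism because brackets in \<open>W\<close> vanish and the defining relations of \<open>TD\<close> have commutators
  in one of the two arguments of \<open>ab_tens\<close>.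
\<close>

definition r3 where "r3 = lie_pres_lift WT (\<lambda>(l, n). ab_tens (fst l) (snd n))"

lemma r3_hom: "r3 \<in> lie_hom F TD WT"
  and r3_tens: "\<lbrakk>l \<in> carrier D; n \<in> N1 \<times> N2\<rbrakk> \<Longrightarrow> r3 (PD.tens l n) = ab_tens (fst l) (snd n)"
proof -
  have comm: "x \<otimes>\<^bsub>L1\<^esub> x' \<in> C1" if "x \<in> carrier L1" "x' \<in> carrier L1" for x x'
    using lie_commutator_ideal(3)[OF pair1] that in_N1 by blast
  have comm2: "y \<otimes>\<^bsub>L2\<^esub> y' \<in> C2" if "y \<in> carrier L2" "y' \<in> carrier L2" for y y'
    using lie_commutator_ideal(3)[OF pair2] that in_N2 by blast
  have mz: "\<ominus>\<^bsub>WT\<^esub> \<zero>\<^bsub>WT\<^esub> = \<zero>\<^bsub>WT\<^esub>" by (rule WT.M.minus_equality) simp_all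
  note simps = mz WT.lie_algebra_axioms ab_tens_linear ab_tens_C1 ab_tens_C2 comm comm2 in_N1 in_N2
    P1.N_sub P2.N_sub P1.N_closed P2.N_closed W_bracket
  note lift = PD.TT_lift[of WT "\<lambda>l n. ab_tens (fst l) (snd n)", folded r3_def]
  show "r3 \<in> lie_hom F TD WT"
    by (rule lift(1)) (auto simp: simps)
  show "r3 (PD.tens l n) = ab_tens (fst l) (snd n)" if "l \<in> carrier D" "n \<in> N1 \<times> N2"
    by (rule lift(2)) (use that in \<open>auto simp: simps\<close>)
qed

text \<open>
  The elements of the kernel of \<open>\<kappa>\<close> that decompose as desired; it turns out that all of them do. The
  summands from \<open>T1\<close> and \<open>T2\<close> are required to lie in the kernels of their commutator maps, which is
  what makes this set central and hence an ideal.
\<close>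

definition split_kernel where
  "split_kernel = {t. \<exists>t1 t2 w. t1 \<in> carrier T1 \<and> pair_kappa L1 t1 = \<zero>\<^bsub>L1\<^esub> \<and> t2 \<in> carrier T2 \<and>
     pair_kappa L2 t2 = \<zero>\<^bsub>L2\<^esub> \<and> w \<in> carrier WT \<and> t = i1 t1 \<oplus>\<^bsub>T\<^esub> i2 t2 \<oplus>\<^bsub>T\<^esub> sym_map w}"

lemma split_kernel_intro:
  "\<lbrakk>t1 \<in> carrier T1; pair_kappa L1 t1 = \<zero>\<^bsub>L1\<^esub>; t2 \<in> carrier T2; pair_kappa L2 t2 = \<zero>\<^bsub>L2\<^esub>;
    w \<in> carrier WT\<rbrakk> \<Longrightarrow> i1 t1 \<oplus>\<^bsub>T\<^esub> i2 t2 \<oplus>\<^bsub>T\<^esub> sym_map w \<in> split_kernel"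
  unfolding split_kernel_def by blast

lemma split_kernel_cases:
  assumes "t \<in> split_kernel"
  obtains t1 t2 w where "t1 \<in> carrier T1" "pair_kappa L1 t1 = \<zero>\<^bsub>L1\<^esub>" "t2 \<in> carrier T2"
    "pair_kappa L2 t2 = \<zero>\<^bsub>L2\<^esub>" "w \<in> carrier WT" "t = i1 t1 \<oplus>\<^bsub>T\<^esub> i2 t2 \<oplus>\<^bsub>T\<^esub> sym_map w"
  using assms unfolding split_kernel_def by (elim CollectE exE conjE)

lemma split_kernel_kappa: "t \<in> split_kernel \<Longrightarrow> t \<in> carrier T \<and> pair_kappa FP t = \<zero>\<^bsub>FP\<^esub>"
  by (erule split_kernel_cases) (auto simp: homs sym_map P.kappa i1(3) i2(3) sym_map_kappa inl inr)

lemma split_kernel_i1: "\<lbrakk>t \<in> carrier T1; pair_kappa L1 t = \<zero>\<^bsub>L1\<^esub>\<rbrakk> \<Longrightarrow> i1 t \<in> split_kernel"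
  using split_kernel_intro[of t "\<zero>\<^bsub>T2\<^esub>" "\<zero>\<^bsub>WT\<^esub>"] by (simp add: zeros sym_map homs P2.kappa)

lemma split_kernel_i2: "\<lbrakk>t \<in> carrier T2; pair_kappa L2 t = \<zero>\<^bsub>L2\<^esub>\<rbrakk> \<Longrightarrow> i2 t \<in> split_kernel"
  using split_kernel_intro[of "\<zero>\<^bsub>T1\<^esub>" t "\<zero>\<^bsub>WT\<^esub>"] by (simp add: zeros sym_map homs P1.kappa)

lemma split_kernel_sym_tens: "\<lbrakk>x \<in> N1; y \<in> N2\<rbrakk> \<Longrightarrow> sym_tens x y \<in> split_kernel"
  using split_kernel_intro[of "\<zero>\<^bsub>T1\<^esub>" "\<zero>\<^bsub>T2\<^esub>" "ab_tens x y"] by (simp add: zeros sym_map_ab_tens P1.kappa P2.kappa)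

lemma split_kernel_ideal: "lie_ideal F split_kernel T"
proof (rule lie_idealI)
  show "lie_algebra F T" by (rule P.TT.lie_algebra_axioms)
  show "split_kernel \<subseteq> carrier T" using split_kernel_kappa by blast
  show zero: "\<zero>\<^bsub>T\<^esub> \<in> split_kernel" using split_kernel_i1[of "\<zero>\<^bsub>T1\<^esub>"] by (simp add: zeros P1.kappa)
  show "x \<oplus>\<^bsub>T\<^esub> y \<in> split_kernel" if xy: "x \<in> split_kernel" "y \<in> split_kernel" for x y
  proof -
    obtain t1 t2 w where t: "t1 \<in> carrier T1" "pair_kappa L1 t1 = \<zero>\<^bsub>L1\<^esub>" "t2 \<in> carrier T2"
      "pair_kappa L2 t2 = \<zero>\<^bsub>L2\<^esub>" "w \<in> carrier WT" "x = i1 t1 \<oplus>\<^bsub>T\<^esub> i2 t2 \<oplus>\<^bsub>T\<^esub> sym_map w"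
      by (rule split_kernel_cases[OF xy(1)])
    obtain s1 s2 v where s: "s1 \<in> carrier T1" "pair_kappa L1 s1 = \<zero>\<^bsub>L1\<^esub>" "s2 \<in> carrier T2"
      "pair_kappa L2 s2 = \<zero>\<^bsub>L2\<^esub>" "v \<in> carrier WT" "y = i1 s1 \<oplus>\<^bsub>T\<^esub> i2 s2 \<oplus>\<^bsub>T\<^esub> sym_map v"
      by (rule split_kernel_cases[OF xy(2)])
    show ?thesis
      unfolding t(6) s(6) sum_decompositions[OF t(1,3,5) s(1,3,5)]
      by (rule split_kernel_intro) (use t s in \<open>auto simp: P1.kappa P2.kappa\<close>)
  qed
  show "c \<odot>\<^bsub>T\<^esub> x \<in> split_kernel" if c: "c \<in> carrier F" and x: "x \<in> split_kernel" for c x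
  proof -
    obtain t1 t2 w where t: "t1 \<in> carrier T1" "pair_kappa L1 t1 = \<zero>\<^bsub>L1\<^esub>" "t2 \<in> carrier T2"
      "pair_kappa L2 t2 = \<zero>\<^bsub>L2\<^esub>" "w \<in> carrier WT" "x = i1 t1 \<oplus>\<^bsub>T\<^esub> i2 t2 \<oplus>\<^bsub>T\<^esub> sym_map w"
      by (rule split_kernel_cases[OF x])
    show ?thesis
      unfolding t(6) smult_decomposition[OF t(1,3,5) c]
      by (rule split_kernel_intro) (use t c in \<open>auto simp: P1.kappa P2.kappa\<close>)
  qed
  show "x \<otimes>\<^bsub>T\<^esub> y \<in> split_kernel" if "x \<in> carrier T" "y \<in> split_kernel" for x y
    using P.bracket_TT_zero[OF that(1)] split_kernel_kappa[OF that(2)] zero by simp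
qed

sublocale QI: lie_quotient_algebra F T split_kernel
  by (simp add: lie_quotient_algebra_def lie_quotient_algebra_axioms_def P.TT.lie_algebra_axioms
    split_kernel_ideal)

lemmas split_kernel_closed = lie_idealD[OF split_kernel_ideal]

text \<open>
  For \<open>x\<close> and \<open>y\<close> in the same factor the symmetrized tensor comes from \<open>J2\<close> of this factor, for \<open>x\<close> and
  \<open>y\<close> in different factors it comes from \<open>W\<close>, and it vanishes if \<open>x\<close> or \<open>y\<close> is a bracket. Since the free
  product is generated by its factors, this suffices.
\<close>

lemma split_kernel_symmetric:
  assumes "x \<in> carrier FP" "y \<in> carrier FP"
  shows "P.tens x y \<oplus>\<^bsub>T\<^esub> P.tens y x \<in> split_kernel"
proof -
  define s where "s u v = P.tens u v \<oplus>\<^bsub>T\<^esub> P.tens v u" for u v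
  have tc: "P.tens u v \<in> carrier T" if "u \<in> carrier FP" "v \<in> carrier FP" for u v
    using that in_N by simp
  have comm: "s u v = s v u" if "u \<in> carrier FP" "v \<in> carrier FP" for u v
    using that tc by (simp add: s_def P.TT.M.a_comm)
  have s0: "s u \<zero>\<^bsub>FP\<^esub> \<in> split_kernel" if "u \<in> carrier FP" for u
    using that in_N split_kernel_closed(2) by (simp add: s_def)
  have s_add: "s u (v \<oplus>\<^bsub>FP\<^esub> v') \<in> split_kernel"
    if "u \<in> carrier FP" "v \<in> carrier FP" "v' \<in> carrier FP" "s u v \<in> split_kernel" "s u v' \<in> split_kernel" for u v v'
  proof -
    have "s u (v \<oplus>\<^bsub>FP\<^esub> v') = s u v \<oplus>\<^bsub>T\<^esub> s u v'"
      using that(1-3) in_N tc by (simp add: s_def P.tens_add_left P.tens_add_right P.TT.M.a_ac)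
    then show ?thesis using that split_kernel_closed(3) by simp
  qed
  have s_smult: "s u (c \<odot>\<^bsub>FP\<^esub> v) \<in> split_kernel"
    if "u \<in> carrier FP" "v \<in> carrier FP" "c \<in> carrier F" "s u v \<in> split_kernel" for u v c
  proof -
    have "s u (c \<odot>\<^bsub>FP\<^esub> v) = c \<odot>\<^bsub>T\<^esub> s u v"
      using that(1-3) in_N tc by (simp add: s_def P.tens_smult_left P.tens_smult_right P.TT.smult_r_distr)
    then show ?thesis using that split_kernel_closed(4) by simp
  qed
  have s_br: "s u (v \<otimes>\<^bsub>FP\<^esub> v') \<in> split_kernel"
    if "u \<in> carrier FP" "v \<in> carrier FP" "v' \<in> carrier FP" for u v v'
  proof -
    have "s (v \<otimes>\<^bsub>FP\<^esub> v') u = \<zero>\<^bsub>T\<^esub>"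
      using P.symmetrized_bracket[OF N_full that(2,3,1)] by (simp add: s_def)
    then show ?thesis using comm[of u "v \<otimes>\<^bsub>FP\<^esub> v'"] that split_kernel_closed(2) by (simp add: FP.bracket_closed)
  qed
  have extend: "s u y \<in> split_kernel" if u: "u \<in> carrier FP" "y \<in> carrier FP"
    and l: "\<And>z. z \<in> carrier L1 \<Longrightarrow> s u (inl z) \<in> split_kernel" and r: "\<And>z. z \<in> carrier L2 \<Longrightarrow> s u (inr z) \<in> split_kernel"
    for u y
    using u(2) by (induction rule: FP_induct) (auto intro: l r s0 s_add s_smult s_br u(1))
  have ll: "s (inl z) (inl z') \<in> split_kernel" if "z \<in> carrier L1" "z' \<in> carrier L1" for z z'
  proof -
    have "s (inl z) (inl z') = i1 (P1.tens z z' \<oplus>\<^bsub>T1\<^esub> P1.tens z' z)"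
      using that in_N1 by (simp add: s_def homs i1(2))
    then show ?thesis
      using that in_N1 A.bracket_swap[of z z']
      by (auto intro!: split_kernel_i1 simp: P1.kappa P1.kappa_tens A.bracket_closed A.M.r_neg)
  qed
  have rr: "s (inr z) (inr z') \<in> split_kernel" if "z \<in> carrier L2" "z' \<in> carrier L2" for z z'
  proof -
    have "s (inr z) (inr z') = i2 (P2.tens z z' \<oplus>\<^bsub>T2\<^esub> P2.tens z' z)"
      using that in_N2 by (simp add: s_def homs i2(2))
    then show ?thesis
      using that in_N2 B.bracket_swap[of z z']
      by (auto intro!: split_kernel_i2 simp: P2.kappa P2.kappa_tens B.bracket_closed B.M.r_neg)
  qed
  have lr: "s (inl z) (inr z') \<in> split_kernel" if "z \<in> carrier L1" "z' \<in> carrier L2" for z z'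
    using split_kernel_sym_tens[of z z'] that in_N1 in_N2 by (simp add: s_def sym_tens_def)
  have rl: "s (inr z') (inl z) \<in> split_kernel" if "z \<in> carrier L1" "z' \<in> carrier L2" for z z'
    using lr[OF that] comm[of "inl z" "inr z'"] that inl(1) inr(1) by simp
  have "s (inl z) y \<in> split_kernel" if "z \<in> carrier L1" for z
    by (rule extend[OF inl(1)[OF that] assms(2) ll[OF that] lr[OF that]])
  then have 1: "s y (inl z) \<in> split_kernel" if "z \<in> carrier L1" for z
    using that assms(2) inl(1) comm[of y "inl z"] by simp
  have "s (inr z) y \<in> split_kernel" if "z \<in> carrier L2" for z
    by (rule extend[OF inr(1)[OF that] assms(2) rl[OF _ that] rr[OF that]])
  then have 2: "s y (inr z) \<in> split_kernel" if "z \<in> carrier L2" for z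
    using that assms(2) inr(1) comm[of y "inr z"] by simp
  have "s y x \<in> split_kernel" by (rule extend[OF assms(2,1) 1 2])
  then show ?thesis using comm[OF assms] by (simp add: s_def)
qed

text \<open>
  As for the symmetrized tensors; on a bracket, \<open>[x, y] \<otimes> [x, y] = [x \<otimes> y, x \<otimes> y] = 0\<close>.
\<close>

lemma split_kernel_alternating: "x \<in> carrier FP \<Longrightarrow> P.tens x x \<in> split_kernel"
proof (induction rule: FP_induct)
  case (inl z)
  then show ?case
    using split_kernel_i1[of "P1.tens z z"] in_N1 by (simp add: i1(2) P1.kappa_tens A.bracket_self)
next
  case (inr z)
  then show ?case
    using split_kernel_i2[of "P2.tens z z"] in_N2 by (simp add: i2(2) P2.kappa_tens B.bracket_self)
next
  case zero
  then show ?case using in_N split_kernel_closed(2) by simp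
next
  case (add x y)
  have "P.tens (x \<oplus>\<^bsub>FP\<^esub> y) (x \<oplus>\<^bsub>FP\<^esub> y) =
      (P.tens x x \<oplus>\<^bsub>T\<^esub> P.tens y y) \<oplus>\<^bsub>T\<^esub> (P.tens x y \<oplus>\<^bsub>T\<^esub> P.tens y x)"
    using add(1,2) in_N by (simp add: P.tens_add_left P.tens_add_right P.TT.M.a_ac)
  then show ?case using add split_kernel_symmetric[of x y] split_kernel_closed(3) by simp
next
  case (smult c x)
  then show ?case using in_N split_kernel_closed(4) by (simp add: P.tens_smult_left P.tens_smult_right)
next
  case (bracket x y)
  have "P.tens (x \<otimes>\<^bsub>FP\<^esub> y) (x \<otimes>\<^bsub>FP\<^esub> y) = P.tens x y \<otimes>\<^bsub>T\<^esub> P.tens x y"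
    using bracket(1,2) in_N by (simp add: P.bracket_tens)
  then show ?case using bracket(1,2) in_N split_kernel_closed(2) by (simp add: P.TT.bracket_self)
qed

text \<open>
  The tensor modulo \<open>split_kernel\<close> is an alternating cocycle on the free product. It is a coboundary on
  both factors, so the corresponding central extension splits over both and, by the universal
  property, over the free product. The second component of the splitting is the map \<open>\<sigma>\<close> with
  \<open>q = \<sigma> \<kappa>\<close>.
\<close>

lemma kappa_kernel_decomposes:
  assumes fd: "vectorspace.fin_dim F L1" "vectorspace.fin_dim F L2"
    and t: "t \<in> carrier T" "pair_kappa FP t = \<zero>\<^bsub>FP\<^esub>"
  shows "t \<in> split_kernel"
proof -
  interpret Q: lie_algebra F QI.Q by (rule QI.lie_algebra_Q)
  let ?b = "\<lambda>x y. QI.q (P.tens x y)"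
  let ?E = "cocycle_extension FP QI.Q ?b"
  note q = lie_homD[OF QI.q_hom]
  have zq: "QI.q u = \<zero>\<^bsub>QI.Q\<^esub>" if "u \<in> split_kernel" for u
    unfolding QI.zero_Q by (rule QI.sub.a_rcos_const[OF that])
  have E: "lie_algebra F ?E"
  proof (rule lie_algebra_cocycle_extension[OF FP.lie_algebra_axioms QI.lie_algebra_Q])
    show "?b x x = \<zero>\<^bsub>QI.Q\<^esub>" if "x \<in> carrier FP" for x
      by (rule zq[OF split_kernel_alternating[OF that]])
    show "?b x (y \<otimes>\<^bsub>FP\<^esub> z) \<oplus>\<^bsub>QI.Q\<^esub> ?b y (z \<otimes>\<^bsub>FP\<^esub> x) \<oplus>\<^bsub>QI.Q\<^esub> ?b z (x \<otimes>\<^bsub>FP\<^esub> y) = \<zero>\<^bsub>QI.Q\<^esub>"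
      if xyz: "x \<in> carrier FP" "y \<in> carrier FP" "z \<in> carrier FP" for x y z
    proof -
      note bc = FP.bracket_closed
      have tc: "P.tens u v \<in> carrier T" if "u \<in> carrier FP" "v \<in> carrier FP" for u v
        using that in_N by simp
      have e1: "P.tens x (y \<otimes>\<^bsub>FP\<^esub> z) = P.tens (z \<otimes>\<^bsub>FP\<^esub> x) y \<oplus>\<^bsub>T\<^esub> P.tens (x \<otimes>\<^bsub>FP\<^esub> y) z"
        using xyz in_N P.tens_bracket_right[of x y z] FP.bracket_swap[of x y]
        by (simp add: P.tens_neg_left bc tc)
      have "P.tens x (y \<otimes>\<^bsub>FP\<^esub> z) \<oplus>\<^bsub>T\<^esub> P.tens y (z \<otimes>\<^bsub>FP\<^esub> x) \<oplus>\<^bsub>T\<^esub> P.tens z (x \<otimes>\<^bsub>FP\<^esub> y) =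
        (P.tens (z \<otimes>\<^bsub>FP\<^esub> x) y \<oplus>\<^bsub>T\<^esub> P.tens y (z \<otimes>\<^bsub>FP\<^esub> x)) \<oplus>\<^bsub>T\<^esub>
        (P.tens (x \<otimes>\<^bsub>FP\<^esub> y) z \<oplus>\<^bsub>T\<^esub> P.tens z (x \<otimes>\<^bsub>FP\<^esub> y))"
        unfolding e1 using xyz bc tc by (simp add: P.TT.M.a_ac)
      also have "\<dots> \<in> split_kernel" using xyz bc by (intro split_kernel_closed(3) split_kernel_symmetric) auto
      finally have "QI.q (P.tens x (y \<otimes>\<^bsub>FP\<^esub> z) \<oplus>\<^bsub>T\<^esub> P.tens y (z \<otimes>\<^bsub>FP\<^esub> x) \<oplus>\<^bsub>T\<^esub>
          P.tens z (x \<otimes>\<^bsub>FP\<^esub> y)) = \<zero>\<^bsub>QI.Q\<^esub>" by (rule zq)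
      moreover have "P.tens x (y \<otimes>\<^bsub>FP\<^esub> z) \<in> carrier T" "P.tens y (z \<otimes>\<^bsub>FP\<^esub> x) \<in> carrier T"
        "P.tens z (x \<otimes>\<^bsub>FP\<^esub> y) \<in> carrier T" using xyz bc tc by blast+
      ultimately show ?thesis by (simp only: q(2) P.TT.M.add.m_closed)
    qed
  qed (use in_N in \<open>auto simp: q P.tens_add_left P.tens_add_right P.tens_smult_left P.tens_smult_right\<close>)
  obtain \<sigma>1 where s1: "\<And>x. x \<in> carrier L1 \<Longrightarrow> \<sigma>1 x \<in> carrier QI.Q"
    "\<And>x y. \<lbrakk>x \<in> carrier L1; y \<in> carrier L1\<rbrakk> \<Longrightarrow> \<sigma>1 (x \<oplus>\<^bsub>L1\<^esub> y) = \<sigma>1 x \<oplus>\<^bsub>QI.Q\<^esub> \<sigma>1 y"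
    "\<And>c x. \<lbrakk>c \<in> carrier F; x \<in> carrier L1\<rbrakk> \<Longrightarrow> \<sigma>1 (c \<odot>\<^bsub>L1\<^esub> x) = c \<odot>\<^bsub>QI.Q\<^esub> \<sigma>1 x"
    "\<And>u. u \<in> carrier T1 \<Longrightarrow> \<sigma>1 (pair_kappa L1 u) = QI.q (i1 u)"
    apply (rule P1.linear_extension[OF fd(1) QI.lie_algebra_Q lie_hom_comp[OF i1(1) QI.q_hom]])
    subgoal by (intro zq split_kernel_i1)
    subgoal premises p for \<sigma> by (rule p(1); (rule p(2-); assumption))
    done
  obtain \<sigma>2 where s2: "\<And>x. x \<in> carrier L2 \<Longrightarrow> \<sigma>2 x \<in> carrier QI.Q"
    "\<And>x y. \<lbrakk>x \<in> carrier L2; y \<in> carrier L2\<rbrakk> \<Longrightarrow> \<sigma>2 (x \<oplus>\<^bsub>L2\<^esub> y) = \<sigma>2 x \<oplus>\<^bsub>QI.Q\<^esub> \<sigma>2 y"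
    "\<And>c x. \<lbrakk>c \<in> carrier F; x \<in> carrier L2\<rbrakk> \<Longrightarrow> \<sigma>2 (c \<odot>\<^bsub>L2\<^esub> x) = c \<odot>\<^bsub>QI.Q\<^esub> \<sigma>2 x"
    "\<And>u. u \<in> carrier T2 \<Longrightarrow> \<sigma>2 (pair_kappa L2 u) = QI.q (i2 u)"
    apply (rule P2.linear_extension[OF fd(2) QI.lie_algebra_Q lie_hom_comp[OF i2(1) QI.q_hom]])
    subgoal by (intro zq split_kernel_i2)
    subgoal premises p for \<sigma> by (rule p(1); (rule p(2-); assumption))
    done
  have b1: "\<sigma>1 (x \<otimes>\<^bsub>L1\<^esub> y) = ?b (inl x) (inl y)" if "x \<in> carrier L1" "y \<in> carrier L1" for x y
    using s1(4)[of "P1.tens x y"] that in_N1 by (simp add: P1.kappa_tens i1(2))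
  have b2: "\<sigma>2 (x \<otimes>\<^bsub>L2\<^esub> y) = ?b (inr x) (inr y)" if "x \<in> carrier L2" "y \<in> carrier L2" for x y
    using s2(4)[of "P2.tens x y"] that in_N2 by (simp add: P2.kappa_tens i2(2))
  have h1: "(\<lambda>x. (inl x, \<sigma>1 x)) \<in> lie_hom F L1 ?E"
    by (rule lie_homI) (auto simp: inl s1 b1)
  have h2: "(\<lambda>x. (inr x, \<sigma>2 x)) \<in> lie_hom F L2 ?E"
    by (rule lie_homI) (auto simp: inr s2 b2)
  define s where "s = lie_pres_lift ?E (case_sum (\<lambda>x. (inl x, \<sigma>1 x)) (\<lambda>x. (inr x, \<sigma>2 x)))"
  note s = FP_lift[OF E h1 h2, folded s_def]
  have fst_hom: "fst \<in> lie_hom F ?E FP" by (rule lie_homI) auto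
  have fst_s: "fst (s x) = x" if "x \<in> carrier FP" for x
    by (rule FP_hom_ext[OF lie_hom_comp[OF s(1) fst_hom] lie_hom_ident FP.lie_algebra_axioms _ _ that])
      (simp_all add: s)
  note s' = lie_homD[OF s(1)] lie_hom_zero[OF s(1) FP.lie_algebra_axioms E]
  have key: "QI.q u = snd (s (pair_kappa FP u))" if "u \<in> carrier T" for u
    using that
  proof (induction rule: P.TT_induct)
    case (tens l n)
    then show ?case using P.N_sub by (simp add: P.kappa_tens s' fst_s)
  next
    case zero
    show ?case by (simp add: P.kappa s' QI.q_zero)
  next
    case (add x y)
    then show ?case by (simp add: P.kappa s' q)
  next
    case (smult c x)
    then show ?case by (simp add: P.kappa s' q)
  qed
  have "QI.q t = \<zero>\<^bsub>QI.Q\<^esub>" using key[OF t(1)] by (simp add: t(2) s')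
  then show ?thesis unfolding QI.zero_Q using QI.q_zero_iff[OF t(1)] by blast
qed

lemma full_split:
  assumes fd: "vectorspace.fin_dim F L1" "vectorspace.fin_dim F L2"
  shows "free_pair_split F L1 L2 N1 N2 r3"
proof
  show "r3 \<in> lie_hom F TD WT" by (rule r3_hom)
  show "\<exists>t1\<in>carrier T1. \<exists>t2\<in>carrier T2. \<exists>w\<in>carrier WT. t = i1 t1 \<oplus>\<^bsub>T\<^esub> i2 t2 \<oplus>\<^bsub>T\<^esub> sym_map w"
    if "t \<in> carrier T" "pair_kappa FP t = \<zero>\<^bsub>FP\<^esub>" for t
    by (rule split_kernel_cases[OF kappa_kernel_decomposes[OF fd that]]) blast
qed (simp_all add: r3_tens ab_tens_C1 ab_tens_C2 zero_C in_N1 in_N2 zero_N P1.N_sub P2.N_sub)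

end

section \<open>The theorem\<close>

theorem theorem3p3:
  fixes F :: "'f ring"
    and L1 :: "('f, 'a) module" and N1 :: "'a set"
    and L2 :: "('f, 'b) module" and N2 :: "'b set"
  assumes "lie_pair F L1 N1" and "lie_pair F L2 N2"
    and "vectorspace.fin_dim F L1" and "vectorspace.fin_dim F L2"
    and "lie_pair F (lie_free_product F L1 L2) (lie_free_product_sub F L1 L2 N1 N2)"
  shows
    "lie_isomorphic F
       (J2 F (lie_free_product F L1 L2) (lie_free_product_sub F L1 L2 N1 N2))
       (lie_direct_sum (lie_direct_sum (J2 F L1 N1) (J2 F L2 N2))
         (lie_tensor_trivial F (pair_abelianization F L1 N1) (pair_abelianization F L2 N2)))
     \<and> lie_isomorphic F
         (pair_square F (lie_free_product F L1 L2) (lie_free_product_sub F L1 L2 N1 N2))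
         (pair_square F (lie_direct_sum L1 L2) (N1 \<times> N2))
     \<and> ((\<exists>K. lie_complement F L1 N1 K) \<and>
           lie_commutator F L1 N1 (carrier L1) = lie_commutator F L1 (carrier L1) (carrier L1)
         \<longrightarrow> lie_isomorphic F
               (schur_multiplier F (lie_free_product F L1 L2)
                 (lie_free_product_sub F L1 L2 N1 N2))
               (lie_direct_sum (schur_multiplier F L1 N1) (schur_multiplier F L2 N2)))"
proof -
  interpret lie_free_prod F L1 L2
    using assms by (simp add: lie_free_prod_def lie_pair_def)
  interpret free_pair F L1 L2 N1 N2
    by unfold_locales (use assms in auto)
  have cases: "(N1 = carrier L1 \<or> N2 = {\<zero>\<^bsub>L2\<^esub>}) \<and> (N2 = carrier L2 \<or> N1 = {\<zero>\<^bsub>L1\<^esub>})"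
    using sub_ideal_cases[OF assms(3,4) P1.ideal_N P2.ideal_N P.ideal_N] .
  have "\<exists>r. free_pair_split F L1 L2 N1 N2 r"
  proof (cases "N1 = carrier L1 \<and> N2 = carrier L2")
    case True
    then interpret full_free_pair F L1 L2 N1 N2 by unfold_locales auto
    show ?thesis using full_split[OF assms(3,4)] by blast
  next
    case False
    then show ?thesis using degenerate_split cases by blast
  qed
  then obtain r where "free_pair_split F L1 L2 N1 N2 r" by blast
  then interpret free_pair_split F L1 L2 N1 N2 r .
  show ?thesis
    using J2_isomorphic square_isomorphic multiplier_isomorphic by blast
qed

end
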